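(* Assume (C1) and simple randomization. Let $\hat b_1,\dots,\hat b_k$ be $p$-dimensional (possibly data-dependent) vectors with $\hat b_t\to b_t$ in probability as $n\to\infty$ for fixed vectors $b_t$, $t=1,\dots,k$, and put $B=(b_1,\dots,b_k)$. (i) As $n\to\infty$, $$\sqrt n\{\hat\theta(\hat b_1,\dots,\hat b_k)-\theta\}\to N(0,V_{\rm SR}(B))\quad\text{in distribution},$$ where $$V_{\rm SR}(B)=\mathrm{diag}\{\pi_t^{-1}\mathrm{var}(Y^{(t)}-b_t^\top X)\}+\mathscr B^\top\Sigma_X B+B^\top\Sigma_X\mathscr B-B^\top\Sigma_X B .$$ In particular this holds for $\hat\theta_{\rm AN}$ (with $b_t=0$), $\hat\theta_{\rm ANC}$ (with $b_t=\beta$) and $\hat\theta_{\rm ANHC}$ (with $b_t=\beta_t$). (ii) $V_{\rm SR}(B)-V_{\rm SR}(\mathscr B)$ is positive semidefinite for every $p\times k$ matrix $B$.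
   Context: Setup: a trial with $k$ treatment arms. For each patient there are potential responses $Y^{(1)},\dots,Y^{(k)}$ (real-valued), a discrete baseline covariate vector $Z$ and a $p$-dimensional baseline covariate vector $X$. Condition (C1): $(Y_i^{(1)},\dots,Y_i^{(k)},Z_i,X_i)$, $i=1,\dots,n$, are i.i.d. with finite second moments, the distribution of baseline covariates is not affected by treatment, and $\Sigma_X=\mathrm{var}(X_i)$ is positive definite. Let $\pi_1,\dots,\pi_k\in(0,1)$ with $\sum_t\pi_t=1$ be fixed assignment proportions. $a_t$ denotes the $t$-th standard basis vector of $\mathbb R^k$; $A_i\in\{a_1,\dots,a_k\}$ is patient $i$'s treatment indicator and the observed response is $Y_i=Y_i^{(t)}$ iff $A_i=a_t$. Simple randomization: $A_1,\dots,A_n$ are i.i.d., independent of all $(Y_i^{(1)},\dots,Y_i^{(k)},Z_i,X_i)$, with $P(A_i=a_t)=\pi_t$. Notation: $\theta=(\theta_1,\dots,\theta_k)^\top$ with $\theta_t=E(Y^{(t)})$; $\mu_X=E(X)$; $\beta_t=\Sigma_X^{-1}\mathrm{cov}(X,Y^{(t)})$; $\beta=\sum_t\pi_t\beta_t$; $\mathscr B=(\beta_1,\dots,\beta_k)$ (a $p\times k$ matrix); $\mathrm{diag}(d_t)$ is the $k\times k$ diagonal matrix with $t$-th diagonal entry $d_t$. $n_t$ is the number of patients with $A_i=a_t$; $\bar Y_t,\bar X_t$ are the sample means of $Y_i$, $X_i$ over patients with $A_i=a_t$; $\bar X$ is the mean of all $X_i$. For $p$-vectors $\hat b_1,\dots,\hat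 b_k$, $\hat\theta(\hat b_1,\dots,\hat b_k)=(\bar Y_1-\hat b_1^\top(\bar X_1-\bar X),\dots,\bar Y_k-\hat b_k^\top(\bar X_k-\bar X))^\top$. $\hat\theta_{\rm AN}$ takes $\hat b_t=0$; $\hat\theta_{\rm ANC}$ takes $\hat b_t=\hat\beta=\{\sum_t\sum_{i:A_i=a_t}(X_i-\bar X_t)(X_i-\bar X_t)^\top\}^{-1}\sum_t\sum_{i:A_i=a_t}(X_i-\bar X_t)Y_i$ for all $t$; $\hat\theta_{\rm ANHC}$ takes $\hat b_t=\hat\beta_t=\{\sum_{i:A_i=a_t}(X_i-\bar X_t)(X_i-\bar X_t)^\top\}^{-1}\sum_{i:A_i=a_t}(X_i-\bar X_t)Y_i$, or alternatively $\hat\beta_t=\frac{n}{n_t}\{\sum_{i=1}^n(X_i-\bar X)(X_i-\bar X)^\top\}^{-1}\sum_{i:A_i=a_t}(X_i-\bar X_t)Y_i$. *)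

theory Defs
  imports "HOL-Probability.Probability"
begin

definition conv_in_distr :: "(nat \<Rightarrow> 'b::euclidean_space measure) \<Rightarrow> 'b measure \<Rightarrow> bool" where
  "conv_in_distr \<mu>s \<nu> \<longleftrightarrow>
     (\<forall>f :: 'b \<Rightarrow> real. bounded (range f) \<and> continuous_on UNIV f \<longrightarrow>
        (\<lambda>n. integral\<^sup>L (\<mu>s n) f) \<longlonglongrightarrow> integral\<^sup>L \<nu> f)"

definition is_mvnormal :: "real^'k \<Rightarrow> real^'k^'k \<Rightarrow> (real^'k) measure \<Rightarrow> bool" where
  "is_mvnormal m V N \<longleftrightarrow> prob_space N \<and> sets N = sets borel \<and>
     (\<forall>c. distr N borel (\<lambda>x. c \<bullet> x) =
        (if c \<bullet> (V *v c) = 0 then return borel (c \<bullet> m)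
         else density lborel (normal_density (c \<bullet> m) (sqrt (c \<bullet> (V *v c))))))"

text \<open>Patients are indexed 0,1,2,...; with n patients the sample is i < n.
  Treatment assignment A i w is the label t of the arm (A_i = a_t).\<close>

definition arm :: "(nat \<Rightarrow> 'a \<Rightarrow> 'k) \<Rightarrow> nat \<Rightarrow> 'a \<Rightarrow> 'k \<Rightarrow> nat set" where
  "arm A n w t = {i. i < n \<and> A i w = t}"

definition ntr :: "(nat \<Rightarrow> 'a \<Rightarrow> 'k) \<Rightarrow> nat \<Rightarrow> 'a \<Rightarrow> 'k \<Rightarrow> nat" where
  "ntr A n w t = card (arm A n w t)"

definition Yobs :: "(nat \<Rightarrow> 'a \<Rightarrow> real^'k) \<Rightarrow> (nat \<Rightarrow> 'a \<Rightarrow> 'k) \<Rightarrow> nat \<Rightarrow> 'a \<Rightarrow> real" where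
  "Yobs Yp A i w = Yp i w $ A i w"

definition Ybar :: "(nat \<Rightarrow> 'a \<Rightarrow> real^'k) \<Rightarrow> (nat \<Rightarrow> 'a \<Rightarrow> 'k) \<Rightarrow> nat \<Rightarrow> 'a \<Rightarrow> 'k \<Rightarrow> real" where
  "Ybar Yp A n w t = (\<Sum>i\<in>arm A n w t. Yobs Yp A i w) / real (ntr A n w t)"

definition Xbar_arm :: "(nat \<Rightarrow> 'a \<Rightarrow> real^'p) \<Rightarrow> (nat \<Rightarrow> 'a \<Rightarrow> 'k) \<Rightarrow> nat \<Rightarrow> 'a \<Rightarrow> 'k \<Rightarrow> real^'p" where
  "Xbar_arm X A n w t = (1 / real (ntr A n w t)) *\<^sub>R (\<Sum>i\<in>arm A n w t. X i w)"

definition Xbar :: "(nat \<Rightarrow> 'a \<Rightarrow> real^'p) \<Rightarrow> nat \<Rightarrow> 'a \<Rightarrow> real^'p" where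
  "Xbar X n w = (1 / real n) *\<^sub>R (\<Sum>i<n. X i w)"

definition theta_hat :: "(nat \<Rightarrow> 'a \<Rightarrow> real^'k) \<Rightarrow> (nat \<Rightarrow> 'a \<Rightarrow> real^'p) \<Rightarrow> (nat \<Rightarrow> 'a \<Rightarrow> 'k)
     \<Rightarrow> ('k \<Rightarrow> real^'p) \<Rightarrow> nat \<Rightarrow> 'a \<Rightarrow> real^'k" where
  "theta_hat Yp X A bh n w =
     (\<chi> t. Ybar Yp A n w t - bh t \<bullet> (Xbar_arm X A n w t - Xbar X n w))"

definition outer :: "real^'p \<Rightarrow> real^'p \<Rightarrow> real^'p^'p" where
  "outer u v = (\<chi> i j. u $ i * v $ j)"

definition beta_hat_ANC :: "(nat \<Rightarrow> 'a \<Rightarrow> real^'k) \<Rightarrow> (nat \<Rightarrow> 'a \<Rightarrow> real^'p) \<Rightarrow> (nat \<Rightarrow> 'a \<Rightarrow> 'k::finite)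
     \<Rightarrow> nat \<Rightarrow> 'a \<Rightarrow> real^'p" where
  "beta_hat_ANC Yp X A n w =
     matrix_inv (\<Sum>t\<in>UNIV. \<Sum>i\<in>arm A n w t.
                   outer (X i w - Xbar_arm X A n w t) (X i w - Xbar_arm X A n w t))
     *v (\<Sum>t\<in>UNIV. \<Sum>i\<in>arm A n w t. Yobs Yp A i w *\<^sub>R (X i w - Xbar_arm X A n w t))"

definition beta_hat_ANHC :: "(nat \<Rightarrow> 'a \<Rightarrow> real^'k) \<Rightarrow> (nat \<Rightarrow> 'a \<Rightarrow> real^'p) \<Rightarrow> (nat \<Rightarrow> 'a \<Rightarrow> 'k)
     \<Rightarrow> nat \<Rightarrow> 'a \<Rightarrow> 'k \<Rightarrow> real^'p" where
  "beta_hat_ANHC Yp X A n w t =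
     matrix_inv (\<Sum>i\<in>arm A n w t.
                   outer (X i w - Xbar_arm X A n w t) (X i w - Xbar_arm X A n w t))
     *v (\<Sum>i\<in>arm A n w t. Yobs Yp A i w *\<^sub>R (X i w - Xbar_arm X A n w t))"

definition beta_hat_ANHC' :: "(nat \<Rightarrow> 'a \<Rightarrow> real^'k) \<Rightarrow> (nat \<Rightarrow> 'a \<Rightarrow> real^'p) \<Rightarrow> (nat \<Rightarrow> 'a \<Rightarrow> 'k)
     \<Rightarrow> nat \<Rightarrow> 'a \<Rightarrow> 'k \<Rightarrow> real^'p" where
  "beta_hat_ANHC' Yp X A n w t =
     (real n / real (ntr A n w t)) *\<^sub>R
     (matrix_inv (\<Sum>i<n. outer (X i w - Xbar X n w) (X i w - Xbar X n w))
      *v (\<Sum>i\<in>arm A n w t. Yobs Yp A i w *\<^sub>R (X i w - Xbar_arm X A n w t)))"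

section \<open>Population quantities (computed from patient 0; all patients are i.i.d.)\<close>

definition theta :: "'a measure \<Rightarrow> (nat \<Rightarrow> 'a \<Rightarrow> real^'k) \<Rightarrow> real^'k" where
  "theta M Yp = (\<chi> t. integral\<^sup>L M (\<lambda>w. Yp 0 w $ t))"

definition mu_X :: "'a measure \<Rightarrow> (nat \<Rightarrow> 'a \<Rightarrow> real^'p) \<Rightarrow> real^'p" where
  "mu_X M X = (\<chi> j. integral\<^sup>L M (\<lambda>w. X 0 w $ j))"

definition Sigma_X :: "'a measure \<Rightarrow> (nat \<Rightarrow> 'a \<Rightarrow> real^'p) \<Rightarrow> real^'p^'p" where
  "Sigma_X M X = (\<chi> i j. integral\<^sup>L M (\<lambda>w. (X 0 w $ i - mu_X M X $ i) * (X 0 w $ j - mu_X M X $ j)))"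

definition cov_XY :: "'a measure \<Rightarrow> (nat \<Rightarrow> 'a \<Rightarrow> real^'k) \<Rightarrow> (nat \<Rightarrow> 'a \<Rightarrow> real^'p) \<Rightarrow> 'k \<Rightarrow> real^'p" where
  "cov_XY M Yp X t = (\<chi> j. integral\<^sup>L M (\<lambda>w. (X 0 w $ j - mu_X M X $ j) * (Yp 0 w $ t - theta M Yp $ t)))"

definition beta :: "'a measure \<Rightarrow> (nat \<Rightarrow> 'a \<Rightarrow> real^'k) \<Rightarrow> (nat \<Rightarrow> 'a \<Rightarrow> real^'p) \<Rightarrow> 'k \<Rightarrow> real^'p" where
  "beta M Yp X t = matrix_inv (Sigma_X M X) *v cov_XY M Yp X t"

definition beta_bar :: "'a measure \<Rightarrow> (nat \<Rightarrow> 'a \<Rightarrow> real^'k::finite) \<Rightarrow> (nat \<Rightarrow> 'a \<Rightarrow> real^'p) \<Rightarrow> ('k \<Rightarrow> real) \<Rightarrow> real^'p" where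
  "beta_bar M Yp X \<pi> = (\<Sum>t\<in>UNIV. \<pi> t *\<^sub>R beta M Yp X t)"

definition var :: "'a measure \<Rightarrow> ('a \<Rightarrow> real) \<Rightarrow> real" where
  "var M f = integral\<^sup>L M (\<lambda>w. (f w - integral\<^sup>L M f)\<^sup>2)"

definition V_SR :: "'a measure \<Rightarrow> (nat \<Rightarrow> 'a \<Rightarrow> real^'k) \<Rightarrow> (nat \<Rightarrow> 'a \<Rightarrow> real^'p) \<Rightarrow> ('k \<Rightarrow> real)
     \<Rightarrow> ('k \<Rightarrow> real^'p) \<Rightarrow> real^'k^'k" where
  "V_SR M Yp X \<pi> b = (\<chi> t s.
      (if t = s then var M (\<lambda>w. Yp 0 w $ t - b t \<bullet> X 0 w) / \<pi> t else 0)
      + beta M Yp X t \<bullet> (Sigma_X M X *v b s)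
      + b t \<bullet> (Sigma_X M X *v beta M Yp X s)
      - b t \<bullet> (Sigma_X M X *v b s))"

definition law_est :: "'a measure \<Rightarrow> (nat \<Rightarrow> 'a \<Rightarrow> real^'k) \<Rightarrow> (nat \<Rightarrow> 'a \<Rightarrow> real^'p) \<Rightarrow> (nat \<Rightarrow> 'a \<Rightarrow> 'k)
     \<Rightarrow> (nat \<Rightarrow> 'a \<Rightarrow> 'k \<Rightarrow> real^'p) \<Rightarrow> nat \<Rightarrow> (real^'k) measure" where
  "law_est M Yp X A bh n =
     distr M borel (\<lambda>w. sqrt (real n) *\<^sub>R (theta_hat Yp X A (bh n w) n w - theta M Yp))"

end

theory Submission
  imports Defs
begin

text \<open>
  Up to a term that vanishes in probability, the scaled estimation error is the normalised sum of the
  i.i.d. influence vectors with components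
  \<open>1{A = t} (Y\<^sup>t - \<theta>\<^sub>t - b\<^sub>t \<bullet> (X - \<mu>)) / \<pi>\<^sub>t + b\<^sub>t \<bullet> (X - \<mu>)\<close>, whose covariance matrix is
  \<open>V_SR\<close> because \<open>A\<close> is independent of \<open>(Y, X)\<close>. The multivariate central limit theorem follows from the
  real one: the real theorem gives convergence of expectations of trigonometric polynomials, and by tightness
  bounded continuous functions can be replaced by such polynomials. The estimated regression coefficients are
  consistent by the weak law of large numbers and Cramer's rule. The difference \<open>V_SR(B) - V_SR(\<B>)\<close> is, as a
  quadratic form in \<open>c\<close>, a \<open>\<pi>\<close>-weighted variance of the vectors
  \<open>(c\<^sub>t / \<pi>\<^sub>t) (\<beta>\<^sub>t - b\<^sub>t)\<close>, hence nonnegative.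
\<close>

section \<open>Centred Gaussian vectors\<close>

lemma symmetric_matrix_inner_commute:
  fixes V :: "real^'n^'n"
  assumes "\<And>i j. V $ i $ j = V $ j $ i"
  shows "u \<bullet> (V *v v) = v \<bullet> (V *v u)"
proof -
  have "transpose V = V" using assms by (simp add: transpose_def vec_eq_iff)
  then show ?thesis
    by (metis dot_lmul_matrix inner_commute transpose_matrix_vector)
qed

lemma matrix_vector_mult_axis: "(V :: real^'n^'m) *v axis s 1 = (\<chi> i. V $ i $ s)"
  by (simp add: vec_eq_iff matrix_vector_mult_def axis_def if_distrib cong: if_cong)

text \<open>Cholesky elimination: subtracting the rank-one matrix built from column \<open>s\<close> clears row and column \<open>s\<close>
  and preserves positive semidefiniteness.\<close>

lemma psd_gram_decomposition:
  fixes V :: "real^'n^'n" and S :: "'n set"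
  assumes "finite S"
    and "\<And>i j. V $ i $ j = V $ j $ i" "\<And>c. 0 \<le> c \<bullet> (V *v c)" "\<And>i j. i \<notin> S \<Longrightarrow> V $ i $ j = 0"
  shows "\<exists>w. \<forall>i j. V $ i $ j = (\<Sum>l\<in>S. w l $ i * (w l :: real^'n) $ j)"
  using assms
proof (induction S arbitrary: V rule: finite_induct)
  case empty
  then show ?case by simp
next
  case (insert s S)
  note sym = insert.prems(1) and psd = insert.prems(2) and supp = insert.prems(3)
  let ?e = "axis s 1 :: real^'n"
  have q: "(c - r *\<^sub>R ?e) \<bullet> (V *v (c - r *\<^sub>R ?e)) = c \<bullet> (V *v c) - 2 * r * (V *v c) $ s + r\<^sup>2 * V $ s $ s" for c r
  proof -
    have "c \<bullet> (V *v ?e) = (V *v c) $ s"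
      by (subst symmetric_matrix_inner_commute[OF sym]) (simp add: inner_axis' )
    moreover have "?e \<bullet> (V *v ?e) = V $ s $ s"
      by (simp add: inner_axis' matrix_vector_mult_axis)
    moreover have "?e \<bullet> (V *v c) = (V *v c) $ s" by (simp add: inner_axis')
    ultimately show ?thesis
      by (simp add: matrix_vector_mult_diff_distrib matrix_vector_mult_scaleR inner_diff_left inner_diff_right power2_eq_square algebra_simps)
  qed
  have Vss: "0 \<le> V $ s $ s" using psd[of ?e] by (simp add: inner_axis' matrix_vector_mult_axis)
  show ?case
  proof (cases "V $ s $ s = 0")
    case True
    have row: "V $ s $ j = 0" for j
    proof (rule ccontr)
      assume nz: "V $ s $ j \<noteq> 0"
      let ?c = "axis j 1 :: real^'n"
      have j: "?c \<bullet> (V *v ?c) = V $ j $ j" "(V *v ?c) $ s = V $ s $ j"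
        by (simp_all add: inner_axis' matrix_vector_mult_axis)
      have "0 \<le> V $ j $ j - 2 * r * V $ s $ j" for r
        using psd[of "?c - r *\<^sub>R ?e"] by (simp only: q j) (simp add: True)
      from this[of "(V $ j $ j + 1) / (2 * V $ s $ j)"] nz show False by simp
    qed
    have "V $ i $ j = 0" if "i \<notin> S" for i j
      using supp[of i j] row[of j] that by (cases "i = s") auto
    from insert.IH[OF sym psd this] obtain w where w: "\<And>i j. V $ i $ j = (\<Sum>l\<in>S. w l $ i * w l $ j)"
      by blast
    have "V $ i $ j = (\<Sum>l\<in>insert s S. (w(s := 0)) l $ i * (w(s := 0)) l $ j)" for i j
      using insert.hyps w by (simp add: sum.insert) (intro sum.cong, auto)
    then show ?thesis by blast
  next
    case False
    with Vss have pos: "0 < V $ s $ s" by simp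
    define W :: "real^'n^'n" where "W = (\<chi> i j. V $ i $ j - V $ i $ s * V $ s $ j / V $ s $ s)"
    have Wc: "W *v c = V *v c - ((V *v c) $ s / V $ s $ s) *\<^sub>R (V *v ?e)" for c
      by (simp add: W_def vec_eq_iff matrix_vector_mult_axis)
         (simp add: matrix_vector_mult_def left_diff_distrib right_diff_distrib sum_subtractf sum_distrib_left sum_divide_distrib mult_ac)
    have "0 \<le> c \<bullet> (W *v c)" for c
    proof -
      let ?r = "(V *v c) $ s / V $ s $ s"
      have "c \<bullet> (V *v ?e) = (V *v c) $ s"
        by (subst symmetric_matrix_inner_commute[OF sym]) (simp add: inner_axis' )
      then have "c \<bullet> (W *v c) = (c - ?r *\<^sub>R ?e) \<bullet> (V *v (c - ?r *\<^sub>R ?e))"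
        unfolding q Wc using pos by (simp add: inner_diff_right power2_eq_square field_simps)
      with psd show ?thesis by simp
    qed
    moreover have "W $ i $ j = W $ j $ i" for i j
      using sym[of i j] sym[of i s] sym[of j s] by (simp add: W_def mult_ac)
    moreover have "W $ i $ j = 0" if "i \<notin> S" for i j
      using supp[of i j] supp[of i s] that pos by (cases "i = s") (auto simp: W_def)
    ultimately obtain w where w: "\<And>i j. W $ i $ j = (\<Sum>l\<in>S. w l $ i * w l $ j)"
      using insert.IH[of W] by blast
    define u where "u = w(s := (1 / sqrt (V $ s $ s)) *\<^sub>R (V *v ?e))"
    have "V $ i $ j = (\<Sum>l\<in>insert s S. u l $ i * u l $ j)" for i j
    proof -
      have "(\<Sum>l\<in>insert s S. u l $ i * u l $ j) = u s $ i * u s $ j + (\<Sum>l\<in>S. u l $ i * u l $ j)"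
        using insert.hyps by simp
      also have "(\<Sum>l\<in>S. u l $ i * u l $ j) = W $ i $ j"
        unfolding w using insert.hyps by (intro sum.cong) (auto simp: u_def)
      also have "u s $ i * u s $ j = V $ i $ s * V $ j $ s / V $ s $ s"
        using pos by (simp add: u_def matrix_vector_mult_axis)
      finally show ?thesis using sym[of j s] by (simp add: W_def)
    qed
    then show ?thesis by blast
  qed
qed

lemma mvnormal_exists:
  fixes V :: "real^'k^'k"
  assumes sym: "\<And>i j. V $ i $ j = V $ j $ i" and psd: "\<And>c. 0 \<le> c \<bullet> (V *v c)"
  shows "\<exists>N. is_mvnormal 0 V N"
proof -
  from psd_gram_decomposition[OF finite_class.finite_UNIV sym psd] obtain w :: "'k \<Rightarrow> real^'k"
    where w: "\<And>i j. V $ i $ j = (\<Sum>l\<in>UNIV. w l $ i * w l $ j)" by auto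
  have quad: "c \<bullet> (V *v c) = (\<Sum>l\<in>UNIV. (c \<bullet> w l)\<^sup>2)" for c
  proof -
    have "c \<bullet> (V *v c) = (\<Sum>i\<in>UNIV. \<Sum>j\<in>UNIV. \<Sum>l\<in>UNIV. (c $ i * w l $ i) * (c $ j * w l $ j))"
      by (simp add: inner_vec_def matrix_vector_mult_def w sum_distrib_left sum_distrib_right mult_ac)
    also have "\<dots> = (\<Sum>l\<in>UNIV. \<Sum>i\<in>UNIV. \<Sum>j\<in>UNIV. (c $ i * w l $ i) * (c $ j * w l $ j))"
      by (rule trans[OF sum.cong[OF refl sum.swap] sum.swap])
    also have "\<dots> = (\<Sum>l\<in>UNIV. (c \<bullet> w l)\<^sup>2)"
      by (simp add: inner_vec_def power2_eq_square sum_product)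
    finally show ?thesis .
  qed
  define Q where "Q = Pi\<^sub>M (UNIV :: 'k set) (\<lambda>_. std_normal_distribution)"
  interpret std: prob_space std_normal_distribution
    by (rule prob_space_normal_density) simp
  interpret Q: prob_space Q
    unfolding Q_def by (intro prob_space_PiM std.prob_space_axioms)
  have [measurable_cong]: "sets Q = sets (Pi\<^sub>M UNIV (\<lambda>_. borel))"
    unfolding Q_def by (intro sets_PiM_cong) auto
  have comp: "distr Q borel (\<lambda>x. x i) = std_normal_distribution" for i
  proof -
    have "distr Q std_normal_distribution (\<lambda>x. x i) = std_normal_distribution"
      unfolding Q_def by (rule distr_PiM_component) (auto intro: std.prob_space_axioms)
    also have "distr Q std_normal_distribution (\<lambda>x. x i) = distr Q borel (\<lambda>x. x i)"
      by (intro distr_cong) auto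
    finally show ?thesis .
  qed
  have indep: "Q.indep_vars (\<lambda>_. borel) (\<lambda>i x. x i) (UNIV :: 'k set)"
  proof (subst Q.indep_vars_iff_distr_eq_PiM')
    have "distr Q (Pi\<^sub>M UNIV (\<lambda>_. borel)) (\<lambda>x. \<lambda>i\<in>UNIV. x i) = distr Q Q (\<lambda>x. x)"
      by (intro distr_cong) (auto simp: \<open>sets Q = _\<close>)
    then show "distr Q (Pi\<^sub>M UNIV (\<lambda>_. borel)) (\<lambda>x. \<lambda>i\<in>UNIV. x i) = (\<Pi>\<^sub>M i\<in>UNIV. distr Q borel (\<lambda>x. x i))"
      by (simp add: comp Q_def[symmetric])
  qed auto
  define G where "G x = (\<Sum>l\<in>UNIV. x l *\<^sub>R w l)" for x :: "'k \<Rightarrow> real"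
  have G [measurable]: "G \<in> borel_measurable Q" unfolding G_def by measurable
  have proj: "distr Q borel (\<lambda>x. c \<bullet> G x) =
      (if c \<bullet> (V *v c) = 0 then return borel 0
       else density lborel (normal_density 0 (sqrt (c \<bullet> (V *v c)))))" for c
  proof -
    let ?J = "{l. c \<bullet> w l \<noteq> 0}"
    have cG: "c \<bullet> G x = (\<Sum>l\<in>?J. (c \<bullet> w l) * x l)" for x
      unfolding G_def inner_sum_right by (intro sum.mono_neutral_cong_right) (auto simp: mult_ac)
    have cV: "c \<bullet> (V *v c) = (\<Sum>l\<in>?J. \<bar>c \<bullet> w l\<bar>\<^sup>2)"
      unfolding quad by (intro sum.mono_neutral_cong_right) auto
    show ?thesis
    proof (cases "?J = {}")
      case True
      have "distr Q borel (\<lambda>x. c \<bullet> G x) = return borel 0"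
        unfolding cG True by (simp add: Q.distr_const)
      then show ?thesis using cV True by simp
    next
      case False
      have "Q.indep_vars (\<lambda>_. borel) (\<lambda>l x. (c \<bullet> w l) * x l) ?J"
        by (rule Q.indep_vars_compose2[where M' = "\<lambda>_. borel" and Y = "\<lambda>l y. (c \<bullet> w l) * y"])
           (auto intro: Q.indep_vars_subset[OF indep])
      moreover have "distributed Q lborel (\<lambda>x. (c \<bullet> w l) * x l) (normal_density 0 \<bar>c \<bullet> w l\<bar>)" if "l \<in> ?J" for l
      proof -
        have "distributed Q lborel (\<lambda>x. x l) (normal_density 0 1)"
          unfolding distributed_def using comp[of l] 
          by (auto simp: distr_cong[of Q Q lborel borel] cong: distr_cong)
        from Q.normal_density_affine[OF this, of "c \<bullet> w l" 0] that show ?thesis by simp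
      qed
      ultimately have "distributed Q lborel (\<lambda>x. \<Sum>l\<in>?J. (c \<bullet> w l) * x l)
          (normal_density (\<Sum>l\<in>?J. 0) (sqrt (\<Sum>l\<in>?J. \<bar>c \<bullet> w l\<bar>\<^sup>2)))"
        using False by (intro Q.sum_indep_normal) auto
      then have "distr Q lborel (\<lambda>x. c \<bullet> G x) = density lborel (normal_density 0 (sqrt (c \<bullet> (V *v c))))"
        unfolding cG cV by (simp add: distributed_def)
      moreover have "distr Q lborel (\<lambda>x. c \<bullet> G x) = distr Q borel (\<lambda>x. c \<bullet> G x)"
        by (intro distr_cong) auto
      moreover have "c \<bullet> (V *v c) \<noteq> 0"
        using False unfolding cV by (subst sum_nonneg_eq_0_iff) auto
      ultimately show ?thesis by simp
    qed
  qed
  have "is_mvnormal 0 V (distr Q borel G)"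
    unfolding is_mvnormal_def
  proof (intro conjI allI)
    show "prob_space (distr Q borel G)" by (rule Q.prob_space_distr) simp
    fix c show "distr (distr Q borel G) borel ((\<bullet>) c) =
         (if c \<bullet> (V *v c) = 0 then return borel (c \<bullet> 0)
          else density lborel (\<lambda>x. ennreal (normal_density (c \<bullet> 0) (sqrt (c \<bullet> (V *v c))) x)))"
      using proj[of c] by (subst distr_distr) (auto simp: comp_def)
  qed simp
  then show ?thesis by blast
qed

section \<open>Convergence in distribution from trigonometric test functions\<close>

inductive trig_poly :: "('b::real_inner \<Rightarrow> real) \<Rightarrow> bool" where
  cosine: "trig_poly (\<lambda>x. a * cos (c \<bullet> x + d))"
| add: "trig_poly f \<Longrightarrow> trig_poly g \<Longrightarrow> trig_poly (\<lambda>x. f x + g x)"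

lemma trig_poly_const: "trig_poly (\<lambda>x. a)"
  using trig_poly.cosine[of a 0 0] by simp

lemma trig_poly_sine: "trig_poly (\<lambda>x. a * sin (c \<bullet> x))"
  using trig_poly.cosine[of a c "- pi / 2"] by (simp add: cos_diff)

lemma trig_poly_sum:
  assumes "finite I" "\<And>i. i \<in> I \<Longrightarrow> trig_poly (f i)"
  shows "trig_poly (\<lambda>x. \<Sum>i\<in>I. f i x)"
  using assms by (induction I rule: finite_induct) (auto intro: trig_poly_const trig_poly.add)

lemma trig_poly_mult:
  assumes "trig_poly f" "trig_poly g"
  shows "trig_poly (\<lambda>x. f x * g x)"
  using assms(1)
proof induction
  case (cosine a c d)
  show ?case using assms(2)
  proof induction
    case (cosine b c' d')
    have "a * cos (c \<bullet> x + d) * (b * cos (c' \<bullet> x + d')) =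
        (a * b / 2) * cos ((c + c') \<bullet> x + (d + d')) + (a * b / 2) * cos ((c - c') \<bullet> x + (d - d'))" for x
      using cos_times_cos[of "c \<bullet> x + d" "c' \<bullet> x + d'"]
      by (simp add: inner_add_left inner_diff_left field_simps)
    then show ?case by (simp only:) (intro trig_poly.intros)
  next
    case (add f g)
    then show ?case by (simp add: distrib_left trig_poly.add)
  qed
next
  case (add f g)
  then show ?case by (simp add: distrib_right trig_poly.add)
qed

lemma trig_poly_bounded_continuous:
  assumes "trig_poly f"
  shows "continuous_on UNIV f \<and> (\<exists>B. \<forall>x. \<bar>f x\<bar> \<le> B)"
  using assms
proof induction
  case (cosine a c d)
  have "\<bar>a * cos (c \<bullet> x + d)\<bar> \<le> \<bar>a\<bar>" for x
    by (simp add: abs_mult mult_left_le)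
  then show ?case by (auto intro!: continuous_intros)
next
  case (add f g)
  then obtain B C where "\<And>x. \<bar>f x\<bar> \<le> B" "\<And>x. \<bar>g x\<bar> \<le> C" by blast
  then have "\<bar>f x + g x\<bar> \<le> B + C" for x by (meson abs_triangle_ineq add_mono order_trans)
  then show ?case using add by (auto intro!: continuous_intros)
qed

lemma bounded_continuous_integrable:
  fixes f :: "'b::euclidean_space \<Rightarrow> real"
  assumes "prob_space \<mu>" "sets \<mu> = sets borel" "continuous_on UNIV f" "\<And>x. \<bar>f x\<bar> \<le> B"
  shows "integrable \<mu> f"
proof -
  interpret prob_space \<mu> by fact
  have "f \<in> borel_measurable \<mu>"
    using borel_measurable_continuous_onI[OF assms(3)] measurable_cong_sets[OF assms(2) refl] by blast
  then show ?thesis by (rule integrable_const_bound[rotated]) (use assms(4) in auto)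
qed

lemma trig_poly_integral_tendsto:
  fixes \<mu>s :: "nat \<Rightarrow> 'b::euclidean_space measure"
  assumes "\<And>n. prob_space (\<mu>s n)" "\<And>n. sets (\<mu>s n) = sets borel" "prob_space N" "sets N = sets borel"
    and cos: "\<And>c d. (\<lambda>n. \<integral>x. cos (c \<bullet> x + d) \<partial>\<mu>s n) \<longlonglongrightarrow> (\<integral>x. cos (c \<bullet> x + d) \<partial>N)"
    and "trig_poly f"
  shows "(\<lambda>n. integral\<^sup>L (\<mu>s n) f) \<longlonglongrightarrow> integral\<^sup>L N f"
  using \<open>trig_poly f\<close>
proof induction
  case (cosine a c d)
  show ?case by (simp add: tendsto_mult_left[OF cos])
next
  case (add f g)
  have int: "integrable \<mu> h" if "prob_space \<mu>" "sets \<mu> = sets borel" "trig_poly h" for \<mu> :: "'b measure" and h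
    using trig_poly_bounded_continuous[OF that(3)] bounded_continuous_integrable[OF that(1,2)] by blast
  have "(\<integral>x. f x + g x \<partial>\<mu>) = (\<integral>x. f x \<partial>\<mu>) + (\<integral>x. g x \<partial>\<mu>)"
    if "prob_space \<mu>" "sets \<mu> = sets borel" for \<mu>
    using int[OF that] add.hyps by simp
  then show ?case using assms(1-4) tendsto_add[OF add.IH] by simp
qed

definition sine_clamp :: "real \<Rightarrow> 'b::euclidean_space \<Rightarrow> 'b" where
  "sine_clamp L x = (\<Sum>b\<in>Basis. (L * sin ((x \<bullet> b) / L)) *\<^sub>R b)"

lemma sine_clamp_inner: "b \<in> Basis \<Longrightarrow> sine_clamp L x \<bullet> b = L * sin ((x \<bullet> b) / L)"
  by (simp add: sine_clamp_def)

lemma trig_poly_polynomial_sine_clamp: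
  assumes "real_polynomial_function p"
  shows "trig_poly (\<lambda>x :: 'b::euclidean_space. p (sine_clamp L x))"
  using assms
proof induction
  case (linear p)
  then interpret bounded_linear p .
  have "p (sine_clamp L x) = (\<Sum>b\<in>Basis. (L * p b) * sin (((1 / L) *\<^sub>R b) \<bullet> x))" for x
    by (simp add: sine_clamp_def sum scaleR mult_ac inner_commute)
  then show ?case by (simp only:) (intro trig_poly_sum trig_poly_sine finite_Basis)
qed (auto intro: trig_poly_const trig_poly.add trig_poly_mult)

lemma norm_sine_clamp_le:
  assumes "L > 0" shows "norm (sine_clamp L x) \<le> norm x"
proof (rule norm_le_componentwise)
  fix b :: 'a assume "b \<in> Basis"
  then show "\<bar>sine_clamp L x \<bullet> b\<bar> \<le> \<bar>x \<bullet> b\<bar>"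
    using assms abs_sin_x_le_abs_x[of "(x \<bullet> b) / L"]
    by (simp add: sine_clamp_inner abs_mult field_simps)
qed

lemma norm_sine_clamp_bound:
  fixes x :: "'b::euclidean_space" and L :: real
  assumes "L > 0" shows "norm (sine_clamp L x) \<le> DIM('b) * L"
proof -
  have "norm (sine_clamp L x) \<le> (\<Sum>b\<in>Basis. \<bar>sine_clamp L x \<bullet> b\<bar>)" by (rule norm_le_l1)
  also have "\<dots> \<le> (\<Sum>b\<in>(Basis::'b set). L)"
    by (intro sum_mono) (use assms in \<open>simp add: sine_clamp_inner abs_mult\<close>)
  finally show ?thesis by simp
qed

lemma norm_sine_clamp_diff_le:
  fixes x :: "'b::euclidean_space"
  assumes "L > 0" shows "norm (sine_clamp L x - x) \<le> DIM('b) * (norm x)\<^sup>2 / (2 * L)"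
proof -
  have sin: "\<bar>sin u - u\<bar> \<le> u\<^sup>2 / 2" for u :: real
    using Maclaurin_sin_bound[of u 2] by (simp add: eval_nat_numeral sin_coeff_def)
  have "\<bar>(sine_clamp L x - x) \<bullet> b\<bar> \<le> (norm x)\<^sup>2 / (2 * L)" if b: "b \<in> Basis" for b
  proof -
    have "(sine_clamp L x - x) \<bullet> b = L * (sin ((x \<bullet> b) / L) - (x \<bullet> b) / L)"
      using b assms by (simp add: inner_diff_left sine_clamp_inner field_simps)
    then have "\<bar>(sine_clamp L x - x) \<bullet> b\<bar> \<le> L * (((x \<bullet> b) / L)\<^sup>2 / 2)"
      using sin[of "(x \<bullet> b) / L"] assms by (simp add: abs_mult)
    also have "\<dots> = (x \<bullet> b)\<^sup>2 / (2 * L)" using assms by (simp add: power2_eq_square field_simps)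
    also have "\<dots> \<le> (norm x)\<^sup>2 / (2 * L)"
      using Basis_le_norm[OF b, of x] assms by (intro divide_right_mono) (auto intro: iffD1[OF abs_le_square_iff])
    finally show ?thesis .
  qed
  then have "(\<Sum>b\<in>Basis. \<bar>(sine_clamp L x - x) \<bullet> b\<bar>) \<le> (\<Sum>b\<in>(Basis::'b set). (norm x)\<^sup>2 / (2 * L))"
    by (intro sum_mono)
  then show ?thesis using norm_le_l1[of "sine_clamp L x - x"] by simp
qed

lemma integral_diff_le_measure:
  fixes f g :: "'b \<Rightarrow> real"
  assumes "prob_space \<mu>" and int: "integrable \<mu> f" "integrable \<mu> g" and A: "A \<in> sets \<mu>"
    and le: "\<And>x. x \<in> space \<mu> \<Longrightarrow> \<bar>f x - g x\<bar> \<le> a + b * indicator A x"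
  shows "\<bar>integral\<^sup>L \<mu> f - integral\<^sup>L \<mu> g\<bar> \<le> a + b * measure \<mu> A"
proof -
  interpret prob_space \<mu> by fact
  have "\<bar>integral\<^sup>L \<mu> f - integral\<^sup>L \<mu> g\<bar> = \<bar>\<integral>x. f x - g x \<partial>\<mu>\<bar>" using int by simp
  also have "\<dots> \<le> (\<integral>x. \<bar>f x - g x\<bar> \<partial>\<mu>)" by (rule integral_abs_bound)
  also have "\<dots> \<le> (\<integral>x. a + b * indicator A x \<partial>\<mu>)"
    using int A le by (intro integral_mono integrable_abs Bochner_Integration.integrable_diff Bochner_Integration.integrable_add
        integrable_mult_right integrable_real_indicator) (auto simp: emeasure_eq_measure)
  also have "\<dots> = a + b * measure \<mu> A"
    using A by (subst Bochner_Integration.integral_add) (auto simp: prob_space emeasure_eq_measure)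
  finally show ?thesis .
qed

lemma prob_space_tight:
  fixes N :: "'b::euclidean_space measure"
  assumes "prob_space N" "sets N = sets borel" "e > 0"
  shows "\<exists>K. measure N {x. K < norm x} \<le> e"
proof -
  interpret prob_space N by fact
  have [measurable_cong]: "sets N = sets borel" by fact
  have sp: "space N = UNIV" using sets_eq_imp_space_eq[OF assms(2)] by simp
  have "(\<Inter>n. {x::'b. real n < norm x}) = {}"
  proof -
    have "\<exists>n. norm x \<le> real n" for x :: 'b by (rule real_arch_simple)
    then have "\<exists>n. x \<notin> {x. real n < norm x}" for x :: 'b by (simp add: not_less)
    then show ?thesis by blast
  qed
  moreover have "{x::'b. real n < norm x} \<in> sets N" for n
    using assms(2) by simp
  then have "(\<lambda>n. measure N {x::'b. real n < norm x}) \<longlonglongrightarrow> measure N (\<Inter>n. {x::'b. real n < norm x})"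
    by (intro finite_Lim_measure_decseq) (auto simp: decseq_def)
  ultimately have "(\<lambda>n. measure N {x::'b. real n < norm x}) \<longlonglongrightarrow> 0" by simp
  from order_tendstoD(2)[OF this assms(3)] show ?thesis
    by (meson eventually_sequentially less_imp_le order_refl)
qed

text \<open>Replacing \<open>f\<close> by \<open>f \<circ> sine_clamp L\<close> is harmless on a large ball, and the clamped function lives on
  a compact set, where Weierstrass turns it into a trigonometric polynomial that is bounded on the
  whole space.\<close>

lemma conv_in_distr_if_cos_tendsto:
  fixes \<mu>s :: "nat \<Rightarrow> 'b::euclidean_space measure"
  assumes \<mu>: "\<And>n. prob_space (\<mu>s n)" "\<And>n. sets (\<mu>s n) = sets borel"
    and N: "prob_space N" "sets N = sets borel"
    and cos: "\<And>c d. (\<lambda>n. \<integral>x. cos (c \<bullet> x + d) \<partial>\<mu>s n) \<longlonglongrightarrow> (\<integral>x. cos (c \<bullet> x + d) \<partial>N)"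
    and tight: "\<And>e. e > 0 \<Longrightarrow> \<exists>K. \<forall>n. measure (\<mu>s n) {x. K < norm x} \<le> e"
  shows "conv_in_distr \<mu>s N"
  unfolding conv_in_distr_def
proof (intro allI impI)
  fix f :: "'b \<Rightarrow> real"
  assume "bounded (range f) \<and> continuous_on UNIV f"
  then obtain B0 where B0: "\<And>x. \<bar>f x\<bar> \<le> B0" and cont: "continuous_on UNIV f"
    by (auto simp: bounded_iff)
  define B where "B = max 1 B0"
  have B: "\<bar>f x\<bar> \<le> B" "1 \<le> B" for x using B0[of x] by (auto simp: B_def)
  show "(\<lambda>n. integral\<^sup>L (\<mu>s n) f) \<longlonglongrightarrow> integral\<^sup>L N f"
  proof (rule tendstoI)
    fix e :: real assume e: "e > 0"
    define d where "d = e / (20 * B)"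
    have d: "d > 0" using e B by (simp add: d_def)
    obtain K1 where K1: "\<And>n. measure (\<mu>s n) {x. K1 < norm x} \<le> d" using tight[OF d] by blast
    obtain K2 where K2: "measure N {x. K2 < norm x} \<le> d" using prob_space_tight[OF N d] by blast
    define K where "K = max 1 (max K1 K2)"
    have K: "K > 0" by (simp add: K_def)
    have sub: "measure \<mu> {x. K < norm x} \<le> d"
      if "prob_space \<mu>" "sets \<mu> = sets borel" "measure \<mu> {x. K' < norm x} \<le> d" "K' \<le> K" for \<mu> :: "'b measure" and K'
    proof -
      interpret prob_space \<mu> by fact
      have "measure \<mu> {x. K < norm x} \<le> measure \<mu> {x. K' < norm x}"
        by (intro finite_measure_mono) (use that in auto)
      then show ?thesis using that by simp
    qed
    have "uniformly_continuous_on (cball 0 K) f"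
      using cont by (intro compact_uniformly_continuous) (auto intro: continuous_on_subset)
    then obtain r where r: "r > 0"
      "\<And>x y. x \<in> cball 0 K \<Longrightarrow> y \<in> cball 0 K \<Longrightarrow> dist y x < r \<Longrightarrow> dist (f y) (f x) < e / 20"
      unfolding uniformly_continuous_on_def using e by (metis divide_pos_pos zero_less_numeral)
    define L where "L = DIM('b) * K\<^sup>2 / r + 1"
    have L: "L > 0" using r K by (simp add: L_def add_nonneg_pos)
    have "r * L = DIM('b) * K\<^sup>2 + r" using r(1) by (simp add: L_def field_simps)
    moreover have "0 \<le> DIM('b) * K\<^sup>2" by simp
    ultimately have "DIM('b) * K\<^sup>2 < 2 * (r * L)" using r(1) by linarith
    then have Lr: "DIM('b) * K\<^sup>2 / (2 * L) < r"
      using L by (simp add: pos_divide_less_eq mult_ac)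
    obtain p where p: "real_polynomial_function p"
      "\<And>x::'b. x \<in> cball 0 (DIM('b) * L) \<Longrightarrow> \<bar>f x - p x\<bar> < e / 20"
      using Stone_Weierstrass_real_polynomial_function[of "cball 0 (DIM('b) * L)" f "e / 20"] e cont
      by (metis compact_cball continuous_on_subset divide_pos_pos subset_UNIV zero_less_numeral)
    let ?h = "\<lambda>x. p (sine_clamp L x)"
    have trig: "trig_poly ?h" by (rule trig_poly_polynomial_sine_clamp[OF p(1)])
    have fh: "\<bar>f x - ?h x\<bar> \<le> e / 10 + (2 * B) * indicator {x. K < norm x} x" for x
    proof -
      have 1: "\<bar>f (sine_clamp L x) - ?h x\<bar> < e / 20"
        using norm_sine_clamp_bound[OF L, of x] by (intro p(2)) simp
      have 2: "\<bar>f x - f (sine_clamp L x)\<bar> \<le> e / 20 + (2 * B) * indicator {x. K < norm x} x"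
      proof (cases "K < norm x")
        case True
        then show ?thesis using B(1)[of x] B(1)[of "sine_clamp L x"] e by simp
      next
        case False
        have "(norm x)\<^sup>2 \<le> K\<^sup>2" using False by (intro power_mono) auto
        then have "DIM('b) * (norm x)\<^sup>2 / (2 * L) \<le> DIM('b) * K\<^sup>2 / (2 * L)"
          using L by (intro divide_right_mono mult_left_mono) auto
        then have "dist x (sine_clamp L x) < r"
          using norm_sine_clamp_diff_le[OF L, of x] Lr by (simp add: dist_norm norm_minus_commute)
        then show ?thesis
          using r(2)[of "sine_clamp L x" x] False norm_sine_clamp_le[OF L, of x] by (simp add: dist_real_def)
      qed
      show ?thesis using 1 2 by linarith
    qed
    have approx: "\<bar>integral\<^sup>L \<mu> f - integral\<^sup>L \<mu> ?h\<bar> \<le> e / 10 + (2 * B) * d"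
      if \<mu>: "prob_space \<mu>" "sets \<mu> = sets borel" "measure \<mu> {x. K < norm x} \<le> d" for \<mu>
    proof -
      have "integrable \<mu> f" by (rule bounded_continuous_integrable[OF \<mu>(1,2) cont B(1)])
      moreover have "integrable \<mu> ?h"
        using trig_poly_bounded_continuous[OF trig] bounded_continuous_integrable[OF \<mu>(1,2)] by blast
      ultimately have "\<bar>integral\<^sup>L \<mu> f - integral\<^sup>L \<mu> ?h\<bar> \<le> e / 10 + (2 * B) * measure \<mu> {x. K < norm x}"
        using \<mu> fh by (intro integral_diff_le_measure) auto
      also have "\<dots> \<le> e / 10 + (2 * B) * d" using B(2) \<mu>(3) by (intro add_mono mult_left_mono) auto
      finally show ?thesis .
    qed
    have Bd: "(2 * B) * d = e / 10" using B(2) by (simp add: d_def)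
    have "eventually (\<lambda>n. dist (integral\<^sup>L (\<mu>s n) ?h) (integral\<^sup>L N ?h) < e / 10) sequentially"
      using trig_poly_integral_tendsto[OF \<mu> N cos trig] e by (intro tendstoD) auto
    then show "eventually (\<lambda>n. dist (integral\<^sup>L (\<mu>s n) f) (integral\<^sup>L N f) < e) sequentially"
    proof eventually_elim
      case (elim n)
      have "\<bar>integral\<^sup>L (\<mu>s n) f - integral\<^sup>L (\<mu>s n) ?h\<bar> \<le> e / 10 + (2 * B) * d"
        by (rule approx[OF \<mu>, OF sub[OF \<mu> K1]]) (simp add: K_def)
      moreover have "\<bar>integral\<^sup>L N f - integral\<^sup>L N ?h\<bar> \<le> e / 10 + (2 * B) * d"
        by (rule approx[OF N, OF sub[OF N K2]]) (simp add: K_def)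
      ultimately show ?case using elim Bd e unfolding dist_real_def by linarith
    qed
  qed
qed

section \<open>Convergence in probability\<close>

context prob_space
begin

text \<open>Stated through a measurable exceptional event, so that \<open>P\<close> itself need not be measurable.\<close>

definition whp :: "(nat \<Rightarrow> 'a \<Rightarrow> bool) \<Rightarrow> bool" where
  "whp P \<longleftrightarrow> (\<forall>d>0. \<forall>\<^sub>F n in sequentially. \<exists>E\<in>events. prob E \<le> d \<and> (\<forall>w\<in>space M - E. P n w))"

lemma whp_mono:
  assumes "whp P" "\<And>n w. w \<in> space M \<Longrightarrow> P n w \<Longrightarrow> Q n w"
  shows "whp Q"
  unfolding whp_def
proof (intro allI impI)
  fix d :: real assume "d > 0"
  with assms(1) have "\<forall>\<^sub>F n in sequentially. \<exists>E\<in>events. prob E \<le> d \<and> (\<forall>w\<in>space M - E. P n w)"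
    by (simp add: whp_def)
  then show "\<forall>\<^sub>F n in sequentially. \<exists>E\<in>events. prob E \<le> d \<and> (\<forall>w\<in>space M - E. Q n w)"
    by eventually_elim (meson DiffD1 assms(2))
qed

lemma whp_eventually:
  assumes "\<forall>\<^sub>F n in sequentially. \<forall>w\<in>space M. P n w"
  shows "whp P"
  unfolding whp_def
proof (intro allI impI)
  fix d :: real assume "d > 0"
  show "\<forall>\<^sub>F n in sequentially. \<exists>E\<in>events. prob E \<le> d \<and> (\<forall>w\<in>space M - E. P n w)"
    using assms \<open>d > 0\<close> by (auto elim!: eventually_mono intro!: bexI[of _ "{}"])
qed

lemma whp_conj:
  assumes "whp P" "whp Q"
  shows "whp (\<lambda>n w. P n w \<and> Q n w)"
  unfolding whp_def
proof (intro allI impI)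
  fix d :: real assume "d > 0"
  then have "d / 2 > 0" by simp
  with assms have "\<forall>\<^sub>F n in sequentially. \<exists>E\<in>events. prob E \<le> d / 2 \<and> (\<forall>w\<in>space M - E. P n w)"
    "\<forall>\<^sub>F n in sequentially. \<exists>E\<in>events. prob E \<le> d / 2 \<and> (\<forall>w\<in>space M - E. Q n w)"
    unfolding whp_def by blast+
  then show "\<forall>\<^sub>F n in sequentially. \<exists>E\<in>events. prob E \<le> d \<and> (\<forall>w\<in>space M - E. P n w \<and> Q n w)"
  proof eventually_elim
    case (elim n)
    then obtain E F where EF: "E \<in> events" "F \<in> events" "prob E \<le> d / 2" "prob F \<le> d / 2"
      "\<forall>w\<in>space M - E. P n w" "\<forall>w\<in>space M - F. Q n w" by blast
    then have "prob (E \<union> F) \<le> d" using measure_Un_le[of E M F] by simp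
    with EF show ?case by (intro bexI[of _ "E \<union> F"]) auto
  qed
qed

lemma whp_ball:
  assumes "finite I" "\<And>i. i \<in> I \<Longrightarrow> whp (P i)"
  shows "whp (\<lambda>n w. \<forall>i\<in>I. P i n w)"
  using assms
proof (induction I rule: finite_induct)
  case empty
  then show ?case by (simp add: whp_eventually)
next
  case (insert i I)
  then show ?case using whp_conj[of "P i" "\<lambda>n w. \<forall>i\<in>I. P i n w"] by simp
qed

lemma whp_if_prob_tendsto_0:
  assumes "\<And>n. {w\<in>space M. \<not> P n w} \<in> events" "(\<lambda>n. prob {w\<in>space M. \<not> P n w}) \<longlonglongrightarrow> 0"
  shows "whp P"
  unfolding whp_def
proof (intro allI impI)
  fix d :: real assume "d > 0"
  with assms(2) have "\<forall>\<^sub>F n in sequentially. prob {w\<in>space M. \<not> P n w} < d"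
    by (rule order_tendstoD)
  then show "\<forall>\<^sub>F n in sequentially. \<exists>E\<in>events. prob E \<le> d \<and> (\<forall>w\<in>space M - E. P n w)"
    by eventually_elim (rule bexI[OF _ assms(1)], auto)
qed

definition tendsto_prob :: "(nat \<Rightarrow> 'a \<Rightarrow> 'b::metric_space) \<Rightarrow> 'b \<Rightarrow> bool" where
  "tendsto_prob Z z \<longleftrightarrow> (\<forall>e>0. whp (\<lambda>n w. dist (Z n w) z < e))"

lemma tendsto_prob_const: "tendsto_prob (\<lambda>n w. c) c"
  by (simp add: tendsto_prob_def whp_eventually)

lemma tendsto_prob_whp_cong:
  assumes "tendsto_prob Z z" "whp (\<lambda>n w. Z n w = Z' n w)"
  shows "tendsto_prob Z' z"
  unfolding tendsto_prob_def
proof (intro allI impI)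
  fix e :: real assume "e > 0"
  with assms(1) have "whp (\<lambda>n w. dist (Z n w) z < e)" by (simp add: tendsto_prob_def)
  from whp_conj[OF this assms(2)] show "whp (\<lambda>n w. dist (Z' n w) z < e)"
    by (rule whp_mono) auto
qed

lemma tendsto_prob_isCont:
  assumes "tendsto_prob Z z" "isCont g z"
  shows "tendsto_prob (\<lambda>n w. g (Z n w)) (g z)"
  unfolding tendsto_prob_def
proof (intro allI impI)
  fix e :: real assume "e > 0"
  with assms(2) obtain d where d: "d > 0" "\<And>x. dist x z < d \<Longrightarrow> dist (g x) (g z) < e"
    unfolding continuous_at_eps_delta by blast
  with assms(1) have "whp (\<lambda>n w. dist (Z n w) z < d)" by (simp add: tendsto_prob_def)
  then show "whp (\<lambda>n w. dist (g (Z n w)) (g z) < e)" by (rule whp_mono) (use d in auto)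
qed

lemma tendsto_prob_Pair:
  assumes "tendsto_prob Z z" "tendsto_prob Z' z'"
  shows "tendsto_prob (\<lambda>n w. (Z n w, Z' n w)) (z, z')"
  unfolding tendsto_prob_def
proof (intro allI impI)
  fix e :: real assume "e > 0"
  then have "whp (\<lambda>n w. dist (Z n w) z < e / 2 \<and> dist (Z' n w) z' < e / 2)"
    using assms half_gt_zero[of e] unfolding tendsto_prob_def by (intro whp_conj) blast+
  then show "whp (\<lambda>n w. dist (Z n w, Z' n w) (z, z') < e)"
  proof (rule whp_mono)
    fix n w assume "dist (Z n w) z < e / 2 \<and> dist (Z' n w) z' < e / 2"
    moreover have "dist (Z n w, Z' n w) (z, z') \<le> dist (Z n w) z + dist (Z' n w) z'"
      by (simp add: dist_Pair_Pair sqrt_sum_squares_le_sum)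
    ultimately show "dist (Z n w, Z' n w) (z, z') < e" by simp
  qed
qed

lemma tendsto_prob_add:
  fixes z z' :: "'b::real_normed_vector"
  assumes "tendsto_prob Z z" "tendsto_prob Z' z'"
  shows "tendsto_prob (\<lambda>n w. Z n w + Z' n w) (z + z')"
  using tendsto_prob_isCont[OF tendsto_prob_Pair[OF assms], of "\<lambda>p. fst p + snd p"]
  by (simp add: continuous_intros)

lemma tendsto_prob_diff:
  fixes z z' :: "'b::real_normed_vector"
  assumes "tendsto_prob Z z" "tendsto_prob Z' z'"
  shows "tendsto_prob (\<lambda>n w. Z n w - Z' n w) (z - z')"
  using tendsto_prob_isCont[OF tendsto_prob_Pair[OF assms], of "\<lambda>p. fst p - snd p"]
  by (simp add: continuous_intros)

lemma tendsto_prob_mult: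
  fixes z z' :: real
  assumes "tendsto_prob Z z" "tendsto_prob Z' z'"
  shows "tendsto_prob (\<lambda>n w. Z n w * Z' n w) (z * z')"
  using tendsto_prob_isCont[OF tendsto_prob_Pair[OF assms], of "\<lambda>p. fst p * snd p"]
  by (simp add: continuous_intros)

lemma tendsto_prob_divide:
  fixes z z' :: real
  assumes "tendsto_prob Z z" "tendsto_prob Z' z'" "z' \<noteq> 0"
  shows "tendsto_prob (\<lambda>n w. Z n w / Z' n w) (z / z')"
  using tendsto_prob_isCont[OF tendsto_prob_Pair[OF assms(1,2)], of "\<lambda>p. fst p / snd p"] assms(3)
  by (simp add: continuous_intros)

lemma tendsto_prob_sum:
  fixes z :: "'i \<Rightarrow> 'b::real_normed_vector"
  assumes "finite I" "\<And>i. i \<in> I \<Longrightarrow> tendsto_prob (Z i) (z i)"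
  shows "tendsto_prob (\<lambda>n w. \<Sum>i\<in>I. Z i n w) (\<Sum>i\<in>I. z i)"
  using assms by (induction I rule: finite_induct) (auto intro: tendsto_prob_const tendsto_prob_add)

lemma tendsto_prob_vec:
  fixes Z :: "nat \<Rightarrow> 'a \<Rightarrow> ('b::real_normed_vector)^'n"
  assumes "\<And>i. tendsto_prob (\<lambda>n w. Z n w $ i) (z $ i)"
  shows "tendsto_prob Z z"
  unfolding tendsto_prob_def
proof (intro allI impI)
  fix e :: real assume "e > 0"
  define d where "d = e / CARD('n)"
  have "d > 0" using \<open>e > 0\<close> by (simp add: d_def)
  then have "whp (\<lambda>n w. dist (Z n w $ i) (z $ i) < d)" for i
    using assms[of i] by (simp add: tendsto_prob_def)
  then have "whp (\<lambda>n w. \<forall>i\<in>UNIV. dist (Z n w $ i) (z $ i) < d)"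
    by (intro whp_ball) auto
  then show "whp (\<lambda>n w. dist (Z n w) z < e)"
  proof (rule whp_mono)
    fix n w assume *: "\<forall>i\<in>UNIV. dist (Z n w $ i) (z $ i) < d"
    have "dist (Z n w) z \<le> (\<Sum>i\<in>UNIV. dist (Z n w $ i) (z $ i))"
      unfolding dist_vec_def by (rule L2_set_le_sum) simp
    also have "\<dots> < (\<Sum>i\<in>(UNIV::'n set). d)" using * by (intro sum_strict_mono) auto
    finally show "dist (Z n w) z < e" by (simp add: d_def)
  qed
qed

definition bounded_in_prob :: "(nat \<Rightarrow> 'a \<Rightarrow> 'b::real_normed_vector) \<Rightarrow> bool" where
  "bounded_in_prob T \<longleftrightarrow> (\<forall>d>0. \<exists>K. \<forall>n. \<exists>E\<in>events. prob E \<le> d \<and> (\<forall>w\<in>space M - E. norm (T n w) \<le> K))"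

lemma tendsto_prob_0_if_norm_le_mult_tight:
  fixes a :: "nat \<Rightarrow> 'a \<Rightarrow> 'b::real_normed_vector" and T :: "nat \<Rightarrow> 'a \<Rightarrow> 'c::real_normed_vector"
    and R :: "nat \<Rightarrow> 'a \<Rightarrow> 'd::real_normed_vector"
  assumes "tendsto_prob a 0" "bounded_in_prob T" "\<And>n w. w \<in> space M \<Longrightarrow> norm (R n w) \<le> norm (a n w) * norm (T n w)"
  shows "tendsto_prob R 0"
  unfolding tendsto_prob_def whp_def
proof (intro allI impI)
  fix e d :: real assume e: "e > 0" and "d > 0"
  then have d: "d / 2 > 0" by simp
  then obtain K0 where K0: "\<And>n. \<exists>E\<in>events. prob E \<le> d / 2 \<and> (\<forall>w\<in>space M - E. norm (T n w) \<le> K0)"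
    using assms(2) unfolding bounded_in_prob_def by blast
  define K where "K = max 1 K0"
  have K: "K > 0" "K0 \<le> K" by (auto simp: K_def)
  have "e / K > 0" using e K by simp
  then have "\<forall>\<^sub>F n in sequentially. \<exists>E\<in>events. prob E \<le> d / 2 \<and> (\<forall>w\<in>space M - E. dist (a n w) 0 < e / K)"
    using assms(1) d unfolding tendsto_prob_def whp_def by blast
  then show "\<forall>\<^sub>F n in sequentially. \<exists>E\<in>events. prob E \<le> d \<and> (\<forall>w\<in>space M - E. dist (R n w) 0 < e)"
  proof eventually_elim
    case (elim n)
    then obtain E where E: "E \<in> events" "prob E \<le> d / 2" "\<And>w. w \<in> space M - E \<Longrightarrow> norm (a n w) < e / K"
      by auto
    obtain F where F: "F \<in> events" "prob F \<le> d / 2" "\<And>w. w \<in> space M - F \<Longrightarrow> norm (T n w) \<le> K0"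
      using K0[of n] by blast
    have "norm (R n w) < e" if w: "w \<in> space M - (E \<union> F)" for w
    proof -
      have "norm (R n w) \<le> norm (a n w) * norm (T n w)" using assms(3) w by blast
      also have "\<dots> \<le> norm (a n w) * K" using F(3)[of w] w K by (intro mult_left_mono) auto
      also have "\<dots> < e" using E(3)[of w] w K by (simp add: pos_less_divide_eq)
      finally show ?thesis .
    qed
    moreover have "prob (E \<union> F) \<le> d" using measure_Un_le[of E M F] E F by simp
    ultimately show ?case using E F by (intro bexI[of _ "E \<union> F"]) auto
  qed
qed

lemma second_moment_tail:
  fixes f :: "'a \<Rightarrow> 'b::{real_normed_vector, second_countable_topology}"
  assumes [measurable]: "f \<in> borel_measurable M" and "integrable M (\<lambda>w. (norm (f w))\<^sup>2)"
    and "(\<integral>w. (norm (f w))\<^sup>2 \<partial>M) \<le> C" "K > 0"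
  shows "prob {w\<in>space M. K < norm (f w)} \<le> C / K\<^sup>2"
proof -
  have "prob {w\<in>space M. K < norm (f w)} \<le> prob {w\<in>space M. (norm (f w))\<^sup>2 \<ge> K\<^sup>2}"
    using \<open>K > 0\<close> by (intro finite_measure_mono) (auto intro!: power_mono)
  also have "\<dots> \<le> (\<integral>w. (norm (f w))\<^sup>2 \<partial>M) / K\<^sup>2"
    by (rule integral_Markov_inequality_measure[where A = "{}"]) (use assms in auto)
  also have "\<dots> \<le> C / K\<^sup>2" using assms by (intro divide_right_mono) auto
  finally show ?thesis .
qed

lemma second_moment_tail_uniform:
  fixes T :: "nat \<Rightarrow> 'a \<Rightarrow> 'b::{real_normed_vector, second_countable_topology}"
  assumes "\<And>n. T n \<in> borel_measurable M" "\<And>n. integrable M (\<lambda>w. (norm (T n w))\<^sup>2)"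
    and "\<And>n. (\<integral>w. (norm (T n w))\<^sup>2 \<partial>M) \<le> C" "d > 0"
  shows "\<exists>K>0. \<forall>n. prob {w\<in>space M. K < norm (T n w)} \<le> d"
proof (intro exI conjI allI)
  define K where "K = sqrt (\<bar>C\<bar> / d + 1)"
  show K: "K > 0" using \<open>d > 0\<close> by (simp add: K_def add_nonneg_pos)
  fix n
  have "prob {w\<in>space M. K < norm (T n w)} \<le> C / K\<^sup>2"
    by (rule second_moment_tail[OF assms(1-3) K])
  also have "\<dots> \<le> d"
  proof -
    have "d * K\<^sup>2 = \<bar>C\<bar> + d" using \<open>d > 0\<close> by (simp add: K_def field_simps)
    then show ?thesis using K \<open>d > 0\<close> by (simp add: pos_divide_le_eq)
  qed
  finally show "prob {w\<in>space M. K < norm (T n w)} \<le> d" .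
qed

lemma bounded_in_prob_if_second_moments_bounded:
  fixes T :: "nat \<Rightarrow> 'a \<Rightarrow> 'b::{real_normed_vector, second_countable_topology}"
  assumes [measurable]: "\<And>n. T n \<in> borel_measurable M" and "\<And>n. integrable M (\<lambda>w. (norm (T n w))\<^sup>2)"
    and "\<And>n. (\<integral>w. (norm (T n w))\<^sup>2 \<partial>M) \<le> C"
  shows "bounded_in_prob T"
  unfolding bounded_in_prob_def
proof (intro allI impI)
  fix d :: real assume "d > 0"
  from second_moment_tail_uniform[of T C, OF assms this] obtain K
    where "\<forall>n. prob {w\<in>space M. K < norm (T n w)} \<le> d" by blast
  then have "\<exists>E\<in>events. prob E \<le> d \<and> (\<forall>w\<in>space M - E. norm (T n w) \<le> K)" for n
    by (intro bexI[of _ "{w\<in>space M. K < norm (T n w)}"]) (auto simp: not_less)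
  then show "\<exists>K. \<forall>n. \<exists>E\<in>events. prob E \<le> d \<and> (\<forall>w\<in>space M - E. norm (T n w) \<le> K)" by blast
qed

lemma conv_in_distr_slutsky:
  fixes T U :: "nat \<Rightarrow> 'a \<Rightarrow> 'b::euclidean_space"
  assumes [measurable]: "\<And>n. T n \<in> borel_measurable M" "\<And>n. U n \<in> borel_measurable M"
    and conv: "conv_in_distr (\<lambda>n. distr M borel (T n)) N" and "bounded_in_prob T"
    and diff: "tendsto_prob (\<lambda>n w. U n w - T n w) 0"
  shows "conv_in_distr (\<lambda>n. distr M borel (U n)) N"
  unfolding conv_in_distr_def
proof (intro allI impI)
  fix f :: "'b \<Rightarrow> real"
  assume f: "bounded (range f) \<and> continuous_on UNIV f"
  then obtain B0 where B0: "\<And>x. \<bar>f x\<bar> \<le> B0" by (auto simp: bounded_iff)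
  define B where "B = max 1 B0"
  have B: "\<bar>f x\<bar> \<le> B" "1 \<le> B" for x using B0[of x] by (auto simp: B_def)
  from f have cont: "continuous_on UNIV f" by blast
  have [measurable]: "f \<in> borel_measurable borel" using cont by (rule borel_measurable_continuous_onI)
  have int: "integrable M (\<lambda>w. f (S w))" if [measurable]: "S \<in> borel_measurable M" for S
    by (rule integrable_const_bound[of _ B]) (use B in auto)
  have "(\<lambda>n. (\<integral>w. f (U n w) \<partial>M) - (\<integral>w. f (T n w) \<partial>M)) \<longlonglongrightarrow> 0"
  proof (rule tendstoI)
    fix e :: real assume e: "e > 0"
    define d where "d = e / (8 * B)"
    have d: "d > 0" using e B by (simp add: d_def)
    obtain K where K: "\<And>n. \<exists>E\<in>events. prob E \<le> d \<and> (\<forall>w\<in>space M - E. norm (T n w) \<le> K)"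
      using \<open>bounded_in_prob T\<close> d unfolding bounded_in_prob_def by blast
    have "uniformly_continuous_on (cball 0 (K + 1)) f"
      using cont by (intro compact_uniformly_continuous) (auto intro: continuous_on_subset)
    then obtain r where r: "r > 0"
      "\<And>x y. x \<in> cball 0 (K + 1) \<Longrightarrow> y \<in> cball 0 (K + 1) \<Longrightarrow> dist y x < r \<Longrightarrow> dist (f y) (f x) < e / 4"
      unfolding uniformly_continuous_on_def using e by (metis divide_pos_pos zero_less_numeral)
    have "min r 1 > 0" using r by simp
    then have "\<forall>\<^sub>F n in sequentially. \<exists>E\<in>events. prob E \<le> d \<and> (\<forall>w\<in>space M - E. dist (U n w - T n w) 0 < min r 1)"
      using diff d unfolding tendsto_prob_def whp_def by blast
    then show "\<forall>\<^sub>F n in sequentially. dist ((\<integral>w. f (U n w) \<partial>M) - (\<integral>w. f (T n w) \<partial>M)) 0 < e"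
    proof eventually_elim
      case (elim n)
      then obtain E where E: "E \<in> events" "prob E \<le> d" "\<And>w. w \<in> space M - E \<Longrightarrow> norm (U n w - T n w) < min r 1"
        by auto
      obtain F where F: "F \<in> events" "prob F \<le> d" "\<And>w. w \<in> space M - F \<Longrightarrow> norm (T n w) \<le> K"
        using K[of n] by blast
      have "\<bar>f (U n w) - f (T n w)\<bar> \<le> e / 4 + 2 * B * indicator (E \<union> F) w" if w: "w \<in> space M" for w
      proof (cases "w \<in> E \<union> F")
        case True
        then show ?thesis using B(1)[of "U n w"] B(1)[of "T n w"] e by simp
      next
        case False
        have "norm (U n w) \<le> norm (U n w - T n w) + norm (T n w)" by norm
        then have "norm (U n w) \<le> K + 1" using E(3)[of w] F(3)[of w] False w by force
        then have "dist (f (U n w)) (f (T n w)) < e / 4"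
          using E(3)[of w] F(3)[of w] False w by (intro r(2)) (auto simp: dist_norm)
        then show ?thesis using False by (simp add: dist_real_def)
      qed
      then have "\<bar>(\<integral>w. f (U n w) \<partial>M) - (\<integral>w. f (T n w) \<partial>M)\<bar> \<le> e / 4 + 2 * B * prob (E \<union> F)"
        using E F by (intro integral_diff_le_measure int prob_space_axioms) auto
      also have "\<dots> \<le> e / 4 + 2 * B * (2 * d)"
        using measure_Un_le[of E M F] E F B by (intro add_left_mono mult_left_mono) auto
      also have "\<dots> < e" using B e by (simp add: d_def)
      finally show ?case by simp
    qed
  qed
  moreover have "(\<lambda>n. \<integral>w. f (T n w) \<partial>M) \<longlonglongrightarrow> integral\<^sup>L N f"
    using conv f unfolding conv_in_distr_def by (auto simp: integral_distr)
  ultimately have "(\<lambda>n. ((\<integral>w. f (U n w) \<partial>M) - (\<integral>w. f (T n w) \<partial>M)) + (\<integral>w. f (T n w) \<partial>M)) \<longlonglongrightarrow> 0 + integral\<^sup>L N f"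
    by (rule tendsto_add)
  then show "(\<lambda>n. integral\<^sup>L (distr M borel (U n)) f) \<longlonglongrightarrow> integral\<^sup>L N f"
    by (simp add: integral_distr)
qed

end

section \<open>Limit theorems for i.i.d. sequences\<close>

lemma borel_measurable_vec_nth [measurable (raw)]:
  fixes f :: "'a \<Rightarrow> 'b::real_normed_vector^'n"
  assumes "f \<in> borel_measurable M"
  shows "(\<lambda>w. f w $ i) \<in> borel_measurable M"
  by (rule measurable_compose[OF assms]) (intro borel_measurable_continuous_onI continuous_intros)

context prob_space
begin

definition iid :: "'b measure \<Rightarrow> (nat \<Rightarrow> 'a \<Rightarrow> 'b) \<Rightarrow> bool" where
  "iid N \<xi> \<longleftrightarrow> indep_vars (\<lambda>_. N) \<xi> UNIV \<and> (\<forall>i. distr M N (\<xi> i) = distr M N (\<xi> 0))"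

lemma iid_measurable: "iid N \<xi> \<Longrightarrow> \<xi> i \<in> measurable M N"
  by (simp add: iid_def indep_vars_def)

lemma iid_compose:
  assumes "iid N \<xi>" and f [measurable]: "f \<in> measurable N N'"
  shows "iid N' (\<lambda>i w. f (\<xi> i w))"
  unfolding iid_def
proof (intro conjI allI)
  show "indep_vars (\<lambda>_. N') (\<lambda>i w. f (\<xi> i w)) UNIV"
    using assms(1) f indep_vars_compose2[of "\<lambda>_. N" \<xi> UNIV "\<lambda>_. f" "\<lambda>_. N'"]
    unfolding iid_def by blast
  fix i
  note [measurable] = iid_measurable[OF assms(1)]
  have "distr M N' (\<lambda>w. f (\<xi> j w)) = distr (distr M N (\<xi> j)) N' f" for j
    by (subst distr_distr) (auto simp: comp_def)
  then show "distr M N' (\<lambda>w. f (\<xi> i w)) = distr M N' (\<lambda>w. f (\<xi> 0 w))"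
    using assms(1) by (metis iid_def)
qed

lemma iid_integral:
  fixes f :: "'b \<Rightarrow> real"
  assumes "iid N \<xi>" and [measurable]: "f \<in> borel_measurable N"
  shows iid_integrable_iff: "integrable M (\<lambda>w. f (\<xi> i w)) \<longleftrightarrow> integrable M (\<lambda>w. f (\<xi> 0 w))"
    and iid_integral_eq: "(\<integral>w. f (\<xi> i w) \<partial>M) = (\<integral>w. f (\<xi> 0 w) \<partial>M)"
proof -
  note [measurable] = iid_measurable[OF assms(1)]
  have eq: "distr M N (\<xi> i) = distr M N (\<xi> 0)" using assms(1) by (simp add: iid_def)
  show "integrable M (\<lambda>w. f (\<xi> i w)) \<longleftrightarrow> integrable M (\<lambda>w. f (\<xi> 0 w))"
    using integrable_distr_eq[of "\<xi> i" M N f] integrable_distr_eq[of "\<xi> 0" M N f] eq by simp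
  show "(\<integral>w. f (\<xi> i w) \<partial>M) = (\<integral>w. f (\<xi> 0 w) \<partial>M)"
    using integral_distr[of "\<xi> i" M N f] integral_distr[of "\<xi> 0" M N f] eq by simp
qed

lemma integrable_mult_if_squares:
  fixes f g :: "'a \<Rightarrow> real"
  assumes [measurable]: "f \<in> borel_measurable M" "g \<in> borel_measurable M"
    and "integrable M (\<lambda>w. (f w)\<^sup>2)" "integrable M (\<lambda>w. (g w)\<^sup>2)"
  shows "integrable M (\<lambda>w. f w * g w)"
proof (rule Bochner_Integration.integrable_bound)
  show "integrable M (\<lambda>w. (f w)\<^sup>2 + (g w)\<^sup>2)" using assms by simp
  have "\<bar>a\<bar> * \<bar>b\<bar> \<le> a\<^sup>2 + b\<^sup>2" for a b :: real
  proof -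
    have "2 * (\<bar>a\<bar> * \<bar>b\<bar>) \<le> a\<^sup>2 + b\<^sup>2" using sum_squares_bound[of "\<bar>a\<bar>" "\<bar>b\<bar>"] by simp
    moreover have "0 \<le> \<bar>a\<bar> * \<bar>b\<bar>" by simp
    ultimately show ?thesis by linarith
  qed
  then show "AE w in M. norm (f w * g w) \<le> norm ((f w)\<^sup>2 + (g w)\<^sup>2)"
    by (simp add: abs_mult)
qed simp

lemma iid_sum_second_moment:
  fixes \<xi> :: "nat \<Rightarrow> 'a \<Rightarrow> real"
  assumes iid: "iid borel \<xi>" and sq: "integrable M (\<lambda>w. (\<xi> 0 w)\<^sup>2)" and mean: "(\<integral>w. \<xi> 0 w \<partial>M) = 0"
  shows "integrable M (\<lambda>w. (\<Sum>i<n. \<xi> i w)\<^sup>2) \<and> (\<integral>w. (\<Sum>i<n. \<xi> i w)\<^sup>2 \<partial>M) = n * (\<integral>w. (\<xi> 0 w)\<^sup>2 \<partial>M)"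
proof (induction n)
  case 0
  then show ?case by simp
next
  case (Suc n)
  note [measurable] = iid_measurable[OF iid]
  let ?S = "\<lambda>w. \<Sum>i<n. \<xi> i w"
  have sqn: "integrable M (\<lambda>w. (\<xi> i w)\<^sup>2)" "(\<integral>w. (\<xi> i w)\<^sup>2 \<partial>M) = (\<integral>w. (\<xi> 0 w)\<^sup>2 \<partial>M)" for i
    using iid_integrable_iff[OF iid, of "\<lambda>x. x\<^sup>2" i] iid_integral_eq[OF iid, of "\<lambda>x. x\<^sup>2" i] sq by simp_all
  have int: "integrable M (\<xi> i)" for i
    by (rule square_integrable_imp_integrable[OF _ sqn(1)]) measurable
  have mean_n: "(\<integral>w. \<xi> n w \<partial>M) = 0"
    using iid_integral_eq[OF iid, of "\<lambda>x. x" n] mean by simp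
  have "indep_var borel (\<xi> n) borel ?S"
    using iid by (intro indep_vars_sum) (auto simp: iid_def elim: indep_vars_subset)
  then have prod: "integrable M (\<lambda>w. \<xi> n w * ?S w)" "(\<integral>w. \<xi> n w * ?S w \<partial>M) = 0"
    using indep_var_integrable[of "\<xi> n" ?S] indep_var_lebesgue_integral[of "\<xi> n" ?S] int mean_n by simp_all
  have eq: "(\<Sum>i<Suc n. \<xi> i w)\<^sup>2 = (?S w)\<^sup>2 + 2 * (\<xi> n w * ?S w) + (\<xi> n w)\<^sup>2" for w
    by (simp add: power2_eq_square algebra_simps)
  show ?case
    unfolding eq using Suc prod sqn[of n] by (simp add: algebra_simps)
qed

lemma iid_mean_L1_tendsto:
  fixes \<xi> :: "nat \<Rightarrow> 'a \<Rightarrow> real"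
  assumes iid: "iid borel \<xi>" and int: "integrable M (\<xi> 0)"
  shows "(\<lambda>n. \<integral>w. \<bar>(\<Sum>i<n. \<xi> i w) / n - (\<integral>w. \<xi> 0 w \<partial>M)\<bar> \<partial>M) \<longlonglongrightarrow> 0"
proof (rule tendstoI)
  fix e :: real assume e: "e > 0"
  note [measurable] = iid_measurable[OF iid]
  define h where "h = e / 5"
  have h: "h > 0" using e by (simp add: h_def)
  define \<tau> :: "nat \<Rightarrow> real \<Rightarrow> real" where "\<tau> m x = (if \<bar>x\<bar> \<le> real m then x else 0)" for m x
  have [measurable]: "\<tau> m \<in> borel_measurable borel" for m unfolding \<tau>_def by measurable
  have "(\<lambda>m. \<integral>w. \<bar>\<xi> 0 w - \<tau> m (\<xi> 0 w)\<bar> \<partial>M) \<longlonglongrightarrow> (\<integral>w. 0 \<partial>M)"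
  proof (rule integral_dominated_convergence[where w = "\<lambda>w. \<bar>\<xi> 0 w\<bar>"])
    have "\<forall>\<^sub>F m in sequentially. \<bar>\<xi> 0 w - \<tau> m (\<xi> 0 w)\<bar> = 0" for w
      using eventually_ge_at_top[of "nat \<lceil>\<bar>\<xi> 0 w\<bar>\<rceil>"]
      by eventually_elim (auto simp: \<tau>_def)
    then show "AE w in M. (\<lambda>m. \<bar>\<xi> 0 w - \<tau> m (\<xi> 0 w)\<bar>) \<longlonglongrightarrow> 0"
      by (auto intro!: tendsto_eventually)
  qed (use int in \<open>auto simp: \<tau>_def\<close>)
  then have "\<forall>\<^sub>F m in sequentially. (\<integral>w. \<bar>\<xi> 0 w - \<tau> m (\<xi> 0 w)\<bar> \<partial>M) < h"
    using h by (intro order_tendstoD) simp_all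
  then obtain m where m: "(\<integral>w. \<bar>\<xi> 0 w - \<tau> m (\<xi> 0 w)\<bar> \<partial>M) < h"
    by (auto simp: eventually_sequentially)
  have \<tau>b: "\<bar>\<tau> m x\<bar> \<le> m" for x by (simp add: \<tau>_def)
  have \<tau>int: "integrable M (\<lambda>w. \<tau> m (\<xi> i w))" for i
    by (rule integrable_const_bound[of _ "real m"]) (use \<tau>b in auto)
  define \<mu> where "\<mu> = (\<integral>w. \<xi> 0 w \<partial>M)"
  define \<mu>' where "\<mu>' = (\<integral>w. \<tau> m (\<xi> 0 w) \<partial>M)"
  define \<zeta> where "\<zeta> i w = \<tau> m (\<xi> i w) - \<mu>'" for i w
  have \<mu>: "\<bar>\<mu>' - \<mu>\<bar> \<le> h"
  proof -
    have "\<bar>\<mu> - \<mu>'\<bar> = \<bar>\<integral>w. \<xi> 0 w - \<tau> m (\<xi> 0 w) \<partial>M\<bar>"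
      using int \<tau>int by (simp add: \<mu>_def \<mu>'_def)
    also have "\<dots> \<le> (\<integral>w. \<bar>\<xi> 0 w - \<tau> m (\<xi> 0 w)\<bar> \<partial>M)" by (rule integral_abs_bound)
    finally show ?thesis using m by simp
  qed
  have iid\<zeta>: "iid borel \<zeta>"
    unfolding \<zeta>_def by (rule iid_compose[OF iid, of "\<lambda>x. \<tau> m x - \<mu>'"]) measurable
  note [measurable] = iid_measurable[OF iid\<zeta>]
  have \<zeta>b: "\<bar>\<zeta> 0 w\<bar> \<le> m + \<bar>\<mu>'\<bar>" for w
    using \<tau>b[of "\<xi> 0 w"] by (simp add: \<zeta>_def)
  have \<zeta>sq: "integrable M (\<lambda>w. (\<zeta> 0 w)\<^sup>2)"
    by (rule integrable_const_bound[of _ "(m + \<bar>\<mu>'\<bar>)\<^sup>2"])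
       (use \<zeta>b in \<open>auto intro!: power2_le_iff_abs_le[THEN iffD2]\<close>)
  have \<zeta>m: "(\<integral>w. \<zeta> 0 w \<partial>M) = 0" using \<tau>int by (simp add: \<zeta>_def \<mu>'_def prob_space)
  define C where "C = (\<integral>w. (\<zeta> 0 w)\<^sup>2 \<partial>M)"
  note S2 = iid_sum_second_moment[OF iid\<zeta> \<zeta>sq \<zeta>m, folded C_def]
  have diff: "integrable M (\<lambda>w. \<bar>\<xi> i w - \<tau> m (\<xi> i w)\<bar>)"
      "(\<integral>w. \<bar>\<xi> i w - \<tau> m (\<xi> i w)\<bar> \<partial>M) = (\<integral>w. \<bar>\<xi> 0 w - \<tau> m (\<xi> 0 w)\<bar> \<partial>M)" for i
    using iid_integrable_iff[OF iid, of "\<lambda>x. \<bar>x - \<tau> m x\<bar>" i] iid_integral_eq[OF iid, of "\<lambda>x. \<bar>x - \<tau> m x\<bar>" i] int \<tau>int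
    by simp_all
  have intn: "integrable M (\<xi> i)" for i
    using iid_integrable_iff[OF iid, of "\<lambda>x. x" i] int by simp
  have bound: "(\<integral>w. \<bar>(\<Sum>i<n. \<xi> i w) / n - \<mu>\<bar> \<partial>M) \<le> 3 * h + C / (n * h)" if n: "n > 0" for n
  proof -
    have "\<bar>(\<Sum>i<n. \<xi> i w) / n - \<mu>\<bar> \<le>
        (h + (\<Sum>i<n. \<zeta> i w)\<^sup>2 / (n\<^sup>2 * h)) + (\<Sum>i<n. \<bar>\<xi> i w - \<tau> m (\<xi> i w)\<bar>) / n + h" for w
    proof -
      let ?z = "(\<Sum>i<n. \<zeta> i w) / n" and ?r = "(\<Sum>i<n. \<xi> i w - \<tau> m (\<xi> i w)) / n"
      have "(\<Sum>i<n. \<zeta> i w) + (\<Sum>i<n. \<xi> i w - \<tau> m (\<xi> i w)) = (\<Sum>i<n. \<xi> i w) - n * \<mu>'"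
        by (simp add: \<zeta>_def sum_subtractf)
      then have "?z + ?r = (\<Sum>i<n. \<xi> i w) / n - \<mu>'"
        using n by (simp add: add_divide_distrib[symmetric] diff_divide_distrib)
      moreover have "\<bar>?r\<bar> \<le> (\<Sum>i<n. \<bar>\<xi> i w - \<tau> m (\<xi> i w)\<bar>) / n"
        by (simp add: divide_right_mono sum_abs)
      moreover have "\<bar>?z\<bar> \<le> h + (\<Sum>i<n. \<zeta> i w)\<^sup>2 / (n\<^sup>2 * h)"
      proof -
        have "0 \<le> (\<bar>?z\<bar> - h)\<^sup>2 + \<bar>?z\<bar> * h" using h by simp
        also have "\<dots> = ?z\<^sup>2 + h\<^sup>2 - h * \<bar>?z\<bar>" by (simp add: power2_eq_square algebra_simps)
        finally have "\<bar>?z\<bar> * h \<le> (h + ?z\<^sup>2 / h) * h" using h by (simp add: power2_eq_square algebra_simps)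
        then have "\<bar>?z\<bar> \<le> h + ?z\<^sup>2 / h" using h by (rule mult_right_le_imp_le)
        then show ?thesis by (simp add: power_divide)
      qed
      ultimately show ?thesis using \<mu> by linarith
    qed
    then have "(\<integral>w. \<bar>(\<Sum>i<n. \<xi> i w) / n - \<mu>\<bar> \<partial>M) \<le>
        (\<integral>w. (h + (\<Sum>i<n. \<zeta> i w)\<^sup>2 / (n\<^sup>2 * h)) + (\<Sum>i<n. \<bar>\<xi> i w - \<tau> m (\<xi> i w)\<bar>) / n + h \<partial>M)"
      using S2[of n] diff intn by (intro integral_mono) auto
    also have "\<dots> = h + (\<integral>w. (\<Sum>i<n. \<zeta> i w)\<^sup>2 \<partial>M) / (n\<^sup>2 * h) +
         (\<Sum>i<n. (\<integral>w. \<bar>\<xi> i w - \<tau> m (\<xi> i w)\<bar> \<partial>M)) / n + h"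
      using S2[of n] diff(1) by (simp add: prob_space)
    also have "\<dots> = h + C / (n * h) + (\<integral>w. \<bar>\<xi> 0 w - \<tau> m (\<xi> 0 w)\<bar> \<partial>M) + h"
    proof -
      have "(\<integral>w. (\<Sum>i<n. \<zeta> i w)\<^sup>2 \<partial>M) / (n\<^sup>2 * h) = C / (n * h)"
        using S2[of n] n by (simp add: power2_eq_square)
      moreover have "(\<Sum>i<n. (\<integral>w. \<bar>\<xi> i w - \<tau> m (\<xi> i w)\<bar> \<partial>M)) = n * (\<integral>w. \<bar>\<xi> 0 w - \<tau> m (\<xi> 0 w)\<bar> \<partial>M)"
        by (subst sum.cong[OF refl diff(2)]) simp
      ultimately show ?thesis using n by simp
    qed
    finally show ?thesis using m by linarith
  qed
  have "(\<lambda>n. C / h / real n) \<longlonglongrightarrow> 0" by (rule lim_const_over_n)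
  then have "\<forall>\<^sub>F n in sequentially. C / h / real n < h" using h by (rule order_tendstoD)
  then show "\<forall>\<^sub>F n in sequentially. dist (\<integral>w. \<bar>(\<Sum>i<n. \<xi> i w) / n - (\<integral>w. \<xi> 0 w \<partial>M)\<bar> \<partial>M) 0 < e"
    using eventually_gt_at_top[of 0]
  proof eventually_elim
    case (elim n)
    have "(\<integral>w. \<bar>(\<Sum>i<n. \<xi> i w) / n - \<mu>\<bar> \<partial>M) < e"
    proof -
      have "C / (n * h) < h" using elim(1) by (simp add: mult.commute)
      then show ?thesis using bound[OF elim(2)] e unfolding h_def by linarith
    qed
    moreover have "0 \<le> (\<integral>w. \<bar>(\<Sum>i<n. \<xi> i w) / n - \<mu>\<bar> \<partial>M)" by simp
    ultimately show ?case by (simp add: \<mu>_def)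
  qed
qed

lemma weak_law_of_large_numbers:
  fixes \<xi> :: "nat \<Rightarrow> 'a \<Rightarrow> real"
  assumes iid: "iid borel \<xi>" and int: "integrable M (\<xi> 0)"
  shows "tendsto_prob (\<lambda>n w. (\<Sum>i<n. \<xi> i w) / n) (\<integral>w. \<xi> 0 w \<partial>M)"
  unfolding tendsto_prob_def
proof (intro allI impI)
  fix e :: real assume e: "e > 0"
  note [measurable] = iid_measurable[OF iid]
  define \<mu> where "\<mu> = (\<integral>w. \<xi> 0 w \<partial>M)"
  have [simp]: "integrable M (\<xi> i)" for i
    using iid_integrable_iff[OF iid, of "\<lambda>x. x" i] int by simp
  have eq: "{w\<in>space M. \<not> dist ((\<Sum>i<n. \<xi> i w) / n) \<mu> < e} = {w\<in>space M. \<bar>(\<Sum>i<n. \<xi> i w) / n - \<mu>\<bar> \<ge> e}" for n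
    by (auto simp: dist_real_def)
  show "whp (\<lambda>n w. dist ((\<Sum>i<n. \<xi> i w) / n) (\<integral>w. \<xi> 0 w \<partial>M) < e)"
    unfolding \<mu>_def[symmetric]
  proof (rule whp_if_prob_tendsto_0)
    show "{w\<in>space M. \<not> dist ((\<Sum>i<n. \<xi> i w) / n) \<mu> < e} \<in> events" for n by measurable
    show "(\<lambda>n. prob {w\<in>space M. \<not> dist ((\<Sum>i<n. \<xi> i w) / n) \<mu> < e}) \<longlonglongrightarrow> 0"
    proof (rule tendsto_sandwich[OF _ _ tendsto_const])
      show "(\<lambda>n. (\<integral>w. \<bar>(\<Sum>i<n. \<xi> i w) / n - \<mu>\<bar> \<partial>M) / e) \<longlonglongrightarrow> 0"
        using tendsto_divide[OF iid_mean_L1_tendsto[OF iid int] tendsto_const[of e]] e by (simp add: \<mu>_def)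
      show "\<forall>\<^sub>F n in sequentially. prob {w\<in>space M. \<not> dist ((\<Sum>i<n. \<xi> i w) / n) \<mu> < e}
          \<le> (\<integral>w. \<bar>(\<Sum>i<n. \<xi> i w) / n - \<mu>\<bar> \<partial>M) / e"
        unfolding eq by (intro always_eventually allI integral_Markov_inequality_measure[where A = "{}"]) (use e in auto)
    qed simp
  qed
qed

lemma iid_scaled_sum_tight:
  fixes \<xi> :: "nat \<Rightarrow> 'a \<Rightarrow> real"
  assumes iid: "iid borel \<xi>" and sq: "integrable M (\<lambda>w. (\<xi> 0 w)\<^sup>2)" and mean: "(\<integral>w. \<xi> 0 w \<partial>M) = 0"
  shows "bounded_in_prob (\<lambda>n w. (\<Sum>i<n. \<xi> i w) / sqrt n)"
proof (rule bounded_in_prob_if_second_moments_bounded)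
  note [measurable] = iid_measurable[OF iid]
  show "(\<lambda>w. (\<Sum>i<n. \<xi> i w) / sqrt n) \<in> borel_measurable M" for n by measurable
  note S2 = iid_sum_second_moment[OF assms]
  show "integrable M (\<lambda>w. (norm ((\<Sum>i<n. \<xi> i w) / sqrt n))\<^sup>2)" for n
    using S2[of n] by (simp add: power_divide)
  show "(\<integral>w. (norm ((\<Sum>i<n. \<xi> i w) / sqrt n))\<^sup>2 \<partial>M) \<le> (\<integral>w. (\<xi> 0 w)\<^sup>2 \<partial>M)" for n
    using S2[of n] by (simp add: power_divide)
qed

lemma iid_cos_tendsto_normal:
  fixes \<xi> :: "nat \<Rightarrow> 'a \<Rightarrow> real"
  assumes iid: "iid borel \<xi>" and sq: "integrable M (\<lambda>w. (\<xi> 0 w)\<^sup>2)" and mean: "(\<integral>w. \<xi> 0 w \<partial>M) = 0"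
    and v: "v = (\<integral>w. (\<xi> 0 w)\<^sup>2 \<partial>M)"
  shows "(\<lambda>n. \<integral>w. cos ((\<Sum>i<n. \<xi> i w) / sqrt n + d) \<partial>M) \<longlonglongrightarrow>
    (\<integral>x. cos (x + d) \<partial>(if v = 0 then return borel 0 else density lborel (normal_density 0 (sqrt v))))"
proof (cases "v = 0")
  case True
  note [measurable] = iid_measurable[OF iid]
  have sqn: "integrable M (\<lambda>w. (\<xi> i w)\<^sup>2)" "(\<integral>w. (\<xi> i w)\<^sup>2 \<partial>M) = v" for i
    using iid_integrable_iff[OF iid, of "\<lambda>x. x\<^sup>2" i] iid_integral_eq[OF iid, of "\<lambda>x. x\<^sup>2" i] sq v by simp_all
  have "AE w in M. (\<xi> i w)\<^sup>2 = 0" for i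
    using integral_nonneg_eq_0_iff_AE[OF sqn(1)[of i]] sqn(2)[of i] True by simp
  then have "AE w in M. \<forall>i. \<xi> i w = 0" by (simp add: AE_all_countable)
  then have "(\<integral>w. cos ((\<Sum>i<n. \<xi> i w) / sqrt n + d) \<partial>M) = (\<integral>w. cos d \<partial>M)" for n
    by (intro integral_cong_AE) auto
  then show ?thesis using True by (simp add: prob_space integral_return)
next
  case False
  define s where "s = sqrt v"
  have "0 \<le> v" by (simp add: v)
  with False have s: "s > 0" "s\<^sup>2 = v" by (simp_all add: s_def)
  note [measurable] = iid_measurable[OF iid]
  have sqn: "integrable M (\<lambda>w. (\<xi> i w)\<^sup>2)" "(\<integral>w. (\<xi> i w)\<^sup>2 \<partial>M) = v" for i
    using iid_integrable_iff[OF iid, of "\<lambda>x. x\<^sup>2" i] iid_integral_eq[OF iid, of "\<lambda>x. x\<^sup>2" i] sq v by simp_all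
  have mn: "(\<integral>w. \<xi> i w \<partial>M) = 0" for i
    using iid_integral_eq[OF iid, of "\<lambda>x. x" i] mean by simp
  have "weak_conv_m (\<lambda>n. distr M borel (\<lambda>x. (\<Sum>i<n. \<xi> i x) / sqrt (n * s\<^sup>2))) std_normal_distribution"
    using iid by (intro central_limit_theorem_zero_mean[where \<mu> = "distr M borel (\<xi> 0)"])
      (auto simp: iid_def s sqn mn)
  then have "(\<lambda>n. integral\<^sup>L (distr M borel (\<lambda>x. (\<Sum>i<n. \<xi> i x) / sqrt (n * s\<^sup>2))) (\<lambda>x. cos (s * x + d)))
      \<longlonglongrightarrow> integral\<^sup>L std_normal_distribution (\<lambda>x. cos (s * x + d))"
    by (rule weak_conv_imp_integral_bdd_continuous_conv[where B = 1, rotated 2])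
       (auto intro!: real_distribution_distr real_dist_normal_dist continuous_intros)
  moreover have "integral\<^sup>L (distr M borel (\<lambda>x. (\<Sum>i<n. \<xi> i x) / sqrt (n * s\<^sup>2))) (\<lambda>x. cos (s * x + d)) =
      (\<integral>w. cos ((\<Sum>i<n. \<xi> i w) / sqrt n + d) \<partial>M)" for n
    using s(1) by (subst integral_distr) (auto simp: real_sqrt_mult)
  moreover have "integral\<^sup>L std_normal_distribution (\<lambda>x. cos (s * x + d)) =
      (\<integral>x. cos (x + d) \<partial>density lborel (normal_density 0 s))"
  proof -
    interpret std: prob_space std_normal_distribution
      by (rule prob_space_normal_density) simp
    have "distributed std_normal_distribution lborel (\<lambda>x. x) (normal_density 0 1)"
      unfolding distributed_def by (auto simp: distr_id2)
    from std.normal_density_affine[OF this, of s 0] s(1)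
    have "distr std_normal_distribution lborel (\<lambda>x. s * x) = density lborel (normal_density 0 s)"
      by (simp add: distributed_def)
    then show ?thesis
      by (subst \<open>distr _ _ _ = _\<close>[symmetric], subst integral_distr) auto
  qed
  ultimately show ?thesis using False by (simp add: s_def)
qed

lemma multivariate_clt:
  fixes \<psi> :: "nat \<Rightarrow> 'a \<Rightarrow> real^'k"
  assumes iid: "iid borel \<psi>" and sq: "\<And>t. integrable M (\<lambda>w. (\<psi> 0 w $ t)\<^sup>2)"
    and mean: "\<And>t. (\<integral>w. \<psi> 0 w $ t \<partial>M) = 0"
    and V: "\<And>t s. V $ t $ s = (\<integral>w. \<psi> 0 w $ t * \<psi> 0 w $ s \<partial>M)"
  shows "\<exists>N. is_mvnormal 0 V N \<and> conv_in_distr (\<lambda>n. distr M borel (\<lambda>w. (1 / sqrt n) *\<^sub>R (\<Sum>i<n. \<psi> i w))) N"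
    and "bounded_in_prob (\<lambda>n w. (1 / sqrt n) *\<^sub>R (\<Sum>i<n. \<psi> i w))"
proof -
  note [measurable] = iid_measurable[OF iid]
  have [simp]: "integrable M (\<lambda>w. \<psi> 0 w $ t * \<psi> 0 w $ s)" for t s
    by (intro integrable_mult_if_squares sq) measurable
  have int1: "integrable M (\<lambda>w. \<psi> 0 w $ t)" for t
    by (rule square_integrable_imp_integrable[OF _ sq]) measurable
  have sqc: "(c \<bullet> \<psi> 0 w)\<^sup>2 = (\<Sum>t\<in>UNIV. \<Sum>s\<in>UNIV. c $ t * c $ s * (\<psi> 0 w $ t * \<psi> 0 w $ s))" for c w
    by (simp add: inner_vec_def power2_eq_square sum_product mult_ac)
  have cint: "integrable M (\<lambda>w. (c \<bullet> \<psi> 0 w)\<^sup>2)" for c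
    unfolding sqc by simp
  have cV: "c \<bullet> (V *v c) = (\<integral>w. (c \<bullet> \<psi> 0 w)\<^sup>2 \<partial>M)" for c
    unfolding sqc by (simp add: inner_vec_def matrix_vector_mult_def V sum_distrib_left mult_ac)
  have cmean: "(\<integral>w. c \<bullet> \<psi> 0 w \<partial>M) = 0" for c
    using int1 mean by (simp add: inner_vec_def)
  have ciid: "iid borel (\<lambda>i w. c \<bullet> \<psi> i w)" for c
    by (rule iid_compose[OF iid]) simp
  have "V $ t $ s = V $ s $ t" for t s unfolding V by (simp add: mult.commute)
  moreover have "0 \<le> c \<bullet> (V *v c)" for c unfolding cV by simp
  ultimately obtain N where N: "is_mvnormal 0 V N" using mvnormal_exists by blast
  define T where "T n w = (1 / sqrt n) *\<^sub>R (\<Sum>i<n. \<psi> i w)" for n w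
  have [measurable]: "T n \<in> borel_measurable M" for n unfolding T_def by measurable
  have Tt: "T n w $ t = (\<Sum>i<n. axis t 1 \<bullet> \<psi> i w) / sqrt n" for n w t
    by (simp add: T_def inner_axis')
  have normT: "(norm (T n w))\<^sup>2 = (\<Sum>t\<in>UNIV. (\<Sum>i<n. axis t 1 \<bullet> \<psi> i w)\<^sup>2 / n)" for n w
    unfolding norm_eq_sqrt_inner by (simp add: inner_vec_def Tt sum_nonneg power_divide flip: power2_eq_square)
  note S2 = iid_sum_second_moment[OF ciid cint cmean]
  have Tint: "integrable M (\<lambda>w. (norm (T n w))\<^sup>2)" for n
    unfolding normT using S2 by (intro Bochner_Integration.integrable_sum integrable_divide) blast
  have TC: "(\<integral>w. (norm (T n w))\<^sup>2 \<partial>M) \<le> (\<Sum>t\<in>UNIV. \<integral>w. (axis t 1 \<bullet> \<psi> 0 w)\<^sup>2 \<partial>M)" for n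
  proof -
    have "(\<integral>w. (norm (T n w))\<^sup>2 \<partial>M) = (\<Sum>t\<in>UNIV. \<integral>w. (\<Sum>i<n. axis t 1 \<bullet> \<psi> i w)\<^sup>2 / n \<partial>M)"
      unfolding normT using S2 by (intro Bochner_Integration.integral_sum integrable_divide) blast
    also have "\<dots> \<le> (\<Sum>t\<in>UNIV. \<integral>w. (axis t 1 \<bullet> \<psi> 0 w)\<^sup>2 \<partial>M)"
      by (rule sum_mono) (use S2[where n = n] in simp)
    finally show ?thesis .
  qed
  show "bounded_in_prob (\<lambda>n w. (1 / sqrt n) *\<^sub>R (\<Sum>i<n. \<psi> i w))"
    unfolding T_def[symmetric] by (rule bounded_in_prob_if_second_moments_bounded[OF _ Tint TC]) simp
  have Nsp: "prob_space N" "sets N = sets borel" using N by (auto simp: is_mvnormal_def)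
  have "conv_in_distr (\<lambda>n. distr M borel (T n)) N"
  proof (rule conv_in_distr_if_cos_tendsto[OF _ _ Nsp])
    show "prob_space (distr M borel (T n))" for n by (rule prob_space_distr) simp
  next
    fix c d
    have "(\<integral>x. cos (c \<bullet> x + d) \<partial>distr M borel (T n)) = (\<integral>w. cos ((\<Sum>i<n. c \<bullet> \<psi> i w) / sqrt n + d) \<partial>M)" for n
      by (subst integral_distr) (auto simp: T_def inner_sum_right)
    moreover have "(\<integral>x. cos (c \<bullet> x + d) \<partial>N) = (\<integral>x. cos (x + d) \<partial>distr N borel (\<lambda>x. c \<bullet> x))"
      by (subst integral_distr) (auto simp: measurable_cong_sets[OF Nsp(2) refl])
    moreover have "distr N borel (\<lambda>x. c \<bullet> x) = (if c \<bullet> (V *v c) = 0 then return borel 0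
         else density lborel (normal_density 0 (sqrt (c \<bullet> (V *v c)))))"
      using N by (simp add: is_mvnormal_def)
    ultimately show "(\<lambda>n. \<integral>x. cos (c \<bullet> x + d) \<partial>distr M borel (T n)) \<longlonglongrightarrow> (\<integral>x. cos (c \<bullet> x + d) \<partial>N)"
      using iid_cos_tendsto_normal[OF ciid cint cmean cV] by simp
  next
    fix e :: real assume "e > 0"
    from second_moment_tail_uniform[of T, OF _ Tint TC this] obtain K
      where "\<forall>n. prob {w\<in>space M. K < norm (T n w)} \<le> e" by auto
    moreover have "measure (distr M borel (T n)) {x. K < norm x} = prob {w\<in>space M. K < norm (T n w)}" for n
      by (subst measure_distr) (auto intro!: arg_cong[where f = prob])
    ultimately show "\<exists>K. \<forall>n. measure (distr M borel (T n)) {x. K < norm x} \<le> e"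
      by (intro exI[of _ K]) simp
  qed simp
  with N show "\<exists>N. is_mvnormal 0 V N \<and> conv_in_distr (\<lambda>n. distr M borel (\<lambda>w. (1 / sqrt n) *\<^sub>R (\<Sum>i<n. \<psi> i w))) N"
    unfolding T_def by blast
qed

end

section \<open>Measurability and continuity of matrix inversion\<close>

lemma borel_measurable_vec_lambda [measurable (raw)]:
  fixes f :: "'n::finite \<Rightarrow> 'a \<Rightarrow> 'b::euclidean_space"
  assumes "\<And>i. f i \<in> borel_measurable M"
  shows "(\<lambda>w. \<chi> i. f i w) \<in> borel_measurable M"
proof (subst borel_measurable_euclidean_space, rule ballI)
  fix u :: "'b^'n" assume "u \<in> Basis"
  then obtain i v where "u = axis i v" by (auto simp: Basis_vec_def)
  then show "(\<lambda>w. (\<chi> i. f i w) \<bullet> u) \<in> borel_measurable M"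
    using assms by (simp add: inner_axis)
qed

lemma borel_measurable_matrix_vector_mult [measurable (raw)]:
  fixes f :: "'a \<Rightarrow> real^'n^'m"
  assumes [measurable]: "f \<in> borel_measurable M" "g \<in> borel_measurable M"
  shows "(\<lambda>w. f w *v g w) \<in> borel_measurable M"
  unfolding matrix_vector_mult_def by measurable

lemma borel_measurable_det [measurable (raw)]:
  fixes f :: "'a \<Rightarrow> real^'n^'n"
  assumes [measurable]: "f \<in> borel_measurable M"
  shows "(\<lambda>w. det (f w)) \<in> borel_measurable M"
  unfolding det_def by measurable

lemma continuous_det [continuous_intros]:
  fixes f :: "'a::t2_space \<Rightarrow> real^'n^'n"
  assumes "continuous F f"
  shows "continuous F (\<lambda>x. det (f x))"
  unfolding det_def using assms by (intro continuous_intros)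

definition cramer_solution :: "real^'n^'n \<Rightarrow> real^'n \<Rightarrow> real^'n" where
  "cramer_solution S c = (\<chi> k. det (\<chi> i j. if j = k then c $ i else S $ i $ j) / det S)"

lemma matrix_inv_mult_eq_iff:
  fixes S :: "real^'n^'n"
  assumes "det S \<noteq> 0"
  shows "matrix_inv S *v c = x \<longleftrightarrow> S *v x = c"
proof -
  have "\<exists>A'. S ** A' = mat 1 \<and> A' ** S = mat 1"
    using assms invertible_det_nz unfolding invertible_def by blast
  then have "S ** matrix_inv S = mat 1 \<and> matrix_inv S ** S = mat 1"
    unfolding matrix_inv_def by (rule someI_ex)
  then show ?thesis
    by (metis matrix_vector_mul_assoc matrix_vector_mul_lid)
qed

lemma matrix_inv_mult_eq_cramer:
  assumes "det S \<noteq> 0" shows "matrix_inv S *v c = cramer_solution S c"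
  unfolding matrix_inv_mult_eq_iff[OF assms] cramer_solution_def using cramer[OF assms] by blast

text \<open>On singular matrices \<open>matrix_inv\<close> is an unspecified constant, which does not disturb measurability.\<close>

lemma matrix_inv_singular:
  fixes S :: "real^'n^'n"
  assumes "det S = 0" shows "matrix_inv S = (SOME A'. False)"
proof -
  have "(\<lambda>A'. S ** A' = mat 1 \<and> A' ** S = mat 1) = (\<lambda>A'. False)"
    using assms invertible_det_nz unfolding invertible_def by blast
  then show ?thesis unfolding matrix_inv_def by (simp only:)
qed

lemma borel_measurable_matrix_inv_mult [measurable (raw)]:
  fixes S :: "'a \<Rightarrow> real^'n^'n"
  assumes [measurable]: "S \<in> borel_measurable M" "c \<in> borel_measurable M"
  shows "(\<lambda>w. matrix_inv (S w) *v c w) \<in> borel_measurable M"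
proof -
  have "(\<lambda>w. matrix_inv (S w) *v c w) =
    (\<lambda>w. if det (S w) = 0 then (SOME A'. False) *v c w else cramer_solution (S w) (c w))"
    by (auto simp: matrix_inv_mult_eq_cramer matrix_inv_singular)
  moreover have "(\<lambda>w. cramer_solution (S w) (c w)) \<in> borel_measurable M"
    unfolding cramer_solution_def by measurable
  ultimately show ?thesis by simp
qed

lemma isCont_matrix_inv_mult:
  fixes S0 :: "real^'n^'n"
  assumes "det S0 \<noteq> 0"
  shows "isCont (\<lambda>p. matrix_inv (fst p) *v snd p) (S0, c0)"
proof -
  have d: "isCont (\<lambda>p. det (fst p :: real^'n^'n)) (S0, c0)" by (intro continuous_intros)
  then have "\<forall>\<^sub>F p in nhds (S0, c0). det (fst p) \<noteq> 0"
    using assms by (simp add: tendsto_imp_eventually_ne isCont_def eventually_nhds_conv_at)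
  then have "\<forall>\<^sub>F p in nhds (S0, c0). matrix_inv (fst p) *v snd p = cramer_solution (fst p) (snd p)"
    by eventually_elim (rule matrix_inv_mult_eq_cramer)
  moreover have "isCont (\<lambda>p. cramer_solution (fst p) (snd p)) (S0, c0)"
  proof -
    have "isCont (\<lambda>p. det (\<chi> i j. if j = k then snd p $ i else (fst p :: real^'n^'n) $ i $ j)) (S0, c0)" for k
    proof (rule continuous_det)
      have "isCont (\<lambda>p. if j = k then snd p $ i else (fst p :: real^'n^'n) $ i $ j) (S0, c0)" for i j
        by (cases "j = k") (auto intro!: continuous_intros)
      then show "isCont (\<lambda>p. \<chi> i j. if j = k then snd p $ i else (fst p :: real^'n^'n) $ i $ j) (S0, c0)"
        unfolding isCont_def by (intro tendsto_vec_lambda) auto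
    qed
    then show ?thesis
      using d assms unfolding cramer_solution_def isCont_def
      by (intro tendsto_vec_lambda tendsto_divide) simp_all
  qed
  ultimately show ?thesis by (simp add: isCont_cong)
qed

lemma det_scaleR:
  fixes S :: "real^'n^'n" shows "det (r *\<^sub>R S) = r ^ CARD('n) * det S"
proof -
  have "r *\<^sub>R S = (\<chi> i. r *s S $ i)" by (simp add: vec_eq_iff)
  then show ?thesis using det_rows_mul[of "\<lambda>_. r" "\<lambda>i. S $ i"] by simp
qed

lemma matrix_inv_mult_scaleR:
  fixes S :: "real^'n^'n"
  assumes "det S \<noteq> 0" "r \<noteq> 0"
  shows "matrix_inv (r *\<^sub>R S) *v (r *\<^sub>R c) = matrix_inv S *v c"
proof -
  have "det (r *\<^sub>R S) \<noteq> 0"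
    using assms by (simp add: det_scaleR)
  then show ?thesis
    using matrix_inv_mult_eq_iff[OF assms(1), of c "matrix_inv S *v c"]
    by (simp add: matrix_inv_mult_eq_iff scaleR_matrix_vector_assoc[symmetric])
qed

context prob_space
begin

lemma tendsto_prob_matrix_inv_mult:
  fixes S :: "nat \<Rightarrow> 'a \<Rightarrow> real^'n^'n"
  assumes S: "tendsto_prob (\<lambda>n w. (1 / real n) *\<^sub>R S n w) S0"
    and c: "tendsto_prob (\<lambda>n w. (1 / real n) *\<^sub>R c n w) c0" and det: "det S0 \<noteq> 0"
  shows "tendsto_prob (\<lambda>n w. matrix_inv (S n w) *v c n w) (matrix_inv S0 *v c0)"
proof (rule tendsto_prob_whp_cong)
  show "tendsto_prob (\<lambda>n w. matrix_inv ((1 / real n) *\<^sub>R S n w) *v ((1 / real n) *\<^sub>R c n w)) (matrix_inv S0 *v c0)"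
    using tendsto_prob_isCont[OF tendsto_prob_Pair[OF S c] isCont_matrix_inv_mult[OF det]] by simp
  have "isCont (det :: real^'n^'n \<Rightarrow> real) S0" using continuous_det[OF continuous_ident] .
  from tendsto_prob_isCont[OF S this]
  have "whp (\<lambda>n w. dist (det ((1 / real n) *\<^sub>R S n w)) (det S0) < \<bar>det S0\<bar>)"
    using det by (simp add: tendsto_prob_def)
  moreover have "whp (\<lambda>n w. n > 0)"
    by (rule whp_eventually) (auto intro: eventually_mono[OF eventually_gt_at_top[of 0]])
  ultimately have "whp (\<lambda>n w. dist (det ((1 / real n) *\<^sub>R S n w)) (det S0) < \<bar>det S0\<bar> \<and> n > 0)"
    by (rule whp_conj)
  then show "whp (\<lambda>n w. matrix_inv ((1 / real n) *\<^sub>R S n w) *v ((1 / real n) *\<^sub>R c n w) = matrix_inv (S n w) *v c n w)"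
  proof (rule whp_mono)
    fix n w assume *: "dist (det ((1 / real n) *\<^sub>R S n w)) (det S0) < \<bar>det S0\<bar> \<and> n > 0"
    then have "det ((1 / real n) *\<^sub>R S n w) \<noteq> 0" by (auto simp: dist_real_def)
    then have "det (S n w) \<noteq> 0" using * by (simp add: det_scaleR)
    then show "matrix_inv ((1 / real n) *\<^sub>R S n w) *v ((1 / real n) *\<^sub>R c n w) = matrix_inv (S n w) *v c n w"
      using * by (intro matrix_inv_mult_scaleR) auto
  qed
qed

end

section \<open>Independence of two processes\<close>

lemma Int_stable_vimages: "Int_stable {V -` a \<inter> space M |a. a \<in> sets N}"
proof (rule Int_stableI)
  fix P Q assume "P \<in> {V -` a \<inter> space M |a. a \<in> sets N}" "Q \<in> {V -` a \<inter> space M |a. a \<in> sets N}"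
  then obtain a b where "P = V -` a \<inter> space M" "Q = V -` b \<inter> space M" "a \<in> sets N" "b \<in> sets N" by blast
  then show "P \<inter> Q \<in> {V -` a \<inter> space M |a. a \<in> sets N}"
    by (intro CollectI exI[of _ "a \<inter> b"]) auto
qed

lemma cylinder_vimage:
  assumes V: "\<And>i. V i \<in> measurable M N" and J: "J \<noteq> {}" "finite J" and a: "\<And>j. j \<in> J \<Longrightarrow> a j \<in> sets N"
  shows "(\<Inter>j\<in>J. V j -` a j \<inter> space M) \<in> {(\<lambda>w i. V i w) -` S \<inter> space M | S. S \<in> sets (Pi\<^sub>M UNIV (\<lambda>_. N))}"
proof -
  let ?P = "Pi\<^sub>M UNIV (\<lambda>_. N)"
  have "{x \<in> space ?P. \<forall>j\<in>J. x j \<in> a j} \<in> sets ?P"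
  proof (rule sets.sets_Collect_finite_All'[OF _ J(2,1)])
    fix j assume "j \<in> J"
    then have "(\<lambda>x. x j) -` a j \<inter> space ?P \<in> sets ?P"
      using a by (intro measurable_sets[OF measurable_component_singleton]) auto
    then show "{x \<in> space ?P. x j \<in> a j} \<in> sets ?P"
      by (simp add: vimage_def Int_def conj_commute)
  qed
  moreover have "(\<lambda>w i. V i w) -` {x \<in> space ?P. \<forall>j\<in>J. x j \<in> a j} \<inter> space M = (\<Inter>j\<in>J. V j -` a j \<inter> space M)"
    using J(1) measurable_space[OF V] by (auto simp: space_PiM)
  ultimately show ?thesis by blast
qed

context prob_space
begin

lemma
  fixes A :: "nat \<Rightarrow> 'a \<Rightarrow> 'b" and W :: "nat \<Rightarrow> 'a \<Rightarrow> 'c"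
  assumes A: "indep_vars (\<lambda>_. NA) A UNIV" and W: "indep_vars (\<lambda>_. NW) W UNIV"
    and AW: "indep_set {(\<lambda>w i. A i w) -` S \<inter> space M | S. S \<in> sets (Pi\<^sub>M UNIV (\<lambda>_. NA))}
                       {(\<lambda>w i. W i w) -` S \<inter> space M | S. S \<in> sets (Pi\<^sub>M UNIV (\<lambda>_. NW))}"
  shows indep_vars_Pair: "indep_vars (\<lambda>_. NA \<Otimes>\<^sub>M NW) (\<lambda>i w. (A i w, W i w)) UNIV"
    and distr_Pair_eq: "distr M (NA \<Otimes>\<^sub>M NW) (\<lambda>w. (A i w, W i w)) = distr M NA (A i) \<Otimes>\<^sub>M distr M NW (W i)"
    and indep_var_functions: "f \<in> measurable NA NE \<Longrightarrow> g \<in> measurable NW NE' \<Longrightarrow>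
      indep_var NE (\<lambda>w. f (A i w)) NE' (\<lambda>w. g (W i w))"
proof -
  have rvA [measurable]: "A i \<in> measurable M NA" for i using A by (simp add: indep_vars_def2)
  have rvW [measurable]: "W i \<in> measurable M NW" for i using W by (simp add: indep_vars_def2)
  define R where "R i a b = (A i -` a \<inter> space M) \<inter> (W i -` b \<inter> space M)" for i a b
  have G: "prob (\<Inter>j\<in>J. R j (a j) (b j)) =
      (\<Prod>j\<in>J. prob (A j -` a j \<inter> space M)) * (\<Prod>j\<in>J. prob (W j -` b j \<inter> space M))"
    if J: "J \<noteq> {}" "finite J" and a: "\<And>j. j \<in> J \<Longrightarrow> a j \<in> sets NA" and b: "\<And>j. j \<in> J \<Longrightarrow> b j \<in> sets NW" for J a b
  proof -
    have "(\<Inter>j\<in>J. R j (a j) (b j)) = (\<Inter>j\<in>J. A j -` a j \<inter> space M) \<inter> (\<Inter>j\<in>J. W j -` b j \<inter> space M)"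
      by (auto simp: R_def)
    also have "prob \<dots> = prob (\<Inter>j\<in>J. A j -` a j \<inter> space M) * prob (\<Inter>j\<in>J. W j -` b j \<inter> space M)"
      by (intro indep_setD[OF AW] cylinder_vimage rvA rvW J a b)
    also have "\<dots> = (\<Prod>j\<in>J. prob (A j -` a j \<inter> space M)) * (\<Prod>j\<in>J. prob (W j -` b j \<inter> space M))"
      using indep_varsD[OF A J(1,2), of a] indep_varsD[OF W J(1,2), of b] a b by simp
    finally show ?thesis .
  qed
  have R1: "prob (R j a b) = prob (A j -` a \<inter> space M) * prob (W j -` b \<inter> space M)"
    if "a \<in> sets NA" "b \<in> sets NW" for j a b
    using G[of "{j}" "\<lambda>_. a" "\<lambda>_. b"] that by simp
  define F where "F i = {R i a b | a b. a \<in> sets NA \<and> b \<in> sets NW}" for i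
  have "indep_sets F UNIV"
  proof (rule indep_setsI)
    show "F i \<subseteq> events" for i by (auto simp: F_def R_def)
    fix E J assume J: "J \<noteq> {}" "finite J" and E: "\<forall>j\<in>J. E j \<in> F j"
    from E have "\<forall>j\<in>J. \<exists>a b. E j = R j a b \<and> a \<in> sets NA \<and> b \<in> sets NW" by (auto simp: F_def)
    then obtain a b where ab: "\<And>j. j \<in> J \<Longrightarrow> E j = R j (a j) (b j)" "\<And>j. j \<in> J \<Longrightarrow> a j \<in> sets NA" "\<And>j. j \<in> J \<Longrightarrow> b j \<in> sets NW"
      by metis
    have "prob (\<Inter>j\<in>J. E j) = prob (\<Inter>j\<in>J. R j (a j) (b j))" using ab(1) by simp
    also have "\<dots> = (\<Prod>j\<in>J. prob (E j))"
      using G[OF J ab(2,3)] R1 ab by (simp add: prod.distrib)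
    finally show "prob (\<Inter>j\<in>J. E j) = (\<Prod>j\<in>J. prob (E j))" .
  qed
  moreover have "Int_stable (F i)" for i
  proof (rule Int_stableI)
    fix P Q assume "P \<in> F i" "Q \<in> F i"
    then obtain a b a' b' where "P = R i a b" "Q = R i a' b'" "a \<in> sets NA" "b \<in> sets NW" "a' \<in> sets NA" "b' \<in> sets NW"
      by (auto simp: F_def)
    moreover have "R i a b \<inter> R i a' b' = R i (a \<inter> a') (b \<inter> b')" by (auto simp: R_def)
    ultimately show "P \<inter> Q \<in> F i" unfolding F_def by blast
  qed
  ultimately have indep: "indep_sets (\<lambda>i. sigma_sets (space M) (F i)) UNIV" by (intro indep_sets_sigma)
  have sub: "{(\<lambda>w. (A i w, W i w)) -` B \<inter> space M | B. B \<in> sets (NA \<Otimes>\<^sub>M NW)} \<subseteq> sigma_sets (space M) (F i)" for i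
  proof -
    have "(\<lambda>w. (A i w, W i w)) \<in> space M \<rightarrow> space NA \<times> space NW"
      using measurable_space[OF rvA] measurable_space[OF rvW] by auto
    from sigma_sets_vimage_commute[OF this, of "{a \<times> b | a b. a \<in> sets NA \<and> b \<in> sets NW}"]
    have "{(\<lambda>w. (A i w, W i w)) -` B \<inter> space M | B. B \<in> sets (NA \<Otimes>\<^sub>M NW)} =
        sigma_sets (space M) {(\<lambda>w. (A i w, W i w)) -` B \<inter> space M | B. B \<in> {a \<times> b | a b. a \<in> sets NA \<and> b \<in> sets NW}}"
      by (simp only: sets_pair_measure)
    also have "{(\<lambda>w. (A i w, W i w)) -` B \<inter> space M | B. B \<in> {a \<times> b | a b. a \<in> sets NA \<and> b \<in> sets NW}} \<subseteq> F i"
    proof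
      fix P assume "P \<in> {(\<lambda>w. (A i w, W i w)) -` B \<inter> space M | B. B \<in> {a \<times> b | a b. a \<in> sets NA \<and> b \<in> sets NW}}"
      then obtain a b where "P = (\<lambda>w. (A i w, W i w)) -` (a \<times> b) \<inter> space M" "a \<in> sets NA" "b \<in> sets NW" by blast
      moreover have "(\<lambda>w. (A i w, W i w)) -` (a \<times> b) \<inter> space M = R i a b" for a b by (auto simp: R_def)
      ultimately show "P \<in> F i" unfolding F_def by blast
    qed
    finally show ?thesis by (simp add: sigma_sets_mono')
  qed
  show "indep_vars (\<lambda>_. NA \<Otimes>\<^sub>M NW) (\<lambda>i w. (A i w, W i w)) UNIV"
    unfolding indep_vars_def2
  proof (intro conjI ballI)
    show "indep_sets (\<lambda>i. {(\<lambda>w. (A i w, W i w)) -` B \<inter> space M | B. B \<in> sets (NA \<Otimes>\<^sub>M NW)}) UNIV"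
      by (rule indep_sets_mono_sets[OF indep sub])
  qed measurable
  show "distr M (NA \<Otimes>\<^sub>M NW) (\<lambda>w. (A i w, W i w)) = distr M NA (A i) \<Otimes>\<^sub>M distr M NW (W i)"
  proof (rule pair_measure_eqI[symmetric])
    interpret DA: prob_space "distr M NA (A i)" by (rule prob_space_distr) simp
    interpret DW: prob_space "distr M NW (W i)" by (rule prob_space_distr) simp
    show "sigma_finite_measure (distr M NA (A i))" "sigma_finite_measure (distr M NW (W i))"
      by unfold_locales
    show "sets (distr M NA (A i) \<Otimes>\<^sub>M distr M NW (W i)) = sets (distr M (NA \<Otimes>\<^sub>M NW) (\<lambda>w. (A i w, W i w)))"
      by (simp cong: sets_pair_measure_cong)
    fix a b assume "a \<in> sets (distr M NA (A i))" "b \<in> sets (distr M NW (W i))"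
    then have ab [measurable]: "a \<in> sets NA" "b \<in> sets NW" by simp_all
    have "(\<lambda>w. (A i w, W i w)) -` (a \<times> b) \<inter> space M = R i a b" by (auto simp: R_def)
    then show "emeasure (distr M NA (A i)) a * emeasure (distr M NW (W i)) b =
        emeasure (distr M (NA \<Otimes>\<^sub>M NW) (\<lambda>w. (A i w, W i w))) (a \<times> b)"
      using R1[OF ab] by (simp add: emeasure_distr emeasure_eq_measure ennreal_mult)
  qed
  show "indep_var NE (\<lambda>w. f (A i w)) NE' (\<lambda>w. g (W i w))"
    if f [measurable]: "f \<in> measurable NA NE" and g [measurable]: "g \<in> measurable NW NE'"
  proof -
    have fA: "(\<lambda>w. f (A i w)) -` a \<inter> space M = A i -` (f -` a \<inter> space NA) \<inter> space M" for a
      using measurable_space[OF rvA] by auto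
    have gW: "(\<lambda>w. g (W i w)) -` a \<inter> space M = W i -` (g -` a \<inter> space NW) \<inter> space M" for a
      using measurable_space[OF rvW] by auto
    show ?thesis
      unfolding indep_var_eq
    proof (intro conjI indep_set_sigma_sets indep_setI Int_stable_vimages)
      fix P Q
      assume "P \<in> {(\<lambda>w. f (A i w)) -` a \<inter> space M |a. a \<in> sets NE}" "Q \<in> {(\<lambda>w. g (W i w)) -` a \<inter> space M |a. a \<in> sets NE'}"
      then obtain a b where "P = A i -` (f -` a \<inter> space NA) \<inter> space M" "Q = W i -` (g -` b \<inter> space NW) \<inter> space M"
        "a \<in> sets NE" "b \<in> sets NE'" unfolding fA gW by blast
      then show "prob (P \<inter> Q) = prob P * prob Q"
        using R1[of "f -` a \<inter> space NA" "g -` b \<inter> space NW" i] measurable_sets[OF f] measurable_sets[OF g]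
        by (simp add: R_def)
    qed (auto intro!: measurable_compose[OF rvA f] measurable_compose[OF rvW g])
  qed
qed

end

section \<open>The simple randomized trial\<close>

lemma sum_centered_mult:
  fixes x y :: "'i \<Rightarrow> real"
  assumes "finite S"
  shows "(\<Sum>i\<in>S. y i * (x i - (\<Sum>i\<in>S. x i) / card S)) = (\<Sum>i\<in>S. y i * x i) - (\<Sum>i\<in>S. y i) * (\<Sum>i\<in>S. x i) / card S"
  by (simp add: right_diff_distrib sum_subtractf flip: sum_distrib_right sum_divide_distrib)

lemma sum_centered_mult_centered:
  fixes x y :: "'i \<Rightarrow> real"
  assumes "finite S"
  shows "(\<Sum>i\<in>S. (y i - (\<Sum>i\<in>S. y i) / card S) * (x i - (\<Sum>i\<in>S. x i) / card S)) =
    (\<Sum>i\<in>S. y i * x i) - (\<Sum>i\<in>S. y i) * (\<Sum>i\<in>S. x i) / card S"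
proof -
  have "(\<Sum>i\<in>S. x i - (\<Sum>i\<in>S. x i) / card S) = 0"
    using assms by (cases "S = {}") (simp_all add: sum_subtractf)
  then have "(\<Sum>i\<in>S. (\<Sum>i\<in>S. y i) / card S * (x i - (\<Sum>i\<in>S. x i) / card S)) = 0"
    by (subst sum_distrib_left[symmetric]) simp
  then show ?thesis
    unfolding left_diff_distrib sum_subtractf sum_centered_mult[OF assms] by simp
qed

context prob_space
begin

definition square_integrable :: "('a \<Rightarrow> real) \<Rightarrow> bool" where
  "square_integrable f \<longleftrightarrow> f \<in> borel_measurable M \<and> integrable M (\<lambda>w. (f w)\<^sup>2)"

lemma square_integrable_mult: "square_integrable f \<Longrightarrow> square_integrable g \<Longrightarrow> integrable M (\<lambda>w. f w * g w)"
  by (simp add: square_integrable_def integrable_mult_if_squares)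

lemma square_integrable_imp_integrable': "square_integrable f \<Longrightarrow> integrable M f"
  by (auto simp: square_integrable_def intro: square_integrable_imp_integrable)

lemma square_integrable_const: "square_integrable (\<lambda>w. c)"
  by (simp add: square_integrable_def)

lemma square_integrable_cmult: "square_integrable f \<Longrightarrow> square_integrable (\<lambda>w. c * f w)"
  by (auto simp: square_integrable_def power_mult_distrib)

lemma square_integrable_add:
  assumes "square_integrable f" "square_integrable g"
  shows "square_integrable (\<lambda>w. f w + g w)"
  using assms square_integrable_mult[OF assms]
  by (auto simp: square_integrable_def power2_sum mult.assoc)

lemma square_integrable_diff:
  assumes "square_integrable f" "square_integrable g"
  shows "square_integrable (\<lambda>w. f w - g w)"
  using square_integrable_add[OF assms(1) square_integrable_cmult[OF assms(2), of "-1"]] by simp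

lemma square_integrable_sum:
  assumes "finite I" "\<And>i. i \<in> I \<Longrightarrow> square_integrable (f i)"
  shows "square_integrable (\<lambda>w. \<Sum>i\<in>I. f i w)"
  using assms by (induction I rule: finite_induct) (auto intro: square_integrable_const square_integrable_add)

end

text \<open>Independence of \<open>A 0\<close> and \<open>(Yp 0, X 0)\<close> is stated through real functions because \<open>indep_var\<close> requires
  both variables to have the same type.\<close>

locale simple_randomized_trial = prob_space M for M :: "'a measure" +
  fixes Yp :: "nat \<Rightarrow> 'a \<Rightarrow> real^'k" and X :: "nat \<Rightarrow> 'a \<Rightarrow> real^'p" and A :: "nat \<Rightarrow> 'a \<Rightarrow> 'k" and \<pi> :: "'k \<Rightarrow> real"
  assumes iid_records: "iid (count_space UNIV \<Otimes>\<^sub>M (borel \<Otimes>\<^sub>M borel)) (\<lambda>i w. (A i w, Yp i w, X i w))"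
    and A_indep: "\<And>f g. g \<in> borel_measurable (borel \<Otimes>\<^sub>M borel) \<Longrightarrow>
      indep_var borel (\<lambda>w. f (A 0 w) :: real) borel (\<lambda>w. g (Yp 0 w, X 0 w))"
    and A_prob: "\<And>t. prob {w\<in>space M. A 0 w = t} = \<pi> t"
    and mom_Y: "\<And>t. integrable M (\<lambda>w. (Yp 0 w $ t)\<^sup>2)"
    and mom_X: "integrable M (\<lambda>w. (norm (X 0 w))\<^sup>2)"
    and posdef: "\<And>v. v \<noteq> 0 \<Longrightarrow> v \<bullet> (Sigma_X M X *v v) > 0"
    and pi_pos: "\<And>t. 0 < \<pi> t" and pi_sum: "(\<Sum>t\<in>UNIV. \<pi> t) = 1"
begin

abbreviation "\<theta> \<equiv> theta M Yp"
abbreviation "\<mu> \<equiv> mu_X M X"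
abbreviation "\<Sigma> \<equiv> Sigma_X M X"
abbreviation "\<beta> \<equiv> beta M Yp X"

lemma measurable_records [measurable]:
  shows "A i \<in> measurable M (count_space UNIV)" "Yp i \<in> borel_measurable M" "X i \<in> borel_measurable M"
proof -
  note D = iid_measurable[OF iid_records, of i]
  show "A i \<in> measurable M (count_space UNIV)"
    using measurable_compose[OF D measurable_fst] by simp
  show "Yp i \<in> borel_measurable M"
    using measurable_compose[OF measurable_compose[OF D measurable_snd] measurable_fst] by simp
  show "X i \<in> borel_measurable M"
    using measurable_compose[OF measurable_compose[OF D measurable_snd] measurable_snd] by simp
qed

definition assigned :: "'k \<Rightarrow> nat \<Rightarrow> 'a \<Rightarrow> real" where
  "assigned t i w = (if A i w = t then 1 else 0)"

lemma measurable_assigned [measurable]: "assigned t i \<in> borel_measurable M"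
  unfolding assigned_def by measurable

lemma sum_arm:
  fixes f :: "nat \<Rightarrow> 'b::real_vector"
  shows "(\<Sum>i\<in>arm A n w t. f i) = (\<Sum>i<n. assigned t i w *\<^sub>R f i)"
proof -
  have "(\<Sum>i<n. assigned t i w *\<^sub>R f i) = (\<Sum>i<n. if A i w = t then f i else 0)"
    by (intro sum.cong) (auto simp: assigned_def)
  also have "\<dots> = (\<Sum>i\<in>{i \<in> {..<n}. A i w = t}. f i)" by (rule sum.inter_filter[symmetric]) simp
  also have "{i \<in> {..<n}. A i w = t} = arm A n w t" by (auto simp: arm_def)
  finally show ?thesis by simp
qed

lemma finite_arm [simp]: "finite (arm A n w t)"
  by (simp add: arm_def)

lemma ntr_eq: "real (ntr A n w t) = (\<Sum>i<n. assigned t i w)"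
  using sum_arm[where f = "\<lambda>_. 1::real"] by (simp add: ntr_def)

lemma sum_arm_Yobs: "(\<Sum>i\<in>arm A n w t. f (Yobs Yp A i w) i) = (\<Sum>i\<in>arm A n w t. f (Yp i w $ t) i)"
  by (intro sum.cong) (auto simp: arm_def Yobs_def)

lemma assigned_integral:
  fixes g :: "(real^'k) \<times> (real^'p) \<Rightarrow> real"
  assumes g: "g \<in> borel_measurable (borel \<Otimes>\<^sub>M borel)" and int: "integrable M (\<lambda>w. g (Yp 0 w, X 0 w))"
  shows "integrable M (\<lambda>w. assigned t 0 w * g (Yp 0 w, X 0 w))"
    and "(\<integral>w. assigned t 0 w * g (Yp 0 w, X 0 w) \<partial>M) = \<pi> t * (\<integral>w. g (Yp 0 w, X 0 w) \<partial>M)"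
proof -
  have ind: "indep_var borel (\<lambda>w. assigned t 0 w) borel (\<lambda>w. g (Yp 0 w, X 0 w))"
    using A_indep[OF g, of "\<lambda>a. if a = t then 1 else 0"] by (simp add: assigned_def)
  have eq: "assigned t 0 w = indicator {w\<in>space M. A 0 w = t} w" if "w \<in> space M" for w
    using that by (simp add: assigned_def indicator_def)
  have [measurable]: "{w\<in>space M. A 0 w = t} \<in> events" by measurable
  have a: "integrable M (assigned t 0)" "(\<integral>w. assigned t 0 w \<partial>M) = \<pi> t"
  proof -
    have "integrable M (assigned t 0) \<longleftrightarrow> integrable M (indicator {w\<in>space M. A 0 w = t} :: 'a \<Rightarrow> real)"
      by (intro Bochner_Integration.integrable_cong refl eq)
    then show "integrable M (assigned t 0)" by (simp add: emeasure_eq_measure)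
    have "(\<integral>w. assigned t 0 w \<partial>M) = (\<integral>w. indicator {w\<in>space M. A 0 w = t} w \<partial>M)"
      by (intro Bochner_Integration.integral_cong refl eq)
    then show "(\<integral>w. assigned t 0 w \<partial>M) = \<pi> t" by (simp add: A_prob)
  qed
  show "integrable M (\<lambda>w. assigned t 0 w * g (Yp 0 w, X 0 w))"
    by (rule indep_var_integrable[OF ind a(1) int])
  show "(\<integral>w. assigned t 0 w * g (Yp 0 w, X 0 w) \<partial>M) = \<pi> t * (\<integral>w. g (Yp 0 w, X 0 w) \<partial>M)"
    using indep_var_lebesgue_integral[OF ind a(1) int] a(2) by simp
qed

lemma iid_assigned:
  fixes g :: "(real^'k) \<times> (real^'p) \<Rightarrow> real"
  assumes [measurable]: "g \<in> borel_measurable (borel \<Otimes>\<^sub>M borel)"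
  shows "iid borel (\<lambda>i w. assigned t i w * g (Yp i w, X i w))"
    and "iid borel (\<lambda>i w. g (Yp i w, X i w))"
proof -
  have "iid borel (\<lambda>i w. (\<lambda>(a, d). (if a = t then 1 else 0) * g d) (A i w, Yp i w, X i w))"
    by (rule iid_compose[OF iid_records]) measurable
  then show "iid borel (\<lambda>i w. assigned t i w * g (Yp i w, X i w))" by (simp add: assigned_def)
  have "iid borel (\<lambda>i w. (\<lambda>(a, d). g d) (A i w, Yp i w, X i w))"
    by (rule iid_compose[OF iid_records]) measurable
  then show "iid borel (\<lambda>i w. g (Yp i w, X i w))" by simp
qed

lemma lln_arm:
  fixes g :: "(real^'k) \<times> (real^'p) \<Rightarrow> real"
  assumes "g \<in> borel_measurable (borel \<Otimes>\<^sub>M borel)" "integrable M (\<lambda>w. g (Yp 0 w, X 0 w))"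
  shows "tendsto_prob (\<lambda>n w. (\<Sum>i\<in>arm A n w t. g (Yp i w, X i w)) / real n) (\<pi> t * (\<integral>w. g (Yp 0 w, X 0 w) \<partial>M))"
  using weak_law_of_large_numbers[OF iid_assigned(1)[OF assms(1)] assigned_integral(1)[OF assms]]
  by (simp add: sum_arm assigned_integral(2)[OF assms])

lemma lln_all:
  fixes g :: "(real^'k) \<times> (real^'p) \<Rightarrow> real"
  assumes "g \<in> borel_measurable (borel \<Otimes>\<^sub>M borel)" "integrable M (\<lambda>w. g (Yp 0 w, X 0 w))"
  shows "tendsto_prob (\<lambda>n w. (\<Sum>i<n. g (Yp i w, X i w)) / real n) (\<integral>w. g (Yp 0 w, X 0 w) \<partial>M)"
  using weak_law_of_large_numbers[OF iid_assigned(2)[OF assms(1)] assms(2)] .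

lemma tendsto_prob_fraction: "tendsto_prob (\<lambda>n w. real (ntr A n w t) / real n) (\<pi> t)"
proof -
  have "tendsto_prob (\<lambda>n w. (\<Sum>i\<in>arm A n w t. 1) / real n) (\<pi> t * (\<integral>w. 1 \<partial>M))"
    by (rule lln_arm) simp_all
  then show ?thesis by (simp add: ntr_def prob_space)
qed

lemma whp_arm_nonempty: "whp (\<lambda>n w. ntr A n w t > 0 \<and> n > 0)"
proof -
  have "whp (\<lambda>n w. dist (real (ntr A n w t) / real n) (\<pi> t) < \<pi> t)"
    using tendsto_prob_fraction pi_pos unfolding tendsto_prob_def by blast
  then show ?thesis
  proof (rule whp_mono)
    fix n w assume "dist (real (ntr A n w t) / real n) (\<pi> t) < \<pi> t"
    then have "real (ntr A n w t) / real n > 0" by (simp add: dist_real_def)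
    then show "ntr A n w t > 0 \<and> n > 0" by (auto simp: zero_less_divide_iff)
  qed
qed

lemma sample_cov_arm:
  fixes g h :: "(real^'k) \<times> (real^'p) \<Rightarrow> real"
  assumes [measurable]: "g \<in> borel_measurable (borel \<Otimes>\<^sub>M borel)" "h \<in> borel_measurable (borel \<Otimes>\<^sub>M borel)"
    and sq: "square_integrable (\<lambda>w. g (Yp 0 w, X 0 w))" "square_integrable (\<lambda>w. h (Yp 0 w, X 0 w))"
  defines "G \<equiv> \<lambda>i w. g (Yp i w, X i w)" and "H \<equiv> \<lambda>i w. h (Yp i w, X i w)"
  shows "tendsto_prob (\<lambda>n w. ((\<Sum>i\<in>arm A n w t. G i w * H i w) -
      (\<Sum>i\<in>arm A n w t. G i w) * (\<Sum>i\<in>arm A n w t. H i w) / real (ntr A n w t)) / real n)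
    (\<pi> t * ((\<integral>w. G 0 w * H 0 w \<partial>M) - (\<integral>w. G 0 w \<partial>M) * (\<integral>w. H 0 w \<partial>M)))"
proof -
  have GH: "tendsto_prob (\<lambda>n w. (\<Sum>i\<in>arm A n w t. G i w * H i w) / real n) (\<pi> t * (\<integral>w. G 0 w * H 0 w \<partial>M))"
    using lln_arm[of "\<lambda>d. g d * h d" t] square_integrable_mult[OF sq] by (simp add: G_def H_def)
  have G: "tendsto_prob (\<lambda>n w. (\<Sum>i\<in>arm A n w t. G i w) / real n) (\<pi> t * (\<integral>w. G 0 w \<partial>M))"
    using lln_arm[of g t] square_integrable_imp_integrable'[OF sq(1)] by (simp add: G_def)
  have H: "tendsto_prob (\<lambda>n w. (\<Sum>i\<in>arm A n w t. H i w) / real n) (\<pi> t * (\<integral>w. H 0 w \<partial>M))"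
    using lln_arm[of h t] square_integrable_imp_integrable'[OF sq(2)] by (simp add: H_def)
  have "\<pi> t \<noteq> 0" using pi_pos[of t] by simp
  note lim = tendsto_prob_diff[OF GH tendsto_prob_divide[OF tendsto_prob_mult[OF G H] tendsto_prob_fraction[of t] this]]
  have "\<pi> t * (\<integral>w. G 0 w * H 0 w \<partial>M) - \<pi> t * (\<integral>w. G 0 w \<partial>M) * (\<pi> t * (\<integral>w. H 0 w \<partial>M)) / \<pi> t =
      \<pi> t * ((\<integral>w. G 0 w * H 0 w \<partial>M) - (\<integral>w. G 0 w \<partial>M) * (\<integral>w. H 0 w \<partial>M))"
    using \<open>\<pi> t \<noteq> 0\<close> by (simp add: field_simps)
  then show ?thesis
  proof (elim subst, intro tendsto_prob_whp_cong[OF lim])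
    show "whp (\<lambda>n w. (\<Sum>i\<in>arm A n w t. G i w * H i w) / real n -
         (\<Sum>i\<in>arm A n w t. G i w) / real n * ((\<Sum>i\<in>arm A n w t. H i w) / real n) / (real (ntr A n w t) / real n) =
         ((\<Sum>i\<in>arm A n w t. G i w * H i w) -
           (\<Sum>i\<in>arm A n w t. G i w) * (\<Sum>i\<in>arm A n w t. H i w) / real (ntr A n w t)) / real n)"
      using whp_arm_nonempty[of t] by (rule whp_mono) (simp add: field_simps)
  qed
qed

lemma sample_cov_all:
  fixes g h :: "(real^'k) \<times> (real^'p) \<Rightarrow> real"
  assumes [measurable]: "g \<in> borel_measurable (borel \<Otimes>\<^sub>M borel)" "h \<in> borel_measurable (borel \<Otimes>\<^sub>M borel)"
    and sq: "square_integrable (\<lambda>w. g (Yp 0 w, X 0 w))" "square_integrable (\<lambda>w. h (Yp 0 w, X 0 w))"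
  defines "G \<equiv> \<lambda>i w. g (Yp i w, X i w)" and "H \<equiv> \<lambda>i w. h (Yp i w, X i w)"
  shows "tendsto_prob (\<lambda>n w. ((\<Sum>i<n. G i w * H i w) - (\<Sum>i<n. G i w) * (\<Sum>i<n. H i w) / real n) / real n)
    ((\<integral>w. G 0 w * H 0 w \<partial>M) - (\<integral>w. G 0 w \<partial>M) * (\<integral>w. H 0 w \<partial>M))"
proof -
  have GH: "tendsto_prob (\<lambda>n w. (\<Sum>i<n. G i w * H i w) / real n) (\<integral>w. G 0 w * H 0 w \<partial>M)"
    using lln_all[of "\<lambda>d. g d * h d"] square_integrable_mult[OF sq] by (simp add: G_def H_def)
  have G: "tendsto_prob (\<lambda>n w. (\<Sum>i<n. G i w) / real n) (\<integral>w. G 0 w \<partial>M)"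
    using lln_all[of g] square_integrable_imp_integrable'[OF sq(1)] by (simp add: G_def)
  have H: "tendsto_prob (\<lambda>n w. (\<Sum>i<n. H i w) / real n) (\<integral>w. H 0 w \<partial>M)"
    using lln_all[of h] square_integrable_imp_integrable'[OF sq(2)] by (simp add: H_def)
  show ?thesis
    using tendsto_prob_diff[OF GH tendsto_prob_mult[OF G H]] by (simp add: diff_divide_distrib)
qed

lemma square_integrable_Y: "square_integrable (\<lambda>w. Yp 0 w $ t)"
  using mom_Y by (simp add: square_integrable_def)

lemma square_integrable_X: "square_integrable (\<lambda>w. X 0 w $ j)"
  unfolding square_integrable_def
proof
  show "integrable M (\<lambda>w. (X 0 w $ j)\<^sup>2)"
  proof (rule Bochner_Integration.integrable_bound[OF mom_X])
    have "(X 0 w $ j)\<^sup>2 \<le> (norm (X 0 w))\<^sup>2" for w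
      using component_le_norm_cart[of "X 0 w" j] by (intro power2_le_iff_abs_le[THEN iffD2]) auto
    then show "AE w in M. norm ((X 0 w $ j)\<^sup>2) \<le> norm ((norm (X 0 w))\<^sup>2)" by simp
  qed measurable
qed measurable

lemma mean_X: "(\<integral>w. X 0 w $ j \<partial>M) = \<mu> $ j" by (simp add: mu_X_def)

lemma mean_Y: "(\<integral>w. Yp 0 w $ t \<partial>M) = \<theta> $ t" by (simp add: theta_def)

lemma expectation_mult_centered:
  assumes "square_integrable f" "square_integrable g"
  shows "(\<integral>w. (f w - expectation f) * (g w - expectation g) \<partial>M) = (\<integral>w. f w * g w \<partial>M) - expectation f * expectation g"
proof -
  define a b where "a = expectation f" and "b = expectation g"
  have "(f w - a) * (g w - b) = f w * g w - b * f w - a * g w + a * b" for w by (simp add: algebra_simps)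
  then have "(\<integral>w. (f w - a) * (g w - b) \<partial>M) = (\<integral>w. f w * g w \<partial>M) - b * expectation f - a * expectation g + a * b"
    using square_integrable_mult[OF assms] assms[THEN square_integrable_imp_integrable'] by (simp add: prob_space)
  then show ?thesis by (simp add: a_def b_def)
qed

lemma Sigma_X_eq: "\<Sigma> $ j $ l = (\<integral>w. X 0 w $ j * X 0 w $ l \<partial>M) - \<mu> $ j * \<mu> $ l"
  using expectation_mult_centered[OF square_integrable_X[of j] square_integrable_X[of l]]
  by (simp add: Sigma_X_def mean_X)

lemma cov_XY_eq: "cov_XY M Yp X t $ j = (\<integral>w. Yp 0 w $ t * X 0 w $ j \<partial>M) - \<theta> $ t * \<mu> $ j"
  using expectation_mult_centered[OF square_integrable_X[of j] square_integrable_Y[of t]]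
  by (simp add: cov_XY_def mean_X mean_Y mult.commute)

lemma det_Sigma: "det \<Sigma> \<noteq> 0"
proof
  assume "det \<Sigma> = 0"
  then have "\<not> invertible \<Sigma>" by (simp add: invertible_det_nz)
  then obtain v where "v \<noteq> 0" "\<Sigma> *v v = 0"
    using matrix_left_invertible_ker invertible_left_inverse by blast
  with posdef[of v] show False by simp
qed

lemma Sigma_beta: "\<Sigma> *v \<beta> t = cov_XY M Yp X t"
  using matrix_inv_mult_eq_iff[OF det_Sigma, of "cov_XY M Yp X t" "\<beta> t"] by (simp add: beta_def)

lemma Sigma_sym: "\<Sigma> $ i $ j = \<Sigma> $ j $ i"
  by (simp add: Sigma_X_def mult.commute)

definition scatter :: "nat set \<Rightarrow> real^'p \<Rightarrow> 'a \<Rightarrow> real^'p^'p" where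
  "scatter S m w = (\<Sum>i\<in>S. outer (X i w - m) (X i w - m))"

definition cross :: "nat \<Rightarrow> 'a \<Rightarrow> 'k \<Rightarrow> real^'p" where
  "cross n w t = (\<Sum>i\<in>arm A n w t. Yobs Yp A i w *\<^sub>R (X i w - Xbar_arm X A n w t))"

lemma tendsto_prob_scatter_arm:
  "tendsto_prob (\<lambda>n w. (1 / real n) *\<^sub>R scatter (arm A n w t) (Xbar_arm X A n w t) w) (\<pi> t *\<^sub>R \<Sigma>)"
proof (intro tendsto_prob_vec)
  fix j l
  have eq: "((1 / real n) *\<^sub>R scatter (arm A n w t) (Xbar_arm X A n w t) w) $ j $ l =
     ((\<Sum>i\<in>arm A n w t. X i w $ j * X i w $ l) -
      (\<Sum>i\<in>arm A n w t. X i w $ j) * (\<Sum>i\<in>arm A n w t. X i w $ l) / real (ntr A n w t)) / real n" for n w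
    using sum_centered_mult_centered[of "arm A n w t" "\<lambda>i. X i w $ j" "\<lambda>i. X i w $ l"]
    by (simp add: scatter_def outer_def Xbar_arm_def ntr_def)
  show "tendsto_prob (\<lambda>n w. ((1 / real n) *\<^sub>R scatter (arm A n w t) (Xbar_arm X A n w t) w) $ j $ l) ((\<pi> t *\<^sub>R \<Sigma>) $ j $ l)"
    unfolding eq using sample_cov_arm[of "\<lambda>d. snd d $ j" "\<lambda>d. snd d $ l" t] square_integrable_X
    by (simp add: Sigma_X_eq mean_X)
qed

lemma tendsto_prob_scatter_all:
  "tendsto_prob (\<lambda>n w. (1 / real n) *\<^sub>R scatter {..<n} (Xbar X n w) w) \<Sigma>"
proof (intro tendsto_prob_vec)
  fix j l
  have eq: "((1 / real n) *\<^sub>R scatter {..<n} (Xbar X n w) w) $ j $ l =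
     ((\<Sum>i<n. X i w $ j * X i w $ l) - (\<Sum>i<n. X i w $ j) * (\<Sum>i<n. X i w $ l) / real n) / real n" for n w
    using sum_centered_mult_centered[of "{..<n}" "\<lambda>i. X i w $ j" "\<lambda>i. X i w $ l"]
    by (simp add: scatter_def outer_def Xbar_def)
  show "tendsto_prob (\<lambda>n w. ((1 / real n) *\<^sub>R scatter {..<n} (Xbar X n w) w) $ j $ l) (\<Sigma> $ j $ l)"
    unfolding eq using sample_cov_all[of "\<lambda>d. snd d $ j" "\<lambda>d. snd d $ l"] square_integrable_X
    by (simp add: Sigma_X_eq mean_X)
qed

lemma tendsto_prob_cross:
  "tendsto_prob (\<lambda>n w. (1 / real n) *\<^sub>R cross n w t) (\<pi> t *\<^sub>R cov_XY M Yp X t)"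
proof (intro tendsto_prob_vec)
  fix j
  have eq: "((1 / real n) *\<^sub>R cross n w t) $ j =
     ((\<Sum>i\<in>arm A n w t. Yp i w $ t * X i w $ j) -
      (\<Sum>i\<in>arm A n w t. Yp i w $ t) * (\<Sum>i\<in>arm A n w t. X i w $ j) / real (ntr A n w t)) / real n" for n w
    using sum_centered_mult[of "arm A n w t" "\<lambda>i. Yp i w $ t" "\<lambda>i. X i w $ j"]
      sum_arm_Yobs[of "\<lambda>y i. y * (X i w $ j - Xbar_arm X A n w t $ j)" w n t]
    by (simp add: cross_def Xbar_arm_def ntr_def)
  show "tendsto_prob (\<lambda>n w. ((1 / real n) *\<^sub>R cross n w t) $ j) ((\<pi> t *\<^sub>R cov_XY M Yp X t) $ j)"
    unfolding eq using sample_cov_arm[of "\<lambda>d. fst d $ t" "\<lambda>d. snd d $ j" t] square_integrable_X square_integrable_Y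
    by (simp add: cov_XY_eq mean_X mean_Y)
qed

lemma tendsto_prob_beta_hat_ANHC: "tendsto_prob (\<lambda>n w. beta_hat_ANHC Yp X A n w t) (\<beta> t)"
proof -
  have "det (\<pi> t *\<^sub>R \<Sigma>) \<noteq> 0" using det_Sigma pi_pos[of t] by (simp add: det_scaleR)
  from tendsto_prob_matrix_inv_mult[OF tendsto_prob_scatter_arm tendsto_prob_cross[of t] this]
  show ?thesis
    using matrix_inv_mult_scaleR[OF det_Sigma, of "\<pi> t" "cov_XY M Yp X t"] pi_pos[of t]
    by (simp add: beta_hat_ANHC_def scatter_def cross_def beta_def)
qed

lemma tendsto_prob_beta_hat_ANC: "tendsto_prob (\<lambda>n w. beta_hat_ANC Yp X A n w) (beta_bar M Yp X \<pi>)"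
proof -
  have S: "tendsto_prob (\<lambda>n w. (1 / real n) *\<^sub>R (\<Sum>t\<in>UNIV. scatter (arm A n w t) (Xbar_arm X A n w t) w)) \<Sigma>"
    using tendsto_prob_sum[of UNIV _ "\<lambda>t. \<pi> t *\<^sub>R \<Sigma>", OF finite_class.finite_UNIV tendsto_prob_scatter_arm]
    by (simp add: scaleR_sum_right[symmetric] scaleR_sum_left[symmetric] pi_sum)
  have C: "tendsto_prob (\<lambda>n w. (1 / real n) *\<^sub>R (\<Sum>t\<in>UNIV. cross n w t)) (\<Sum>t\<in>UNIV. \<pi> t *\<^sub>R cov_XY M Yp X t)"
    using tendsto_prob_sum[of UNIV _ "\<lambda>t. \<pi> t *\<^sub>R cov_XY M Yp X t", OF finite_class.finite_UNIV tendsto_prob_cross]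
    by (simp add: scaleR_sum_right[symmetric])
  have "matrix_inv \<Sigma> *v (\<Sum>t\<in>UNIV. \<pi> t *\<^sub>R cov_XY M Yp X t) = beta_bar M Yp X \<pi>"
    unfolding beta_bar_def beta_def
    by (simp add: linear_sum[OF matrix_vector_mul_linear] matrix_vector_mult_scaleR)
  with tendsto_prob_matrix_inv_mult[OF S C det_Sigma] show ?thesis
    by (simp add: beta_hat_ANC_def scatter_def cross_def)
qed

lemma tendsto_prob_beta_hat_ANHC': "tendsto_prob (\<lambda>n w. beta_hat_ANHC' Yp X A n w t) (\<beta> t)"
proof -
  note B = tendsto_prob_matrix_inv_mult[OF tendsto_prob_scatter_all tendsto_prob_cross[of t] det_Sigma]
  have lim: "matrix_inv \<Sigma> *v (\<pi> t *\<^sub>R cov_XY M Yp X t) = \<pi> t *\<^sub>R \<beta> t"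
    by (simp add: beta_def matrix_vector_mult_scaleR)
  have "\<pi> t \<noteq> 0" using pi_pos[of t] by simp
  then have "isCont (\<lambda>p. (1 / fst p) *\<^sub>R (snd p :: real^'p)) (\<pi> t, \<pi> t *\<^sub>R \<beta> t)"
    by (intro continuous_intros) auto
  from tendsto_prob_isCont[OF tendsto_prob_Pair[OF tendsto_prob_fraction B[unfolded lim]] this]
  show ?thesis using \<open>\<pi> t \<noteq> 0\<close>
    by (simp add: beta_hat_ANHC'_def scatter_def cross_def)
qed

definition resid :: "('k \<Rightarrow> real^'p) \<Rightarrow> 'k \<Rightarrow> (real^'k) \<times> (real^'p) \<Rightarrow> real" where
  "resid b t d = (fst d $ t - \<theta> $ t) - b t \<bullet> (snd d - \<mu>)"

text \<open>The summand of the first-order expansion of the scaled estimation error.\<close>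

definition influence :: "('k \<Rightarrow> real^'p) \<Rightarrow> nat \<Rightarrow> 'a \<Rightarrow> real^'k" where
  "influence b i w = (\<chi> t. assigned t i w * (resid b t (Yp i w, X i w) / \<pi> t) + b t \<bullet> (X i w - \<mu>))"

lemma measurable_resid [measurable]: "resid b t \<in> borel_measurable (borel \<Otimes>\<^sub>M borel)"
  unfolding resid_def by measurable

lemma square_integrable_X_centered: "square_integrable (\<lambda>w. X 0 w $ j - \<mu> $ j)"
  by (intro square_integrable_diff square_integrable_X square_integrable_const)

lemma square_integrable_Y_centered: "square_integrable (\<lambda>w. Yp 0 w $ t - \<theta> $ t)"
  by (intro square_integrable_diff square_integrable_Y square_integrable_const)

lemma inner_X_centered: "u \<bullet> (X i w - \<mu>) = (\<Sum>j\<in>UNIV. u $ j * (X i w $ j - \<mu> $ j))"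
  by (simp add: inner_vec_def)

lemma square_integrable_inner_X: "square_integrable (\<lambda>w. u \<bullet> (X 0 w - \<mu>))"
  unfolding inner_X_centered
  by (intro square_integrable_sum square_integrable_cmult square_integrable_X_centered) simp

lemma square_integrable_resid: "square_integrable (\<lambda>w. resid b t (Yp 0 w, X 0 w))"
  unfolding resid_def fst_conv snd_conv
  by (intro square_integrable_diff[OF square_integrable_Y_centered square_integrable_inner_X])

lemma mean_X_centered: "(\<integral>w. X 0 w $ j - \<mu> $ j \<partial>M) = 0"
  using square_integrable_imp_integrable'[OF square_integrable_X] by (simp add: mean_X prob_space)

lemma mean_inner_X: "(\<integral>w. u \<bullet> (X 0 w - \<mu>) \<partial>M) = 0"
proof -
  have "(\<integral>w. u \<bullet> (X 0 w - \<mu>) \<partial>M) = (\<Sum>j\<in>UNIV. \<integral>w. u $ j * (X 0 w $ j - \<mu> $ j) \<partial>M)"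
    unfolding inner_X_centered
    by (intro Bochner_Integration.integral_sum integrable_mult_right square_integrable_imp_integrable'
        square_integrable_X_centered)
  also have "\<dots> = 0" by (simp only: integral_mult_right_zero mean_X_centered) simp
  finally show ?thesis .
qed

lemma mean_resid: "(\<integral>w. resid b t (Yp 0 w, X 0 w) \<partial>M) = 0"
  unfolding resid_def fst_conv snd_conv
  using square_integrable_imp_integrable'[OF square_integrable_inner_X[of "b t"]]
    square_integrable_imp_integrable'[OF square_integrable_Y[of t]]
  by (subst Bochner_Integration.integral_diff) (simp_all add: mean_inner_X mean_Y prob_space)

lemma cov_inner_X: "(\<integral>w. (u \<bullet> (X 0 w - \<mu>)) * (v \<bullet> (X 0 w - \<mu>)) \<partial>M) = u \<bullet> (\<Sigma> *v v)"
proof -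
  have "(\<integral>w. (u \<bullet> (X 0 w - \<mu>)) * (v \<bullet> (X 0 w - \<mu>)) \<partial>M) =
    (\<integral>w. (\<Sum>j\<in>UNIV. \<Sum>l\<in>UNIV. (u $ j * v $ l) * ((X 0 w $ j - \<mu> $ j) * (X 0 w $ l - \<mu> $ l))) \<partial>M)"
    unfolding inner_X_centered sum_product by (simp add: mult_ac)
  also have "\<dots> = (\<Sum>j\<in>UNIV. \<Sum>l\<in>UNIV. (u $ j * v $ l) * (\<integral>w. (X 0 w $ j - \<mu> $ j) * (X 0 w $ l - \<mu> $ l) \<partial>M))"
    using square_integrable_mult[OF square_integrable_X_centered square_integrable_X_centered]
    by simp
  also have "\<dots> = u \<bullet> (\<Sigma> *v v)"
    by (simp add: inner_vec_def matrix_vector_mult_def Sigma_X_def sum_distrib_left mult_ac)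
  finally show ?thesis .
qed

lemma cov_Y_inner_X: "(\<integral>w. (Yp 0 w $ t - \<theta> $ t) * (u \<bullet> (X 0 w - \<mu>)) \<partial>M) = u \<bullet> (\<Sigma> *v \<beta> t)"
proof -
  have "(\<integral>w. (Yp 0 w $ t - \<theta> $ t) * (u \<bullet> (X 0 w - \<mu>)) \<partial>M) =
    (\<integral>w. (\<Sum>j\<in>UNIV. u $ j * ((X 0 w $ j - \<mu> $ j) * (Yp 0 w $ t - \<theta> $ t))) \<partial>M)"
    unfolding inner_X_centered sum_distrib_left by (simp add: mult_ac)
  also have "\<dots> = (\<Sum>j\<in>UNIV. u $ j * (\<integral>w. (X 0 w $ j - \<mu> $ j) * (Yp 0 w $ t - \<theta> $ t) \<partial>M))"
    using square_integrable_mult[OF square_integrable_X_centered square_integrable_Y_centered]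
    by simp
  also have "\<dots> = u \<bullet> (\<Sigma> *v \<beta> t)"
    unfolding Sigma_beta by (simp add: inner_vec_def cov_XY_def)
  finally show ?thesis .
qed

lemma Sigma_inner_commute: "u \<bullet> (\<Sigma> *v v) = v \<bullet> (\<Sigma> *v u)"
  by (rule symmetric_matrix_inner_commute[OF Sigma_sym])

lemma cov_resid_inner_X:
  "(\<integral>w. resid b t (Yp 0 w, X 0 w) * (u \<bullet> (X 0 w - \<mu>)) \<partial>M) = u \<bullet> (\<Sigma> *v \<beta> t) - b t \<bullet> (\<Sigma> *v u)"
  unfolding resid_def fst_conv snd_conv left_diff_distrib
  using square_integrable_mult[OF square_integrable_inner_X square_integrable_inner_X, of "b t" u]
    square_integrable_mult[OF square_integrable_Y_centered square_integrable_inner_X, of t u]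
  by (subst Bochner_Integration.integral_diff)
     (simp_all only: left_diff_distrib[symmetric] cov_inner_X cov_Y_inner_X)

lemma var_eq_resid: "var M (\<lambda>w. Yp 0 w $ t - b t \<bullet> X 0 w) = (\<integral>w. (resid b t (Yp 0 w, X 0 w))\<^sup>2 \<partial>M)"
proof -
  have "(\<integral>w. Yp 0 w $ t - b t \<bullet> X 0 w \<partial>M) = (\<integral>w. resid b t (Yp 0 w, X 0 w) + (\<theta> $ t - b t \<bullet> \<mu>) \<partial>M)"
    by (intro Bochner_Integration.integral_cong refl) (simp add: resid_def inner_diff_right)
  also have "\<dots> = \<theta> $ t - b t \<bullet> \<mu>"
    using square_integrable_imp_integrable'[OF square_integrable_resid] by (simp add: mean_resid prob_space)
  finally have m: "(\<integral>w. Yp 0 w $ t - b t \<bullet> X 0 w \<partial>M) = \<theta> $ t - b t \<bullet> \<mu>" .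
  show ?thesis
    unfolding var_def m
    by (intro Bochner_Integration.integral_cong refl arg_cong[where f = "\<lambda>x. x\<^sup>2"])
       (simp add: resid_def inner_diff_right)
qed

lemma var_expand:
  "var M (\<lambda>w. Yp 0 w $ t - b t \<bullet> X 0 w) =
    (\<integral>w. (Yp 0 w $ t - \<theta> $ t)\<^sup>2 \<partial>M) - 2 * (b t \<bullet> (\<Sigma> *v \<beta> t)) + b t \<bullet> (\<Sigma> *v b t)"
proof -
  let ?y = "\<lambda>w. Yp 0 w $ t - \<theta> $ t" and ?x = "\<lambda>w. b t \<bullet> (X 0 w - \<mu>)"
  have "(\<integral>w. (resid b t (Yp 0 w, X 0 w))\<^sup>2 \<partial>M) = (\<integral>w. (?y w)\<^sup>2 - 2 * (?y w * ?x w) + ?x w * ?x w \<partial>M)"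
    unfolding resid_def fst_conv snd_conv by (intro Bochner_Integration.integral_cong refl) (simp add: power2_eq_square algebra_simps)
  also have "\<dots> = (\<integral>w. (?y w)\<^sup>2 \<partial>M) - 2 * (\<integral>w. ?y w * ?x w \<partial>M) + (\<integral>w. ?x w * ?x w \<partial>M)"
  proof -
    have "integrable M (\<lambda>w. (?y w)\<^sup>2)" using square_integrable_Y_centered by (simp add: square_integrable_def)
    moreover have "integrable M (\<lambda>w. ?y w * ?x w)" "integrable M (\<lambda>w. ?x w * ?x w)"
      by (intro square_integrable_mult square_integrable_Y_centered square_integrable_inner_X)+
    ultimately show ?thesis by (simp only: Bochner_Integration.integral_add Bochner_Integration.integral_diff
          Bochner_Integration.integrable_diff integrable_mult_right integral_mult_right_zero)
  qed
  finally show ?thesis unfolding var_eq_resid cov_Y_inner_X cov_inner_X .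
qed

lemma assigned_mult: "assigned t i w * assigned s i w = (if t = s then assigned t i w else 0)"
  by (auto simp: assigned_def)

lemma influence_cov:
  "V_SR M Yp X \<pi> b $ t $ s = (\<integral>w. influence b 0 w $ t * influence b 0 w $ s \<partial>M)"
proof -
  let ?R = "\<lambda>t w. resid b t (Yp 0 w, X 0 w)" and ?B = "\<lambda>t w. b t \<bullet> (X 0 w - \<mu>)" and ?I = "\<lambda>t. assigned t 0"
  have pi: "\<pi> t \<noteq> 0" for t using pi_pos[of t] by simp
  have eq: "influence b 0 w $ t * influence b 0 w $ s =
      (if t = s then 1 / (\<pi> t)\<^sup>2 else 0) * (?I t w * (?R t w * ?R t w)) + (1 / \<pi> t) * (?I t w * (?R t w * ?B s w)) +
      (1 / \<pi> s) * (?I s w * (?R s w * ?B t w)) + ?B t w * ?B s w" for w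
  proof -
    have "influence b 0 w $ t * influence b 0 w $ s =
        (?I t w * ?I s w) * (?R t w * ?R s w / (\<pi> t * \<pi> s)) + (1 / \<pi> t) * (?I t w * (?R t w * ?B s w)) +
        (1 / \<pi> s) * (?I s w * (?R s w * ?B t w)) + ?B t w * ?B s w"
      by (simp add: influence_def algebra_simps)
    then show ?thesis unfolding assigned_mult by (auto simp: power2_eq_square)
  qed
  have RR: "integrable M (\<lambda>w. ?I t w * (?R t w * ?R t w))"
    "(\<integral>w. ?I t w * (?R t w * ?R t w) \<partial>M) = \<pi> t * (\<integral>w. ?R t w * ?R t w \<partial>M)"
    using assigned_integral[of "\<lambda>d. resid b t d * resid b t d" t]
      square_integrable_mult[OF square_integrable_resid square_integrable_resid] by simp_all
  have RB: "integrable M (\<lambda>w. ?I t w * (?R t w * ?B s w))"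
    "(\<integral>w. ?I t w * (?R t w * ?B s w) \<partial>M) = \<pi> t * (\<integral>w. ?R t w * ?B s w \<partial>M)" for t s
    using assigned_integral[of "\<lambda>d. resid b t d * (b s \<bullet> (snd d - \<mu>))" t]
      square_integrable_mult[OF square_integrable_resid square_integrable_inner_X] by simp_all
  have BB: "integrable M (\<lambda>w. ?B t w * ?B s w)"
    by (intro square_integrable_mult square_integrable_inner_X)
  have "(\<integral>w. influence b 0 w $ t * influence b 0 w $ s \<partial>M) =
      (if t = s then 1 / (\<pi> t)\<^sup>2 else 0) * (\<pi> t * (\<integral>w. ?R t w * ?R t w \<partial>M)) +
      (1 / \<pi> t) * (\<pi> t * (\<integral>w. ?R t w * ?B s w \<partial>M)) + (1 / \<pi> s) * (\<pi> s * (\<integral>w. ?R s w * ?B t w \<partial>M)) +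
      (\<integral>w. ?B t w * ?B s w \<partial>M)"
    unfolding eq by (simp only: RR RB BB Bochner_Integration.integral_add Bochner_Integration.integrable_add
        integrable_mult_right integral_mult_right_zero)
  also have "\<dots> = (if t = s then (\<integral>w. ?R t w * ?R t w \<partial>M) / \<pi> t else 0) +
      (b s \<bullet> (\<Sigma> *v \<beta> t) - b t \<bullet> (\<Sigma> *v b s)) + (b t \<bullet> (\<Sigma> *v \<beta> s) - b s \<bullet> (\<Sigma> *v b t)) + b t \<bullet> (\<Sigma> *v b s)"
    unfolding cov_resid_inner_X cov_inner_X using pi by (auto simp: power2_eq_square)
  also have "\<dots> = V_SR M Yp X \<pi> b $ t $ s"
    unfolding V_SR_def
    using Sigma_inner_commute[of "b s" "\<beta> t"] Sigma_inner_commute[of "b s" "b t"]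
    by (simp add: var_eq_resid power2_eq_square)
  finally show ?thesis by simp
qed

lemma iid_influence: "iid borel (influence b)"
proof -
  have "iid borel (\<lambda>i w. (\<lambda>(a, d). \<chi> t. (if a = t then 1 else 0) * (resid b t d / \<pi> t) + b t \<bullet> (snd d - \<mu>))
      (A i w, Yp i w, X i w))"
    by (rule iid_compose[OF iid_records]) measurable
  then show ?thesis by (simp add: influence_def[abs_def] assigned_def)
qed

lemma square_integrable_assigned_mult:
  assumes "square_integrable f" shows "square_integrable (\<lambda>w. assigned t 0 w * f w)"
proof -
  have [measurable]: "f \<in> borel_measurable M" using assms by (simp add: square_integrable_def)
  show ?thesis
    unfolding square_integrable_def
  proof
    show "integrable M (\<lambda>w. (assigned t 0 w * f w)\<^sup>2)"
      by (rule Bochner_Integration.integrable_bound[of M "\<lambda>w. (f w)\<^sup>2"])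
         (use assms in \<open>auto simp: square_integrable_def assigned_def\<close>)
  qed measurable
qed

lemma influence_clt:
  shows "\<exists>N. is_mvnormal 0 (V_SR M Yp X \<pi> b) N \<and>
      conv_in_distr (\<lambda>n. distr M borel (\<lambda>w. (1 / sqrt (real n)) *\<^sub>R (\<Sum>i<n. influence b i w))) N"
    and "bounded_in_prob (\<lambda>n w. (1 / sqrt (real n)) *\<^sub>R (\<Sum>i<n. influence b i w))"
proof -
  have sq: "square_integrable (\<lambda>w. influence b 0 w $ t)" for t
  proof -
    have "square_integrable (\<lambda>w. assigned t 0 w * (1 / \<pi> t * resid b t (Yp 0 w, X 0 w)) + b t \<bullet> (X 0 w - \<mu>))"
      by (intro square_integrable_add square_integrable_assigned_mult square_integrable_cmult
          square_integrable_resid square_integrable_inner_X)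
    then show ?thesis by (simp add: influence_def)
  qed
  have mean: "(\<integral>w. influence b 0 w $ t \<partial>M) = 0" for t
  proof -
    note int = square_integrable_imp_integrable'[OF square_integrable_resid[of b t]]
    note I = assigned_integral[of "resid b t" t, OF measurable_resid int]
    have "(\<integral>w. influence b 0 w $ t \<partial>M) =
      (\<integral>w. (1 / \<pi> t) * (assigned t 0 w * resid b t (Yp 0 w, X 0 w)) + b t \<bullet> (X 0 w - \<mu>) \<partial>M)"
      by (simp add: influence_def)
    also have "\<dots> = 0"
      by (simp only: Bochner_Integration.integral_add integrable_mult_right I integral_mult_right_zero
          square_integrable_imp_integrable'[OF square_integrable_inner_X] mean_inner_X mean_resid)
    finally show ?thesis .
  qed
  have sq': "integrable M (\<lambda>w. (influence b 0 w $ t)\<^sup>2)" for t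
    using sq by (simp add: square_integrable_def)
  show "\<exists>N. is_mvnormal 0 (V_SR M Yp X \<pi> b) N \<and>
      conv_in_distr (\<lambda>n. distr M borel (\<lambda>w. (1 / sqrt (real n)) *\<^sub>R (\<Sum>i<n. influence b i w))) N"
    by (rule multivariate_clt(1)[OF iid_influence sq' mean influence_cov])
  show "bounded_in_prob (\<lambda>n w. (1 / sqrt (real n)) *\<^sub>R (\<Sum>i<n. influence b i w))"
    by (rule multivariate_clt(2)[OF iid_influence sq' mean influence_cov])
qed

lemma V_SR_diff_psd: "0 \<le> c \<bullet> ((V_SR M Yp X \<pi> b - V_SR M Yp X \<pi> \<beta>) *v c)"
proof -
  define d where "d t = \<beta> t - b t" for t
  let ?q = "\<lambda>u v. u \<bullet> (\<Sigma> *v v)"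
  have diff: "(V_SR M Yp X \<pi> b - V_SR M Yp X \<pi> \<beta>) $ t $ s = (if t = s then ?q (d t) (d t) / \<pi> t else 0) - ?q (d t) (d s)" for t s
  proof -
    have "?q (d t) (d s) = ?q (\<beta> t) (\<beta> s) - ?q (\<beta> t) (b s) - ?q (b t) (\<beta> s) + ?q (b t) (b s)" for t s
      by (simp add: d_def inner_diff_left inner_diff_right matrix_vector_mult_diff_distrib)
    note q = this
    have "var M (\<lambda>w. Yp 0 w $ t - b t \<bullet> X 0 w) - var M (\<lambda>w. Yp 0 w $ t - \<beta> t \<bullet> X 0 w) = ?q (d t) (d t)"
      unfolding var_expand q using Sigma_inner_commute[of "\<beta> t" "b t"] by simp
    then show ?thesis
      unfolding V_SR_def by (cases "t = s") (simp_all add: q diff_divide_distrib[symmetric])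
  qed
  define v where "v = (\<Sum>t\<in>UNIV. c $ t *\<^sub>R d t)"
  have qnn: "0 \<le> ?q u u" for u using posdef[of u] by (cases "u = 0") auto
  have qsum: "?q v u = (\<Sum>t\<in>UNIV. c $ t * ?q (d t) u)" for u
    by (simp add: v_def inner_sum_left)
  have "c \<bullet> ((V_SR M Yp X \<pi> b - V_SR M Yp X \<pi> \<beta>) *v c) =
      (\<Sum>t\<in>UNIV. (c $ t)\<^sup>2 * ?q (d t) (d t) / \<pi> t) - (\<Sum>t\<in>UNIV. \<Sum>s\<in>UNIV. c $ t * (c $ s * ?q (d t) (d s)))"
  proof -
    let ?W = "V_SR M Yp X \<pi> b - V_SR M Yp X \<pi> \<beta>"
    have "c \<bullet> (?W *v c) = (\<Sum>t\<in>UNIV. \<Sum>s\<in>UNIV. c $ t * c $ s * ?W $ t $ s)"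
      by (simp only: inner_vec_def matrix_vector_mult_def vec_lambda_beta sum_distrib_left inner_real_def mult_ac)
    also have "\<dots> = (\<Sum>t\<in>UNIV. \<Sum>s\<in>UNIV. (if t = s then c $ t * c $ s * (?q (d t) (d t) / \<pi> t) else 0) - c $ t * (c $ s * ?q (d t) (d s)))"
      unfolding diff by (intro sum.cong refl) (simp add: right_diff_distrib)
    also have "\<dots> = (\<Sum>t\<in>UNIV. (c $ t)\<^sup>2 * ?q (d t) (d t) / \<pi> t) - (\<Sum>t\<in>UNIV. \<Sum>s\<in>UNIV. c $ t * (c $ s * ?q (d t) (d s)))"
      by (simp add: sum_subtractf power2_eq_square)
    finally show ?thesis .
  qed
  also have "(\<Sum>t\<in>UNIV. \<Sum>s\<in>UNIV. c $ t * (c $ s * ?q (d t) (d s))) = ?q v v"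
  proof -
    have "?q (d t) v = (\<Sum>s\<in>UNIV. c $ s * ?q (d t) (d s))" for t
      using qsum[of "d t"] Sigma_inner_commute[of _ "d t"] by simp
    then show ?thesis by (simp add: qsum sum_distrib_left)
  qed
  also have "(\<Sum>t\<in>UNIV. (c $ t)\<^sup>2 * ?q (d t) (d t) / \<pi> t) - ?q v v =
      (\<Sum>t\<in>UNIV. \<pi> t * ?q ((c $ t / \<pi> t) *\<^sub>R d t - v) ((c $ t / \<pi> t) *\<^sub>R d t - v))"
  proof -
    have "\<pi> t * ?q ((c $ t / \<pi> t) *\<^sub>R d t - v) ((c $ t / \<pi> t) *\<^sub>R d t - v) =
        (c $ t)\<^sup>2 * ?q (d t) (d t) / \<pi> t - 2 * (c $ t * ?q (d t) v) + \<pi> t * ?q v v" for t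
      using pi_pos[of t] Sigma_inner_commute[of v "d t"]
      by (simp add: inner_diff_left inner_diff_right matrix_vector_mult_diff_distrib matrix_vector_mult_scaleR
          power2_eq_square field_simps)
    then have "(\<Sum>t\<in>UNIV. \<pi> t * ?q ((c $ t / \<pi> t) *\<^sub>R d t - v) ((c $ t / \<pi> t) *\<^sub>R d t - v)) =
      (\<Sum>t\<in>UNIV. (c $ t)\<^sup>2 * ?q (d t) (d t) / \<pi> t) - 2 * ?q v v + (\<Sum>t\<in>UNIV. \<pi> t) * ?q v v"
      by (simp only: sum.distrib sum_subtractf sum_distrib_left[symmetric] sum_distrib_right[symmetric] qsum[of v, symmetric])
    then show ?thesis by (simp add: pi_sum)
  qed
  also have "0 \<le> \<dots>" using qnn pi_pos by (intro sum_nonneg mult_nonneg_nonneg) (auto intro: less_imp_le)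
  finally show ?thesis by simp
qed

lemma measurable_sum_arm [measurable]:
  fixes f :: "nat \<Rightarrow> 'a \<Rightarrow> 'b::euclidean_space"
  assumes [measurable]: "\<And>i. f i \<in> borel_measurable M"
  shows "(\<lambda>w. \<Sum>i\<in>arm A n w t. f i w) \<in> borel_measurable M"
  unfolding sum_arm by measurable

lemma measurable_ntr [measurable]: "(\<lambda>w. real (ntr A n w t)) \<in> borel_measurable M"
  unfolding ntr_eq by measurable

lemma measurable_Xbar_arm [measurable]: "(\<lambda>w. Xbar_arm X A n w t) \<in> borel_measurable M"
  unfolding Xbar_arm_def by measurable

lemma measurable_Xbar [measurable]: "(\<lambda>w. Xbar X n w) \<in> borel_measurable M"
  unfolding Xbar_def by measurable

lemma Ybar_eq: "Ybar Yp A n w t = (\<Sum>i\<in>arm A n w t. Yp i w $ t) / real (ntr A n w t)"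
  unfolding Ybar_def using sum_arm_Yobs[of "\<lambda>y i. y" w n t] by simp

lemma measurable_theta_hat:
  assumes [measurable]: "\<And>t. (\<lambda>w. bh w t) \<in> borel_measurable M"
  shows "(\<lambda>w. theta_hat Yp X A (bh w) n w) \<in> borel_measurable M"
  unfolding theta_hat_def Ybar_eq by measurable

lemma measurable_scatter_arm [measurable]:
  "(\<lambda>w. scatter (arm A n w t) (Xbar_arm X A n w t) w) \<in> borel_measurable M"
  unfolding scatter_def outer_def by measurable

lemma measurable_scatter_all [measurable]: "(\<lambda>w. scatter {..<n} (Xbar X n w) w) \<in> borel_measurable M"
  unfolding scatter_def outer_def by measurable

lemma measurable_cross [measurable]: "(\<lambda>w. cross n w t) \<in> borel_measurable M"
proof -
  have "cross n w t = (\<Sum>i\<in>arm A n w t. Yp i w $ t *\<^sub>R (X i w - Xbar_arm X A n w t))" for w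
    unfolding cross_def by (intro sum.cong) (auto simp: arm_def Yobs_def)
  then show ?thesis by simp
qed

lemma measurable_beta_hats:
  shows measurable_beta_hat_ANC: "(\<lambda>w. beta_hat_ANC Yp X A n w) \<in> borel_measurable M"
    and measurable_beta_hat_ANHC: "(\<lambda>w. beta_hat_ANHC Yp X A n w t) \<in> borel_measurable M"
    and measurable_beta_hat_ANHC': "(\<lambda>w. beta_hat_ANHC' Yp X A n w t) \<in> borel_measurable M"
  unfolding beta_hat_ANC_def beta_hat_ANHC_def beta_hat_ANHC'_def scatter_def[symmetric] cross_def[symmetric]
  by measurable

lemma arm_scaled_sum_tight:
  fixes g :: "(real^'k) \<times> (real^'p) \<Rightarrow> real"
  assumes g: "g \<in> borel_measurable (borel \<Otimes>\<^sub>M borel)"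
    and sq: "square_integrable (\<lambda>w. g (Yp 0 w, X 0 w))" and mean: "(\<integral>w. g (Yp 0 w, X 0 w) \<partial>M) = 0"
  shows "bounded_in_prob (\<lambda>n w. (\<Sum>i\<in>arm A n w t. g (Yp i w, X i w)) / sqrt (real n))"
    and "bounded_in_prob (\<lambda>n w. (\<Sum>i<n. g (Yp i w, X i w)) / sqrt (real n))"
proof -
  have "(\<integral>w. assigned t 0 w * g (Yp 0 w, X 0 w) \<partial>M) = 0"
    using assigned_integral(2)[OF g square_integrable_imp_integrable'[OF sq]] mean by simp
  with iid_scaled_sum_tight[OF iid_assigned(1)[OF g, of t]] square_integrable_assigned_mult[OF sq, of t]
  show "bounded_in_prob (\<lambda>n w. (\<Sum>i\<in>arm A n w t. g (Yp i w, X i w)) / sqrt (real n))"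
    by (simp add: sum_arm square_integrable_def)
  show "bounded_in_prob (\<lambda>n w. (\<Sum>i<n. g (Yp i w, X i w)) / sqrt (real n))"
    using iid_scaled_sum_tight[OF iid_assigned(2)[OF g] _ mean] sq by (simp add: square_integrable_def)
qed

lemma scaled_error_expansion:
  assumes n: "n > 0" and N: "ntr A n w t > 0"
  shows "(sqrt (real n) *\<^sub>R (theta_hat Yp X A bh n w - \<theta>)) $ t - ((1 / sqrt (real n)) *\<^sub>R (\<Sum>i<n. influence b i w)) $ t =
    (real n / real (ntr A n w t) - 1 / \<pi> t) * ((\<Sum>i\<in>arm A n w t. resid b t (Yp i w, X i w)) / sqrt (real n))
    - (\<Sum>j\<in>UNIV. ((bh t - b t) $ j * (real n / real (ntr A n w t))) * ((\<Sum>i\<in>arm A n w t. X i w $ j - \<mu> $ j) / sqrt (real n))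
         - (bh t - b t) $ j * ((\<Sum>i<n. X i w $ j - \<mu> $ j) / sqrt (real n)))"
proof -
  define r where "r = sqrt (real n)"
  have r: "r > 0" "real n = r * r" using n by (simp_all add: r_def)
  define m where "m = real (ntr A n w t)"
  have m: "m > 0" "real (card (arm A n w t)) = m" using N by (simp_all add: m_def ntr_def)
  define Xa where "Xa = Xbar_arm X A n w t"
  define Xb where "Xb = Xbar X n w"
  have SXa: "(\<Sum>i\<in>arm A n w t. X i w) = m *\<^sub>R Xa" using m by (simp add: Xa_def Xbar_arm_def m_def)
  have SXb: "(\<Sum>i<n. X i w) = (r * r) *\<^sub>R Xb" using r by (simp add: Xb_def Xbar_def)
  have a: "(\<Sum>i\<in>arm A n w t. X i w $ j - \<mu> $ j) = m * (Xa - \<mu>) $ j" for j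
    using arg_cong[OF SXa, of "\<lambda>v. v $ j"] by (simp add: sum_subtractf m right_diff_distrib)
  have c: "(\<Sum>i<n. X i w $ j - \<mu> $ j) = r * r * (Xb - \<mu>) $ j" for j
    using arg_cong[OF SXb, of "\<lambda>v. v $ j"] by (simp add: sum_subtractf r(2) right_diff_distrib)
  have SR: "(\<Sum>i\<in>arm A n w t. resid b t (Yp i w, X i w)) = m * (Ybar Yp A n w t - \<theta> $ t - b t \<bullet> (Xa - \<mu>))"
  proof -
    have "(\<Sum>i\<in>arm A n w t. Yp i w $ t) = m * Ybar Yp A n w t" using m by (simp add: Ybar_eq m_def)
    moreover have "(\<Sum>i\<in>arm A n w t. b t \<bullet> (X i w - \<mu>)) = m * (b t \<bullet> (Xa - \<mu>))"
    proof -
      have "(\<Sum>i\<in>arm A n w t. b t \<bullet> (X i w - \<mu>)) = b t \<bullet> ((\<Sum>i\<in>arm A n w t. X i w) - m *\<^sub>R \<mu>)"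
        by (simp add: inner_sum_right sum_subtractf inner_diff_right m(2))
      then show ?thesis by (simp add: SXa inner_diff_right right_diff_distrib)
    qed
    ultimately show ?thesis
      by (simp add: resid_def sum_subtractf m(2) right_diff_distrib)
  qed
  have Sinf: "(\<Sum>i<n. influence b i w) $ t = (\<Sum>i\<in>arm A n w t. resid b t (Yp i w, X i w)) / \<pi> t + r * r * (b t \<bullet> (Xb - \<mu>))"
  proof -
    have "(\<Sum>i<n. b t \<bullet> (X i w - \<mu>)) = b t \<bullet> ((\<Sum>i<n. X i w) - (r * r) *\<^sub>R \<mu>)"
      by (simp add: inner_sum_right sum_subtractf inner_diff_right r(2))
    then have "(\<Sum>i<n. b t \<bullet> (X i w - \<mu>)) = r * r * (b t \<bullet> (Xb - \<mu>))"
      by (simp add: SXb inner_diff_right right_diff_distrib)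
    then show ?thesis
      by (simp add: influence_def sum.distrib sum_arm sum_divide_distrib)
  qed
  have "(\<Sum>j\<in>UNIV. ((bh t - b t) $ j * (real n / m)) * ((\<Sum>i\<in>arm A n w t. X i w $ j - \<mu> $ j) / r)
         - (bh t - b t) $ j * ((\<Sum>i<n. X i w $ j - \<mu> $ j) / r)) =
      (\<Sum>j\<in>UNIV. r * ((bh t - b t) $ j * (Xa - Xb) $ j))"
    unfolding a c by (intro sum.cong refl) (use r m in \<open>simp add: field_simps\<close>)
  also have "\<dots> = r * ((bh t - b t) \<bullet> (Xa - Xb))"
    by (simp add: inner_vec_def sum_distrib_left)
  finally have last: "(\<Sum>j\<in>UNIV. ((bh t - b t) $ j * (real n / m)) * ((\<Sum>i\<in>arm A n w t. X i w $ j - \<mu> $ j) / r)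
         - (bh t - b t) $ j * ((\<Sum>i<n. X i w $ j - \<mu> $ j) / r)) = r * ((bh t - b t) \<bullet> (Xa - Xb))" .
  define S where "S = (\<Sum>i\<in>arm A n w t. resid b t (Yp i w, X i w))"
  have lhs: "(sqrt (real n) *\<^sub>R (theta_hat Yp X A bh n w - \<theta>)) $ t - ((1 / sqrt (real n)) *\<^sub>R (\<Sum>i<n. influence b i w)) $ t =
      r * (Ybar Yp A n w t - bh t \<bullet> (Xa - Xb) - \<theta> $ t) - (S / \<pi> t + r * r * (b t \<bullet> (Xb - \<mu>))) / r"
    using Sinf by (simp add: theta_hat_def flip: r_def Xa_def Xb_def S_def)
  have "real n / m * (S / r) = r * (Ybar Yp A n w t - \<theta> $ t - b t \<bullet> (Xa - \<mu>))"
    unfolding S_def SR using r m by (simp add: field_simps)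
  then have "(real n / m - 1 / \<pi> t) * (S / r) = r * (Ybar Yp A n w t - \<theta> $ t - b t \<bullet> (Xa - \<mu>)) - S / \<pi> t / r"
    by (simp add: left_diff_distrib diff_divide_distrib)
  moreover have "(S / \<pi> t + r * r * (b t \<bullet> (Xb - \<mu>))) / r = S / \<pi> t / r + r * (b t \<bullet> (Xb - \<mu>))"
    using r by (simp add: add_divide_distrib)
  ultimately show ?thesis
    unfolding lhs unfolding r_def[symmetric] m_def[symmetric] last S_def[symmetric]
    by (simp add: inner_diff_left inner_diff_right algebra_simps)
qed

lemma scaled_error_tendsto_influence:
  assumes bhat: "\<And>t. tendsto_prob (\<lambda>n w. bhat n w t) (b t)"
  shows "tendsto_prob (\<lambda>n w. sqrt (real n) *\<^sub>R (theta_hat Yp X A (bhat n w) n w - \<theta>) -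
      (1 / sqrt (real n)) *\<^sub>R (\<Sum>i<n. influence b i w)) 0"
proof (rule tendsto_prob_vec)
  fix t
  have pi: "\<pi> t \<noteq> 0" using pi_pos[of t] by simp
  have inv: "tendsto_prob (\<lambda>n w. real n / real (ntr A n w t)) (1 / \<pi> t)"
    using tendsto_prob_divide[OF tendsto_prob_const[of 1] tendsto_prob_fraction[of t] pi] by simp
  have op: "tendsto_prob (\<lambda>n w. a n w * T n w) 0" if "tendsto_prob a 0" "bounded_in_prob T" for a T :: "nat \<Rightarrow> 'a \<Rightarrow> real"
    using that by (rule tendsto_prob_0_if_norm_le_mult_tight) (simp add: abs_mult)
  have R: "bounded_in_prob (\<lambda>n w. (\<Sum>i\<in>arm A n w t. resid b t (Yp i w, X i w)) / sqrt (real n))"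
    by (rule arm_scaled_sum_tight(1)[OF measurable_resid square_integrable_resid mean_resid])
  have T: "bounded_in_prob (\<lambda>n w. (\<Sum>i\<in>arm A n w t. X i w $ j - \<mu> $ j) / sqrt (real n))"
      "bounded_in_prob (\<lambda>n w. (\<Sum>i<n. X i w $ j - \<mu> $ j) / sqrt (real n))" for j
    using arm_scaled_sum_tight[of "\<lambda>d. snd d $ j - \<mu> $ j"] square_integrable_X_centered[of j] mean_X_centered[of j]
    by simp_all
  have bj: "tendsto_prob (\<lambda>n w. (bhat n w t - b t) $ j) 0" for j
  proof -
    have "isCont (\<lambda>v. (v - b t) $ j) (b t)" by (intro continuous_intros)
    from tendsto_prob_isCont[OF bhat this] show ?thesis by simp
  qed
  have bj': "tendsto_prob (\<lambda>n w. (bhat n w t - b t) $ j * (real n / real (ntr A n w t))) 0" for j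
    using tendsto_prob_mult[OF bj inv] by simp
  have a: "tendsto_prob (\<lambda>n w. real n / real (ntr A n w t) - 1 / \<pi> t) 0"
    using tendsto_prob_diff[OF inv tendsto_prob_const[of "1 / \<pi> t"]] by simp
  have "tendsto_prob (\<lambda>n w. \<Sum>j\<in>UNIV.
       ((bhat n w t - b t) $ j * (real n / real (ntr A n w t))) * ((\<Sum>i\<in>arm A n w t. X i w $ j - \<mu> $ j) / sqrt (real n))
         - (bhat n w t - b t) $ j * ((\<Sum>i<n. X i w $ j - \<mu> $ j) / sqrt (real n))) (\<Sum>j\<in>(UNIV::'p set). 0 - 0)"
    by (intro tendsto_prob_sum tendsto_prob_diff op bj bj' T) simp
  from tendsto_prob_diff[OF op[OF a R] this]
  have lim: "tendsto_prob (\<lambda>n w. (real n / real (ntr A n w t) - 1 / \<pi> t) * ((\<Sum>i\<in>arm A n w t. resid b t (Yp i w, X i w)) / sqrt (real n))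
    - (\<Sum>j\<in>UNIV. ((bhat n w t - b t) $ j * (real n / real (ntr A n w t))) * ((\<Sum>i\<in>arm A n w t. X i w $ j - \<mu> $ j) / sqrt (real n))
         - (bhat n w t - b t) $ j * ((\<Sum>i<n. X i w $ j - \<mu> $ j) / sqrt (real n)))) 0"
    by simp
  have "tendsto_prob (\<lambda>n w. (sqrt (real n) *\<^sub>R (theta_hat Yp X A (bhat n w) n w - \<theta>)) $ t -
      ((1 / sqrt (real n)) *\<^sub>R (\<Sum>i<n. influence b i w)) $ t) 0"
    by (rule tendsto_prob_whp_cong[OF lim], rule whp_mono[OF whp_arm_nonempty[of t]])
       (rule scaled_error_expansion[symmetric], simp_all)
  then show "tendsto_prob (\<lambda>n w. (sqrt (real n) *\<^sub>R (theta_hat Yp X A (bhat n w) n w - \<theta>) -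
      (1 / sqrt (real n)) *\<^sub>R (\<Sum>i<n. influence b i w)) $ t) (0 $ t)"
    by simp
qed

theorem estimator_clt:
  assumes meas: "\<And>n t. (\<lambda>w. bhat n w t) \<in> borel_measurable M"
    and bhat: "\<And>t. tendsto_prob (\<lambda>n w. bhat n w t) (b t)"
  shows "\<exists>N. is_mvnormal 0 (V_SR M Yp X \<pi> b) N \<and> conv_in_distr (law_est M Yp X A bhat) N"
proof -
  obtain N where N: "is_mvnormal 0 (V_SR M Yp X \<pi> b) N"
    "conv_in_distr (\<lambda>n. distr M borel (\<lambda>w. (1 / sqrt (real n)) *\<^sub>R (\<Sum>i<n. influence b i w))) N"
    using influence_clt(1) by blast
  note [measurable] = iid_measurable[OF iid_influence] measurable_theta_hat[OF meas]
  have "conv_in_distr (\<lambda>n. distr M borel (\<lambda>w. sqrt (real n) *\<^sub>R (theta_hat Yp X A (bhat n w) n w - \<theta>))) N"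
    by (rule conv_in_distr_slutsky[OF _ _ N(2) influence_clt(2) scaled_error_tendsto_influence[OF bhat]]) measurable
  then have "conv_in_distr (law_est M Yp X A bhat) N" by (simp add: law_est_def[abs_def])
  with N(1) show ?thesis by blast
qed

end

theorem theorem1:
  fixes M :: "'a measure"
    and Yp :: "nat \<Rightarrow> 'a \<Rightarrow> real^'k"
    and Z :: "nat \<Rightarrow> 'a \<Rightarrow> 'z::countable"
    and X :: "nat \<Rightarrow> 'a \<Rightarrow> real^'p"
    and A :: "nat \<Rightarrow> 'a \<Rightarrow> 'k"
    and \<pi> :: "'k \<Rightarrow> real"
  defines "MW \<equiv> (borel :: (real^'k) measure) \<Otimes>\<^sub>M (count_space (UNIV :: 'z set) \<Otimes>\<^sub>M (borel :: (real^'p) measure))"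
  assumes P: "prob_space M"
    \<comment> \<open>(C1): the patient records (Y_i^(1..k), Z_i, X_i) are i.i.d.\<close>
    and iid_indep: "prob_space.indep_vars M (\<lambda>_. MW) (\<lambda>i w. (Yp i w, Z i w, X i w)) UNIV"
    and iid_distr: "\<And>i. distr M MW (\<lambda>w. (Yp i w, Z i w, X i w)) = distr M MW (\<lambda>w. (Yp 0 w, Z 0 w, X 0 w))"
    \<comment> \<open>finite second moments\<close>
    and mom_Y: "\<And>t. integrable M (\<lambda>w. (Yp 0 w $ t)\<^sup>2)"
    and mom_X: "integrable M (\<lambda>w. (norm (X 0 w))\<^sup>2)"
    \<comment> \<open>Sigma_X positive definite\<close>
    and posdef: "\<And>v. v \<noteq> 0 \<Longrightarrow> v \<bullet> (Sigma_X M X *v v) > 0"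
    \<comment> \<open>assignment proportions\<close>
    and pi_pos: "\<And>t. 0 < \<pi> t" and pi_lt1: "\<And>t. \<pi> t < 1" and pi_sum: "(\<Sum>t\<in>UNIV. \<pi> t) = 1"
    \<comment> \<open>simple randomization: A_i i.i.d. with P(A_i = a_t) = pi_t, independent of all records\<close>
    and A_indep: "prob_space.indep_vars M (\<lambda>_. count_space UNIV) A UNIV"
    and A_prob: "\<And>i t. measure M {w \<in> space M. A i w = t} = \<pi> t"
    and A_W_indep: "prob_space.indep_set M
        {(\<lambda>w i. A i w) -` S \<inter> space M | S. S \<in> sets (Pi\<^sub>M UNIV (\<lambda>_. count_space UNIV))}
        {(\<lambda>w i. (Yp i w, Z i w, X i w)) -` S \<inter> space M | S. S \<in> sets (Pi\<^sub>M UNIV (\<lambda>_. MW))}"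
  shows
    \<comment> \<open>(i) general estimated coefficients converging in probability\<close>
    "(\<forall>(bhat :: nat \<Rightarrow> 'a \<Rightarrow> 'k \<Rightarrow> real^'p) (b :: 'k \<Rightarrow> real^'p).
        (\<forall>n t. (\<lambda>w. bhat n w t) \<in> borel_measurable M) \<and>
        (\<forall>t e. e > 0 \<longrightarrow>
           (\<lambda>n. measure M {w \<in> space M. norm (bhat n w t - b t) > e}) \<longlonglongrightarrow> 0)
        \<longrightarrow> (\<exists>N. is_mvnormal 0 (V_SR M Yp X \<pi> b) N \<and>
                 conv_in_distr (law_est M Yp X A bhat) N))
    \<comment> \<open>theta-hat_AN (b_t = 0)\<close>
     \<and> (\<exists>N. is_mvnormal 0 (V_SR M Yp X \<pi> (\<lambda>_. 0)) N \<and>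
            conv_in_distr (law_est M Yp X A (\<lambda>n w t. 0)) N)
    \<comment> \<open>theta-hat_ANC (b_t = beta)\<close>
     \<and> (\<exists>N. is_mvnormal 0 (V_SR M Yp X \<pi> (\<lambda>_. beta_bar M Yp X \<pi>)) N \<and>
            conv_in_distr (law_est M Yp X A (\<lambda>n w t. beta_hat_ANC Yp X A n w)) N)
    \<comment> \<open>theta-hat_ANHC (b_t = beta_t), both versions of beta-hat_t\<close>
     \<and> (\<exists>N. is_mvnormal 0 (V_SR M Yp X \<pi> (beta M Yp X)) N \<and>
            conv_in_distr (law_est M Yp X A (beta_hat_ANHC Yp X A)) N)
     \<and> (\<exists>N. is_mvnormal 0 (V_SR M Yp X \<pi> (beta M Yp X)) N \<and>
            conv_in_distr (law_est M Yp X A (beta_hat_ANHC' Yp X A)) N)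
    \<comment> \<open>(ii) V_SR(B) - V_SR(script B) is positive semidefinite for every B\<close>
     \<and> (\<forall>(b :: 'k \<Rightarrow> real^'p) (c :: real^'k).
          0 \<le> c \<bullet> ((V_SR M Yp X \<pi> b - V_SR M Yp X \<pi> (beta M Yp X)) *v c))"
proof -
  interpret prob_space M by (rule P)
  let ?C = "count_space (UNIV :: 'k set)"
  let ?W = "\<lambda>i w. (Yp i w, Z i w, X i w)"
  note pair = indep_vars_Pair[OF A_indep iid_indep A_W_indep] distr_Pair_eq[OF A_indep iid_indep A_W_indep]
    indep_var_functions[OF A_indep iid_indep A_W_indep]
  have rvA: "A i \<in> measurable M ?C" for i using A_indep by (simp add: indep_vars_def2)
  have distr_A: "distr M ?C (A i) = distr M ?C (A 0)" for i
  proof (rule measure_eqI_finite[where A = UNIV])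
    fix t :: 'k
    have "emeasure (distr M ?C (A i)) {t} = ennreal (\<pi> t)" for i
    proof -
      have "A i -` {t} \<inter> space M = {w \<in> space M. A i w = t}" by auto
      then show ?thesis using A_prob[of i t] rvA by (simp add: emeasure_distr emeasure_eq_measure)
    qed
    then show "emeasure (distr M ?C (A i)) {t} = emeasure (distr M ?C (A 0)) {t}" by simp
  qed simp_all
  have iid_pair: "iid (?C \<Otimes>\<^sub>M MW) (\<lambda>i w. (A i w, ?W i w))"
    unfolding iid_def
  proof (intro conjI allI)
    show "indep_vars (\<lambda>_. ?C \<Otimes>\<^sub>M MW) (\<lambda>i w. (A i w, ?W i w)) UNIV" by (rule pair(1))
    show "distr M (?C \<Otimes>\<^sub>M MW) (\<lambda>w. (A i w, ?W i w)) = distr M (?C \<Otimes>\<^sub>M MW) (\<lambda>w. (A 0 w, ?W 0 w))" for i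
      unfolding pair(2) distr_A[of i] iid_distr[of i] ..
  qed
  have drop_Z: "(\<lambda>(y, z, x). (y, x)) \<in> measurable MW (borel \<Otimes>\<^sub>M borel)"
    unfolding MW_def by measurable
  interpret simple_randomized_trial M Yp X A \<pi>
  proof unfold_locales
    have "(\<lambda>(a, d). (a, (\<lambda>(y, z, x). (y, x)) d)) \<in> measurable (?C \<Otimes>\<^sub>M MW) (?C \<Otimes>\<^sub>M (borel \<Otimes>\<^sub>M borel))"
      using drop_Z by measurable
    from iid_compose[OF iid_pair this]
    show "iid (?C \<Otimes>\<^sub>M (borel \<Otimes>\<^sub>M borel)) (\<lambda>i w. (A i w, Yp i w, X i w))" by simp
  next
    fix f :: "'k \<Rightarrow> real" and g :: "(real^'k) \<times> (real^'p) \<Rightarrow> real"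
    assume "g \<in> borel_measurable (borel \<Otimes>\<^sub>M borel)"
    from pair(3)[OF _ measurable_compose[OF drop_Z this], of f borel 0]
    show "indep_var borel (\<lambda>w. f (A 0 w)) borel (\<lambda>w. g (Yp 0 w, X 0 w))" by simp
  qed (use assms in auto)
  have general: "\<exists>N. is_mvnormal 0 (V_SR M Yp X \<pi> b) N \<and> conv_in_distr (law_est M Yp X A bhat) N"
    if meas: "\<And>n t. (\<lambda>w. bhat n w t) \<in> borel_measurable M"
      and lim: "\<And>t e. e > 0 \<Longrightarrow> (\<lambda>n. measure M {w \<in> space M. norm (bhat n w t - b t) > e}) \<longlonglongrightarrow> 0"
    for bhat :: "nat \<Rightarrow> 'a \<Rightarrow> 'k \<Rightarrow> real^'p" and b
  proof (rule estimator_clt[OF meas])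
    fix t
    show "tendsto_prob (\<lambda>n w. bhat n w t) (b t)"
      unfolding tendsto_prob_def
    proof (intro allI impI)
      fix e :: real assume "e > 0"
      have "whp (\<lambda>n w. norm (bhat n w t - b t) \<le> e / 2)"
      proof (rule whp_if_prob_tendsto_0)
        note [measurable] = meas
        show "{w \<in> space M. \<not> norm (bhat n w t - b t) \<le> e / 2} \<in> events" for n by measurable
        show "(\<lambda>n. prob {w \<in> space M. \<not> norm (bhat n w t - b t) \<le> e / 2}) \<longlonglongrightarrow> 0"
          using lim[of "e / 2" t] \<open>e > 0\<close> by (simp add: not_le)
      qed
      then show "whp (\<lambda>n w. dist (bhat n w t) (b t) < e)"
        by (rule whp_mono) (use \<open>e > 0\<close> in \<open>simp add: dist_norm\<close>)
    qed
  qed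
  show ?thesis
    by (intro conjI allI impI general estimator_clt V_SR_diff_psd measurable_beta_hats tendsto_prob_const
        borel_measurable_const tendsto_prob_beta_hat_ANC tendsto_prob_beta_hat_ANHC tendsto_prob_beta_hat_ANHC') blast+
qed

end
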